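(* Let $\alpha\in\mathbb R\setminus\mathbb Q$, let $c$ be analytic on $\mathbb T$, not identically zero (zeros on $\mathbb T$ are allowed), of the form $c(\theta)=\sum_k\hat c_ke^{2\pi ik(\theta+\alpha/2)}$ with $\hat c_k\in\mathbb R$, and let $v:\mathbb T\to\mathbb R$ be Lipschitz. Then for every $\theta\notin\Theta$, the operator $H_c(\theta)$ has no eigenvalues on $\{E: L(E)<\delta_c(\alpha,\theta)\}$. In particular, for a.e. $\theta\in\mathbb T$, $H_c(\theta)$ has no eigenvalues on $\{E:L(E)<\beta(\alpha)\}$.
   Context: $\mathbb T=\mathbb R/\mathbb Z$, $\|x\|=\mathrm{dist}(x,\mathbb Z)$. $\tilde c$ is the analytic function with $\tilde c=\overline{c}$ on $\mathbb T$. The operator on $\ell^2(\mathbb Z)$ is $$(H_c(\theta)u)_n=c(\theta+n\alpha)u_{n+1}+\tilde c(\theta+(n-1)\alpha)u_{n-1}+v(\theta+n\alpha)u_n.$$ Let $\theta_1,\dots,\theta_m$ be the zeros of $c$ on $\mathbb T$, counted with multiplicity ($m=0$ if there are none), and $\Theta=\bigcup_{j=1}^m(\theta_j+\mathbb Z\alpha+\mathbb Z)$. Let $p_n/q_n$ be the continued fraction approximants of $\alpha$. Then $\beta(\alpha)=\limsup_{n\to\infty}\frac{\ln q_{n+1}}{q_n}\in[0,\infty]$ and $$\delta_c(\alpha,\theta)=\limsup_{n\to\infty}\frac{\sum_{j=1}^m\ln\|q_n(\theta-\theta_j)\|+\ln q_{n+1}}{q_n}\in[-\infty,\infty]$$ (with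 $\ln 0=-\infty$). $L(E)=\lim_{n\to\infty}\frac1n\int_{\mathbb T}\log\|A_n(\theta)\|d\theta$, where $A_n(\theta)=A(\theta+(n-1)\alpha)\cdots A(\theta)$ and $A(\theta)=\frac1{c(\theta)}\begin{pmatrix}E-v(\theta)&-\tilde c(\theta-\alpha)\\ c(\theta)&0\end{pmatrix}$. *)

theory Defs
  imports "HOL-Complex_Analysis.Complex_Analysis"
begin

text \<open>
  Functions on the circle are represented by \<open>1\<close>-periodic functions on the real line.
  An analytic function on the circle is given as a function \<open>c :: complex \<Rightarrow> complex\<close> that is
  analytic on (a neighbourhood of) \<open>\<real>\<close> and \<open>1\<close>-periodic on \<open>\<real>\<close>; its values off the real
  line enter only through the multiplicities of its real zeros, which depend only on its germ
  along \<open>\<real>\<close>.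
\<close>

definition analytic_on_circle :: "(complex \<Rightarrow> complex) \<Rightarrow> bool" where
  "analytic_on_circle c \<longleftrightarrow>
     c analytic_on \<real> \<and> (\<forall>x::real. c (of_real (x + 1)) = c (of_real x))"

definition dist_int :: "real \<Rightarrow> real" where
  "dist_int x = infdist x \<int>"

text \<open>The analytic function that coincides with the complex conjugate of \<open>c\<close> on \<open>\<real>\<close>.\<close>

definition conj_ext :: "(complex \<Rightarrow> complex) \<Rightarrow> complex \<Rightarrow> complex" where
  "conj_ext c z = cnj (c (cnj z))"

definition ell2 :: "(int \<Rightarrow> complex) set" where
  "ell2 = {u. (\<lambda>n. (norm (u n))\<^sup>2) summable_on UNIV}"

definition H_op ::
  "real \<Rightarrow> (complex \<Rightarrow> complex) \<Rightarrow> (real \<Rightarrow> real) \<Rightarrow> real \<Rightarrow> (int \<Rightarrow> complex) \<Rightarrow> int \<Rightarrow> complex" where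
  "H_op \<alpha> c v \<theta> u = (\<lambda>n.
      c (of_real (\<theta> + of_int n * \<alpha>)) * u (n + 1)
    + conj_ext c (of_real (\<theta> + of_int (n - 1) * \<alpha>)) * u (n - 1)
    + of_real (v (\<theta> + of_int n * \<alpha>)) * u n)"

definition is_eigenvalue :: "((int \<Rightarrow> complex) \<Rightarrow> (int \<Rightarrow> complex)) \<Rightarrow> real \<Rightarrow> bool" where
  "is_eigenvalue T E \<longleftrightarrow>
     (\<exists>u\<in>ell2. u \<noteq> (\<lambda>n. 0) \<and> T u = (\<lambda>n. of_real E * u n))"

text \<open>One representative in \<open>[0,1)\<close> of each zero on the circle, without multiplicity.\<close>

definition circle_zeros :: "(complex \<Rightarrow> complex) \<Rightarrow> real set" where
  "circle_zeros c = {t \<in> {0..<1}. c (of_real t) = 0}"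

definition Theta_set :: "real \<Rightarrow> (complex \<Rightarrow> complex) \<Rightarrow> real set" where
  "Theta_set \<alpha> c = (\<Union>t\<in>circle_zeros c. {t + of_int k * \<alpha> + of_int l | k l :: int. True})"

text \<open>
  Continued fraction expansion \<open>[a\<^sub>0; a\<^sub>1, a\<^sub>2, \<dots>]\<close> of an irrational number: the complete quotients
  \<open>\<alpha>\<^sub>0 = \<alpha>\<close>, \<open>\<alpha>\<^sub>n\<^sub>+\<^sub>1 = 1 / (\<alpha>\<^sub>n - a\<^sub>n)\<close>, the partial quotients \<open>a\<^sub>n = \<lfloor>\<alpha>\<^sub>n\<rfloor>\<close>, and the denominators
  \<open>q\<^sub>n\<close> of the convergents.
\<close>

primrec cf_complete :: "real \<Rightarrow> nat \<Rightarrow> real" where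
  "cf_complete \<alpha> 0 = \<alpha>"
| "cf_complete \<alpha> (Suc n) = 1 / frac (cf_complete \<alpha> n)"

definition cf_quot :: "real \<Rightarrow> nat \<Rightarrow> int" where
  "cf_quot \<alpha> n = \<lfloor>cf_complete \<alpha> n\<rfloor>"

fun cf_q :: "real \<Rightarrow> nat \<Rightarrow> int" where
  "cf_q \<alpha> 0 = 1"
| "cf_q \<alpha> (Suc 0) = cf_quot \<alpha> 1"
| "cf_q \<alpha> (Suc (Suc n)) = cf_quot \<alpha> (Suc (Suc n)) * cf_q \<alpha> (Suc n) + cf_q \<alpha> n"

definition beta :: "real \<Rightarrow> ereal" where
  "beta \<alpha> = limsup (\<lambda>n. ereal (ln (of_int (cf_q \<alpha> (Suc n))) / of_int (cf_q \<alpha> n)))"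

text \<open>The logarithm on \<open>[0,\<infinity>)\<close> with \<open>ln 0 = -\<infinity>\<close> (the library's real \<open>ln\<close> has \<open>ln 0 = 0\<close>).\<close>

definition eln :: "real \<Rightarrow> ereal" where
  "eln x = (if x = 0 then -\<infinity> else ereal (ln x))"

text \<open>
  The sum over zeros counted with multiplicity is a sum over the distinct zeros weighted by their
  orders.
\<close>

definition delta :: "real \<Rightarrow> (complex \<Rightarrow> complex) \<Rightarrow> real \<Rightarrow> ereal" where
  "delta \<alpha> c \<theta> = limsup (\<lambda>n.
     ((\<Sum>t\<in>circle_zeros c.
         ereal (of_int (zorder c (of_real t))) * eln (dist_int (of_int (cf_q \<alpha> n) * (\<theta> - t))))
      + ereal (ln (of_int (cf_q \<alpha> (Suc n))))) / ereal (of_int (cf_q \<alpha> n)))"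

definition cocycle_mat ::
  "real \<Rightarrow> (complex \<Rightarrow> complex) \<Rightarrow> (real \<Rightarrow> real) \<Rightarrow> real \<Rightarrow> real \<Rightarrow> complex^2^2" where
  "cocycle_mat \<alpha> c v E \<theta> = map_matrix (\<lambda>z. 1 / c (of_real \<theta>) * z)
     (vector [vector [of_real (E - v \<theta>), - conj_ext c (of_real (\<theta> - \<alpha>))],
              vector [c (of_real \<theta>), 0]])"

primrec cocycle_iter ::
  "real \<Rightarrow> (complex \<Rightarrow> complex) \<Rightarrow> (real \<Rightarrow> real) \<Rightarrow> real \<Rightarrow> nat \<Rightarrow> real \<Rightarrow> complex^2^2" where
  "cocycle_iter \<alpha> c v E 0 \<theta> = mat 1"
| "cocycle_iter \<alpha> c v E (Suc n) \<theta> =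
     cocycle_mat \<alpha> c v E (\<theta> + of_nat n * \<alpha>) ** cocycle_iter \<alpha> c v E n \<theta>"

text \<open>
  The matrix norm is the operator norm (the library's \<open>norm\<close> on matrices is the Frobenius norm).
  The matrices are undefined for countably many \<open>\<theta>\<close> only, which do not affect the integral.
\<close>

definition lyapunov ::
  "real \<Rightarrow> (complex \<Rightarrow> complex) \<Rightarrow> (real \<Rightarrow> real) \<Rightarrow> real \<Rightarrow> real" where
  "lyapunov \<alpha> c v E = lim (\<lambda>n.
     1 / of_nat n * (LINT \<theta>:{0..1}|lborel. ln (onorm (\<lambda>x. cocycle_iter \<alpha> c v E n \<theta> *v x))))"

end

theory Submission
  imports Defs "HOL-Computational_Algebra.Fundamental_Theorem_Algebra"
begin

text \<open>
  The argument is Gordon's: an eigenfunction cannot decay if its coefficients nearly repeat over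
  consecutive blocks whose length is a continued fraction denominator \<open>q = q\<^sub>n\<close> of \<open>\<alpha>\<close>. Put
  \<open>X\<^sub>k = (u\<^sub>k, u\<^sub>k\<^sub>-\<^sub>1)\<close>, let \<open>B(x) = c(x) A(x)\<close> be the transfer matrix with its denominator cleared, \<open>B\<^sub>q\<close>
  the product of \<open>q\<close> consecutive matrices \<open>B\<close> and \<open>C\<^sub>q\<close> the product of the corresponding values of
  \<open>c\<close>, so that \<open>C\<^sub>q(\<theta>) X\<^sub>q = B\<^sub>q(\<theta>) X\<^sub>0\<close>. If \<open>B\<^sub>q\<close> and \<open>C\<^sub>q\<close> were the same on the three blocks
  \<open>[-q, 0)\<close>, \<open>[0, q)\<close> and \<open>[q, 2q)\<close>, the Cayley-Hamilton theorem would bound \<open>X\<^sub>0\<close> by the largest of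
  \<open>X\<^sub>q\<close>, \<open>X\<^sub>2\<^sub>q\<close> and \<open>X\<^sub>-\<^sub>q\<close>, which tend to \<open>0\<close> for \<open>u\<close> in \<open>\<ell>\<^sup>2\<close>.

  The blocks differ by a rotation by \<open>q \<alpha>\<close>, which is within \<open>1/q\<^sub>n\<^sub>+\<^sub>1\<close> of an integer. Let
  \<open>I = \<integral> ln |c|\<close>. The products \<open>B\<^sub>q\<close> are at most \<open>e\<^sup>q\<^sup>(\<^sup>L\<^sup>+\<^sup>I\<^sup>+\<^sup>\<epsilon>\<^sup>)\<close>, uniformly in the phase
  (\<open>uniform_growth\<close>), and so \<open>B\<^sub>q\<close> changes by about \<open>e\<^sup>q\<^sup>(\<^sup>L\<^sup>+\<^sup>I\<^sup>+\<^sup>\<epsilon>\<^sup>)/q\<^sub>n\<^sub>+\<^sub>1\<close> from one block to the next.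
  Cayley-Hamilton is applied to the matrices \<open>B\<^sub>q\<close>, before any division by \<open>C\<^sub>q\<close>; hence this change
  has to be compared with one factor \<open>C\<^sub>q\<close> only (\<open>three_block_bound\<close>), while a perturbation of
  \<open>A\<close> itself would lose the small values of \<open>c\<close> twice.

  The size of \<open>C\<^sub>q\<close> comes from the exact identity \<open>\<Prod>\<^sub>j\<^sub><\<^sub>q |2 sin \<pi>(x + j/q)| = |2 sin \<pi>qx|\<close>: after \<open>c\<close> is
  written as a non-vanishing factor times powers of \<open>|2 sin \<pi>(x - \<theta>\<^sub>j)|\<close> (\<open>circle_factorization\<close>), it
  gives \<open>|C\<^sub>q(\<theta>)| \<ge> e\<^sup>q\<^sup>(\<^sup>I\<^sup>-\<^sup>\<epsilon>\<^sup>) \<Prod>\<^sub>j \<parallel>q(\<theta> - \<theta>\<^sub>j)\<parallel>\<close> (\<open>norm_c_prod_ge\<close>). The change of \<open>B\<^sub>q\<close> relative to \<open>C\<^sub>q\<close> is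
  therefore at most about \<open>e\<^sup>q\<^sup>(\<^sup>L\<^sup>+\<^sup>2\<^sup>\<epsilon>\<^sup>) / (q\<^sub>n\<^sub>+\<^sub>1 \<Prod>\<^sub>j \<parallel>q(\<theta> - \<theta>\<^sub>j)\<parallel>)\<close>, and \<open>L < \<delta>\<close> says that, for small \<open>\<epsilon>\<close>,
  this is exponentially small for infinitely many \<open>n\<close> (\<open>solution_bounded_below\<close>,
  \<open>no_eigenvalue_below_delta\<close>).

  For the statement about almost every phase, \<open>\<Sum>\<^sub>n |ln |2 sin \<pi>q\<^sub>n(\<theta> - \<theta>\<^sub>j)|| / q\<^sub>n\<close> has a finite integral
  over \<open>\<theta>\<close>, so its terms tend to \<open>0\<close> almost everywhere. The zeros then do not contribute to the limit
  superior that defines \<open>\<delta>\<close>, and \<open>\<beta> \<le> \<delta>\<close> (\<open>AE_beta_le_delta\<close>).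
\<close>

section \<open>The operator norm of complex two-by-two matrices\<close>

(* The dollar sign also denotes coefficients of power series, which makes matrix entries ambiguous. *)
no_notation fps_nth (infixl \<open>$\<close> 75)

definition opnorm :: "complex^2^2 \<Rightarrow> real" where
  "opnorm A = onorm (\<lambda>x. A *v x)"

lemma norm_mult_vec_le: "norm (A *v x) \<le> opnorm A * norm x"
  unfolding opnorm_def by (rule onorm) (rule matrix_vector_mul_bounded_linear)

lemma opnorm_nonneg [simp]: "0 \<le> opnorm A"
  unfolding opnorm_def by (rule onorm_pos_le) (rule matrix_vector_mul_bounded_linear)

lemma opnorm_mult_le: "opnorm (A ** B) \<le> opnorm A * opnorm B"
  using onorm_compose[OF matrix_vector_mul_bounded_linear matrix_vector_mul_bounded_linear, of A B]
  by (simp add: opnorm_def o_def matrix_vector_mul_assoc)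

lemma opnorm_add_le: "opnorm (A + B) \<le> opnorm A + opnorm B"
  using onorm_triangle[OF matrix_vector_mul_bounded_linear matrix_vector_mul_bounded_linear, of A B]
  by (simp add: opnorm_def matrix_vector_mult_add_rdistrib)

lemma opnorm_minus: "opnorm (- A) = opnorm A"
proof -
  have "(- A) *v x = - (A *v x)" for x
    by (simp add: matrix_vector_mult_def vec_eq_iff sum_negf)
  thus ?thesis
    using onorm_neg[of "(*v) A"] by (simp add: opnorm_def)
qed

lemma norm_vec2_le: "norm (x :: complex^2) \<le> norm (x$1) + norm (x$2)"
  using L2_set_le_sum[of "UNIV :: 2 set" "\<lambda>i. norm (x$i)"]
  by (simp add: norm_vec_def sum_2)

lemma norm_entry_le_opnorm: "norm (A $ i $ j) \<le> opnorm A"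
proof -
  have "A *v axis j 1 = column j A"
    by (simp add: matrix_vector_mult_def column_def axis_def vec_eq_iff if_distrib cong: if_cong)
  hence "norm (A $ i $ j) = norm ((A *v axis j 1) $ i)"
    by (simp add: column_def)
  also have "\<dots> \<le> norm (A *v axis j 1)"
    by (rule Finite_Cartesian_Product.norm_nth_le)
  also have "\<dots> \<le> opnorm A * norm (axis j (1::complex))"
    by (rule norm_mult_vec_le)
  also have "norm (axis j (1::complex)) = 1" by simp
  finally show ?thesis by simp
qed

lemma opnorm_le_entries:
  "opnorm A \<le> norm (A$1$1) + norm (A$1$2) + norm (A$2$1) + norm (A$2$2)"
  unfolding opnorm_def
proof (rule onorm_le)
  fix x :: "complex^2"
  have 1: "norm (x$1) \<le> norm x" "norm (x$2) \<le> norm x"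
    by (rule Finite_Cartesian_Product.norm_nth_le)+
  have "norm (A *v x) \<le> norm (A$1$1 * x$1 + A$1$2 * x$2) + norm (A$2$1 * x$1 + A$2$2 * x$2)"
    using norm_vec2_le[of "A *v x"] by (simp add: matrix_vector_mult_def sum_2)
  also have "\<dots> \<le> (norm (A$1$1) * norm x + norm (A$1$2) * norm x) + (norm (A$2$1) * norm x + norm (A$2$2) * norm x)"
    by (intro add_mono norm_triangle_le) (auto simp: norm_mult intro!: mult_left_mono 1)
  finally show "norm (A *v x) \<le> (norm (A$1$1) + norm (A$1$2) + norm (A$2$1) + norm (A$2$2)) * norm x"
    by (simp add: algebra_simps)
qed

lemma opnorm_diff_le: "\<bar>opnorm A - opnorm B\<bar> \<le> opnorm (A - B)"
  using opnorm_add_le[of "A - B" B] opnorm_add_le[of "B - A" A] opnorm_minus[of "A - B"] by simp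

lemma opnorm_mat_1: "opnorm (mat 1) = 1"
  by (simp add: opnorm_def onorm_id)

text \<open>
  A lower bound for the norm: it keeps the logarithm of a matrix product integrable and the Lyapunov
  exponent nonnegative.
\<close>
lemma norm_det_le_opnorm: "norm (det (A :: complex^2^2)) \<le> 2 * (opnorm A)\<^sup>2"
proof -
  have "norm (det A) \<le> norm (A$1$1) * norm (A$2$2) + norm (A$1$2) * norm (A$2$1)"
    using norm_triangle_ineq4[of "A$1$1 * A$2$2" "A$1$2 * A$2$1"] by (simp add: det_2 norm_mult)
  also have "\<dots> \<le> opnorm A * opnorm A + opnorm A * opnorm A"
    by (intro add_mono mult_mono norm_entry_le_opnorm) auto
  finally show ?thesis by (simp add: power2_eq_square)
qed

lemma continuous_on_opnorm:
  fixes F :: "real \<Rightarrow> complex^2^2"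
  assumes "\<And>i j. continuous_on UNIV (\<lambda>x. F x $ i $ j)"
  shows "continuous_on UNIV (\<lambda>x. opnorm (F x))"
proof -
  have "isCont (\<lambda>x. opnorm (F x)) x" for x
  proof -
    have c: "((\<lambda>y. F y $ i $ j) \<longlongrightarrow> F x $ i $ j) (at x)" for i j
      using assms[of i j] by (simp add: continuous_on_eq_continuous_at isCont_def)
    let ?g = "\<lambda>y. norm (F y $1$1 - F x $1$1) + norm (F y $1$2 - F x $1$2)
        + norm (F y $2$1 - F x $2$1) + norm (F y $2$2 - F x $2$2)"
    have "((\<lambda>y. ?g y) \<longlongrightarrow> ?g x) (at x)"
      by (intro tendsto_add tendsto_norm tendsto_diff tendsto_const c)
    hence g: "(?g \<longlongrightarrow> 0) (at x)" by simp
    have "norm (opnorm (F y) - opnorm (F x)) \<le> ?g y" for y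
      using order_trans[OF opnorm_diff_le[of "F y" "F x"] opnorm_le_entries[of "F y - F x"]] by simp
    hence "\<forall>\<^sub>F y in at x. norm (opnorm (F y) - opnorm (F x)) \<le> ?g y"
      by (intro always_eventually) blast
    from Lim_null_comparison[OF this g] show ?thesis
      unfolding isCont_def by (simp add: LIM_zero_iff)
  qed
  thus ?thesis by (simp add: continuous_on_eq_continuous_at)
qed

lemma opnorm_scale: "opnorm (map_matrix (\<lambda>z. k * z) A) = norm k * opnorm A"
proof (cases "k = 0")
  case True
  have "map_matrix (\<lambda>z. 0 * z) A = 0" by (simp add: map_matrix_def vec_eq_iff)
  with True show ?thesis by (simp add: opnorm_def onorm_zero)
next
  case False
  have mv: "map_matrix (\<lambda>z. k * z) A *v x = k *s (A *v x)" for k :: complex and A :: "complex^2^2" and x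
    by (simp add: matrix_vector_mult_def map_matrix_def vec_eq_iff sum_distrib_left mult_ac)
  have ns: "norm (k *s (x::complex^2)) = norm k * norm x" for k x
    unfolding norm_vec_def by (subst L2_set_right_distrib) (simp_all add: norm_mult)
  have le: "opnorm (map_matrix (\<lambda>z. k * z) A) \<le> norm k * opnorm A" for k and A :: "complex^2^2"
    by (subst (1) opnorm_def, rule onorm_le)
       (simp add: mv ns mult.assoc mult_left_mono norm_mult_vec_le)
  have "map_matrix (\<lambda>z. (1/k) * z) (map_matrix (\<lambda>z. k * z) A) = A"
    using False by (simp add: map_matrix_def vec_eq_iff)
  hence "opnorm A \<le> norm (1/k) * opnorm (map_matrix (\<lambda>z. k * z) A)"
    using le[of "1/k" "map_matrix (\<lambda>z. k * z) A"] by simp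
  hence "norm k * opnorm A \<le> opnorm (map_matrix (\<lambda>z. k * z) A)"
    using False by (simp add: norm_divide field_simps)
  thus ?thesis using le[of k A] by simp
qed

section \<open>Continued fraction convergents\<close>

fun cf_p :: "real \<Rightarrow> nat \<Rightarrow> int" where
  "cf_p \<alpha> 0 = cf_quot \<alpha> 0"
| "cf_p \<alpha> (Suc 0) = cf_quot \<alpha> 1 * cf_quot \<alpha> 0 + 1"
| "cf_p \<alpha> (Suc (Suc n)) = cf_quot \<alpha> (Suc (Suc n)) * cf_p \<alpha> (Suc n) + cf_p \<alpha> n"

lemma cf_complete_irrational: "\<alpha> \<notin> \<rat> \<Longrightarrow> cf_complete \<alpha> n \<notin> \<rat>"
proof (induction n)
  case (Suc n)
  have "frac (cf_complete \<alpha> n) \<notin> \<rat>"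
    using Suc by (metis Rats_add Rats_of_int add.commute diff_add_cancel frac_def)
  thus ?case
    by (metis Rats_divide Rats_1 cf_complete.simps(2) div_by_1 divide_divide_eq_right mult_1 )
qed simp

lemma cf_frac_pos: "\<alpha> \<notin> \<rat> \<Longrightarrow> 0 < frac (cf_complete \<alpha> n)"
  using cf_complete_irrational[of \<alpha> n] by (metis Ints_subset_Rats frac_eq_0_iff frac_ge_0 order_le_less subsetD)

lemma cf_complete_gt_1: "\<alpha> \<notin> \<rat> \<Longrightarrow> 1 < cf_complete \<alpha> (Suc n)"
  using cf_frac_pos[of \<alpha> n] frac_lt_1[of "cf_complete \<alpha> n"] by simp

lemma cf_quot_ge_1: "\<alpha> \<notin> \<rat> \<Longrightarrow> 1 \<le> cf_quot \<alpha> (Suc n)"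
  using cf_complete_gt_1[of \<alpha> n] unfolding cf_quot_def by linarith

lemma cf_q_pos: "\<alpha> \<notin> \<rat> \<Longrightarrow> 1 \<le> cf_q \<alpha> n"
proof (induction \<alpha> n rule: cf_q.induct)
  case (2 \<alpha>) thus ?case using cf_quot_ge_1[of \<alpha> 0] by simp
next
  case (3 \<alpha> n)
  have "1 * 1 \<le> cf_quot \<alpha> (Suc (Suc n)) * cf_q \<alpha> (Suc n)"
    using cf_quot_ge_1[OF 3(3), of "Suc n"] 3 by (intro mult_mono) auto
  thus ?case using 3 by simp
qed simp

lemma cf_q_step: "\<alpha> \<notin> \<rat> \<Longrightarrow> cf_q \<alpha> (Suc n) + cf_q \<alpha> n \<le> cf_q \<alpha> (Suc (Suc n))"
  using cf_quot_ge_1[of \<alpha> "Suc n"] cf_q_pos[of \<alpha> "Suc n"]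
  by (simp add: mult_le_cancel_right1)

lemma cf_q_mono: "\<alpha> \<notin> \<rat> \<Longrightarrow> cf_q \<alpha> n \<le> cf_q \<alpha> (Suc n)"
  using cf_q_step[of \<alpha> "n - 1"] cf_q_pos[of \<alpha> "n-1"] cf_q_pos[of \<alpha> "Suc 0"]
  by (cases n) auto

lemma cf_q_double: "\<alpha> \<notin> \<rat> \<Longrightarrow> 2 * cf_q \<alpha> n \<le> cf_q \<alpha> (Suc (Suc n))"
  using cf_q_step[of \<alpha> n] cf_q_mono[of \<alpha> n] by linarith

lemma cf_q_ge: "\<alpha> \<notin> \<rat> \<Longrightarrow> int n \<le> cf_q \<alpha> n"
proof (induction \<alpha> n rule: cf_q.induct)
  case (2 \<alpha>) thus ?case using cf_q_pos[of \<alpha> "Suc 0"] by simp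
next
  case (3 \<alpha> n)
  thus ?case using cf_q_step[OF 3(3), of n] cf_q_pos[OF 3(3), of n] by (simp del: cf_q.simps)
qed simp

lemma cf_q_at_top: "\<alpha> \<notin> \<rat> \<Longrightarrow> filterlim (\<lambda>n. real_of_int (cf_q \<alpha> n)) at_top sequentially"
  by (rule filterlim_at_top_mono[OF filterlim_real_sequentially])
     (intro always_eventually allI, metis cf_q_ge of_int_le_iff of_int_of_nat_eq)

text \<open>
  The denominators at least double over two steps, so both the even and the odd ones grow
  geometrically.
\<close>
lemma summable_inverse_cf_q:
  assumes "\<alpha> \<notin> \<rat>" shows "summable (\<lambda>n. 1 / real_of_int (cf_q \<alpha> n))"
proof -
  have pow: "2 ^ n \<le> cf_q \<alpha> (2 * n)" "2 ^ n \<le> cf_q \<alpha> (Suc (2 * n))" for n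
  proof (induction n)
    case 0 show "2 ^ 0 \<le> cf_q \<alpha> (2 * 0)" "2 ^ 0 \<le> cf_q \<alpha> (Suc (2 * 0))"
      using cf_q_pos[OF assms, of "Suc 0"] by auto
  next
    case (Suc n)
    show "2 ^ Suc n \<le> cf_q \<alpha> (2 * Suc n)"
      using Suc cf_q_double[OF assms, of "2 * n"] by simp
    show "2 ^ Suc n \<le> cf_q \<alpha> (Suc (2 * Suc n))"
      using Suc cf_q_double[OF assms, of "Suc (2 * n)"] by simp
  qed
  have "summable (\<lambda>n. norm (1 / real_of_int (cf_q \<alpha> n)))"
  proof (rule summableI_nonneg_bounded)
    fix n
    have "(\<Sum>i<n. norm (1 / real_of_int (cf_q \<alpha> i))) \<le> (\<Sum>i<2*n. 1 / real_of_int (cf_q \<alpha> i))"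
      using cf_q_pos[OF assms] by (subst sum.cong[OF refl, of _ _ "\<lambda>i. 1 / real_of_int (cf_q \<alpha> i)"])
         (auto intro!: sum_mono2 simp: order_trans[OF zero_le_one])
    also have "\<dots> = (\<Sum>i<n. 1 / real_of_int (cf_q \<alpha> (2*i)) + 1 / real_of_int (cf_q \<alpha> (Suc (2*i))))"
      by (induction n) auto
    also have "\<dots> \<le> (\<Sum>i<n. 2 * (1/2)^i)"
    proof (intro sum_mono)
      fix i
      have "1 / real_of_int (cf_q \<alpha> (2*i)) \<le> 1 / 2^i" "1 / real_of_int (cf_q \<alpha> (Suc (2*i))) \<le> 1 / 2^i"
        using of_int_le_iff[where 'a=real, THEN iffD2, OF pow(1)[of i]]
          of_int_le_iff[where 'a=real, THEN iffD2, OF pow(2)[of i]]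
        by (auto intro!: frac_le)
      thus "1 / real_of_int (cf_q \<alpha> (2*i)) + 1 / real_of_int (cf_q \<alpha> (Suc (2*i))) \<le> 2 * (1/2)^i"
        by (simp add: power_one_over)
    qed
    also have "\<dots> \<le> 4"
      using sum_le_suminf[of "\<lambda>i. 2 * (1/2::real)^i" "{..<n}"] suminf_mult[of "\<lambda>i. (1/2::real)^i" 2] suminf_geometric[of "1/2::real"]
      by (auto intro!: summable_mult summable_geometric)
    finally show "(\<Sum>i<n. norm (1 / real_of_int (cf_q \<alpha> i))) \<le> 4" .
  qed simp
  thus ?thesis by (rule summable_norm_cancel)
qed

lemma cf_determinant: "cf_p \<alpha> (Suc n) * cf_q \<alpha> n - cf_p \<alpha> n * cf_q \<alpha> (Suc n) = (-1) ^ n"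
  by (induction n) (auto simp: algebra_simps)

lemma coprime_cf: "coprime (cf_p \<alpha> n) (cf_q \<alpha> n)"
proof (rule coprimeI)
  fix d assume "d dvd cf_p \<alpha> n" "d dvd cf_q \<alpha> n"
  hence "d dvd (cf_p \<alpha> (Suc n) * cf_q \<alpha> n - cf_p \<alpha> n * cf_q \<alpha> (Suc n))" by simp
  moreover have "(-1 :: int) ^ n dvd 1" by (cases "even n") auto
  ultimately show "is_unit d" unfolding cf_determinant by (rule dvd_trans)
qed

text \<open>
  The errors \<open>q\<^sub>n \<alpha> - p\<^sub>n\<close> satisfy the same recursion as \<open>q\<^sub>n\<close> and \<open>p\<^sub>n\<close>; as the partial quotient is
  \<open>1/x - x'\<close>, with \<open>x\<close> and \<open>x'\<close> consecutive fractional parts, the recursion of order two collapses to one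
  of order one.
\<close>
lemma cf_remainder_step:
  assumes "\<alpha> \<notin> \<rat>"
  shows "of_int (cf_q \<alpha> (Suc n)) * \<alpha> - of_int (cf_p \<alpha> (Suc n))
       = - (of_int (cf_q \<alpha> n) * \<alpha> - of_int (cf_p \<alpha> n)) * frac (cf_complete \<alpha> (Suc n))"
proof (induction n)
  case 0
  have "frac \<alpha> \<noteq> 0" using cf_frac_pos[OF assms, of 0] by simp
  moreover define f a where "f = frac \<alpha>" and "a = real_of_int (cf_quot \<alpha> 0)"
  have \<alpha>: "\<alpha> = f + a" by (simp add: f_def a_def cf_quot_def frac_def)
  have "frac (cf_complete \<alpha> (Suc 0)) = 1 / f - of_int (cf_quot \<alpha> 1)"
    by (simp add: f_def cf_quot_def) (simp add: frac_def)
  moreover have "of_int (cf_q \<alpha> (Suc 0)) * \<alpha> - of_int (cf_p \<alpha> (Suc 0)) = of_int (cf_quot \<alpha> 1) * f - 1"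
    using arg_cong[OF \<alpha>, of "\<lambda>x. of_int (cf_quot \<alpha> 1) * x"] by (simp add: a_def algebra_simps)
  moreover have "of_int (cf_q \<alpha> 0) * \<alpha> - of_int (cf_p \<alpha> 0) = f"
    using \<alpha> by (simp add: a_def)
  moreover have "f \<noteq> 0" using calculation(1) by (simp add: f_def)
  ultimately show ?case by (simp add: right_diff_distrib del: cf_complete.simps cf_q.simps cf_p.simps)
next
  case (Suc n)
  have x: "frac (cf_complete \<alpha> (Suc n)) \<noteq> 0" using cf_frac_pos[OF assms, of "Suc n"] by linarith
  define d where "d = (\<lambda>n. real_of_int (cf_q \<alpha> n) * \<alpha> - of_int (cf_p \<alpha> n))"
  have IH: "d (Suc n) = - d n * frac (cf_complete \<alpha> (Suc n))" using Suc unfolding d_def .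
  have "d (Suc (Suc n)) = of_int (cf_quot \<alpha> (Suc (Suc n))) * d (Suc n) + d n"
    by (simp add: d_def algebra_simps)
  also have "of_int (cf_quot \<alpha> (Suc (Suc n))) = 1 / frac (cf_complete \<alpha> (Suc n)) - frac (cf_complete \<alpha> (Suc (Suc n)))"
    by (simp add: cf_quot_def, simp add: frac_def)
  also have "\<dots> * d (Suc n) + d n = - d (Suc n) * frac (cf_complete \<alpha> (Suc (Suc n)))"
    using x unfolding IH by (simp add: field_simps)
  finally show ?case unfolding d_def .
qed

text \<open>
  With \<open>x\<^sub>n\<^sub>+\<^sub>1\<close> the fractional part of the complete quotient, the quantity
  \<open>|q\<^sub>n \<alpha> - p\<^sub>n| (q\<^sub>n\<^sub>+\<^sub>1 + q\<^sub>n x\<^sub>n\<^sub>+\<^sub>1)\<close> does not depend on \<open>n\<close> and equals \<open>1\<close>.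
\<close>
lemma cf_approx:
  assumes "\<alpha> \<notin> \<rat>"
  shows "\<bar>of_int (cf_q \<alpha> n) * \<alpha> - of_int (cf_p \<alpha> n)\<bar> \<le> 1 / of_int (cf_q \<alpha> (Suc n))"
proof -
  define d where "d = (\<lambda>n. \<bar>real_of_int (cf_q \<alpha> n) * \<alpha> - of_int (cf_p \<alpha> n)\<bar>)"
  define x where "x = (\<lambda>n. frac (cf_complete \<alpha> n))"
  have x: "0 < x n" for n unfolding x_def by (rule cf_frac_pos[OF assms])
  have ds: "d (Suc n) = d n * x (Suc n)" for n
    using x[of "Suc n"] unfolding d_def cf_remainder_step[OF assms] x_def by (simp add: abs_mult)
  have a: "of_int (cf_quot \<alpha> (Suc n)) = 1 / x n - x (Suc n)" for n
    by (simp add: cf_quot_def x_def, simp add: frac_def)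
  have "d n * (of_int (cf_q \<alpha> (Suc n)) + of_int (cf_q \<alpha> n) * x (Suc n)) = 1"
  proof (induction n)
    case 0
    have "d 0 = x 0" by (simp add: d_def x_def cf_quot_def frac_def)
    thus ?case using a[of 0] x[of 0] by simp
  next
    case (Suc n)
    have "of_int (cf_q \<alpha> (Suc (Suc n))) + of_int (cf_q \<alpha> (Suc n)) * x (Suc (Suc n))
        = (1 / x (Suc n)) * of_int (cf_q \<alpha> (Suc n)) + of_int (cf_q \<alpha> n)"
      by (simp add: a algebra_simps)
    thus ?case using Suc x[of "Suc n"] ds[of n] by (simp add: field_simps)
  qed
  moreover have "0 \<le> d n * (of_int (cf_q \<alpha> n) * x (Suc n))"
    using x[of "Suc n"] cf_q_pos[OF assms, of n] by (simp add: d_def)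
  ultimately have "d n * of_int (cf_q \<alpha> (Suc n)) \<le> 1" by (simp add: distrib_left)
  moreover have "real_of_int (cf_q \<alpha> (Suc n)) > 0" using cf_q_pos[OF assms, of "Suc n"] by simp
  ultimately show ?thesis unfolding d_def by (simp add: field_simps)
qed

section \<open>Integration over the circle\<close>

abbreviation circle_measure :: "real measure" where
  "circle_measure \<equiv> restrict_space lborel {0..<1}"

lemma periodic_int_shift:
  fixes f :: "real \<Rightarrow> 'a"
  assumes "\<And>x. f (x + 1) = f x"
  shows "f (x + of_int n) = f x"
proof -
  have nat: "f (x + of_nat m) = f x" for m x
  proof (induction m)
    case (Suc m) thus ?case using assms[of "x + of_nat m"] by (simp add: add_ac)
  qed simp
  show ?thesis
  proof (cases "n \<ge> 0")
    case True thus ?thesis using nat[of x "nat n"] by simp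
  next
    case False
    hence e: "x + of_int n + of_nat (nat (- n)) = x" by simp
    show ?thesis using nat[of "x + of_int n" "nat (- n)"] unfolding e by simp
  qed
qed

lemma periodic_frac:
  fixes f :: "real \<Rightarrow> 'a"
  assumes "\<And>x. f (x + 1) = f x"
  shows "f (frac x) = f x"
  using periodic_int_shift[of f "frac x" "\<lfloor>x\<rfloor>", OF assms] by (simp add: frac_def)

text \<open>
  Unfolding: the interval is cut at the integers and the pieces are translated into \<open>[0,1)\<close>, where
  every point is covered exactly \<open>k\<close> times.
\<close>
lemma nn_integral_period_interval:
  fixes \<phi> :: "real \<Rightarrow> ennreal" and k :: nat and s :: real
  assumes [measurable]: "\<phi> \<in> borel_measurable borel" and per: "\<And>x. \<phi> (x + 1) = \<phi> x"
  shows "(\<integral>\<^sup>+y. \<phi> y * indicator {s..<s + k} y \<partial>lborel)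
       = of_nat k * (\<integral>\<^sup>+y. \<phi> y * indicator {0..<1} y \<partial>lborel)"
proof -
  define N where "N = {\<lfloor>s\<rfloor>..\<lfloor>s\<rfloor> + int k}"
  have fin: "finite N" by (simp add: N_def)
  let ?I = "indicator {s..<s + k} :: real \<Rightarrow> ennreal"
  have tile: "?I y = (\<Sum>n\<in>N. ?I y * indicator {of_int n..<of_int n + 1} y)" for y
  proof (cases "y \<in> {s..<s + k}")
    case True
    have "\<lfloor>y\<rfloor> \<in> N" using True unfolding N_def by (auto, linarith+)
    moreover have "(indicator {of_int n..<of_int n + 1} y :: ennreal) = (if n = \<lfloor>y\<rfloor> then 1 else 0)" for n
    proof -
      have "y \<in> {of_int n..<of_int n + 1} \<longleftrightarrow> n = \<lfloor>y\<rfloor>"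
        unfolding eq_commute[of n] floor_eq_iff by simp
      thus ?thesis by (simp only: indicator_def of_bool_def)
    qed
    ultimately show ?thesis using True fin by simp
  qed simp
  have count: "(\<Sum>n\<in>N. ?I (of_int n + y)) = of_nat k" if y: "y \<in> {0..<1}" for y
  proof -
    have "{n \<in> N. of_int n + y \<in> {s..<s + k}} = {\<lceil>s - y\<rceil>..<\<lceil>s - y\<rceil> + int k}"
      using y unfolding N_def by (auto simp: le_floor_iff ceiling_le_iff) linarith+
    hence "card {n \<in> N. of_int n + y \<in> {s..<s + k}} = k" by simp
    moreover have "(\<Sum>n\<in>N. ?I (of_int n + y)) = of_nat (card {n \<in> N. of_int n + y \<in> {s..<s + k}})"
      using fin by (simp add: indicator_def sum.If_cases Int_def)
    ultimately show ?thesis by simp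
  qed
  have "(\<integral>\<^sup>+y. \<phi> y * ?I y \<partial>lborel)
      = (\<integral>\<^sup>+y. (\<Sum>n\<in>N. \<phi> y * ?I y * indicator {of_int n..<of_int n + 1} y) \<partial>lborel)"
    by (subst tile) (simp add: sum_distrib_left mult_ac)
  also have "\<dots> = (\<Sum>n\<in>N. \<integral>\<^sup>+y. \<phi> y * ?I y * indicator {of_int n..<of_int n + 1} y \<partial>lborel)"
    by (rule nn_integral_sum) measurable
  also have "\<dots> = (\<Sum>n\<in>N. \<integral>\<^sup>+y. \<phi> y * ?I (of_int n + y) * indicator {0..<1} y \<partial>lborel)"
  proof (intro sum.cong refl)
    fix n
    have p: "\<phi> (of_int n + y) = \<phi> y" for y
      using periodic_int_shift[of \<phi> y n, OF per] by (simp add: add.commute)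
    have i: "(indicator {of_int n..<of_int n + 1} (of_int n + y) :: ennreal) = indicator {0..<1} y" for y :: real
      by (auto simp: indicator_def)
    show "(\<integral>\<^sup>+y. \<phi> y * ?I y * indicator {of_int n..<of_int n + 1} y \<partial>lborel)
       = (\<integral>\<^sup>+y. \<phi> y * ?I (of_int n + y) * indicator {0..<1} y \<partial>lborel)"
      by (subst nn_integral_real_affine[where c=1 and t="of_int n"]) (simp_all add: p i)
  qed
  also have "\<dots> = (\<integral>\<^sup>+y. (\<Sum>n\<in>N. \<phi> y * ?I (of_int n + y) * indicator {0..<1} y) \<partial>lborel)"
    by (rule nn_integral_sum[symmetric]) measurable
  also have "\<dots> = (\<integral>\<^sup>+y. of_nat k * (\<phi> y * indicator {0..<1} y) \<partial>lborel)"
  proof (intro nn_integral_cong)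
    fix y :: real
    show "(\<Sum>n\<in>N. \<phi> y * ?I (of_int n + y) * indicator {0..<1} y) = of_nat k * (\<phi> y * indicator {0..<1} y)"
    proof (cases "y \<in> {0..<1}")
      case True
      have "(\<Sum>n\<in>N. \<phi> y * ?I (of_int n + y)) = \<phi> y * of_nat k"
        using count[OF True] by (simp flip: sum_distrib_left)
      thus ?thesis using True by (simp add: mult.commute)
    qed simp
  qed
  also have "\<dots> = of_nat k * (\<integral>\<^sup>+y. \<phi> y * indicator {0..<1} y \<partial>lborel)"
    by (rule nn_integral_cmult) measurable
  finally show ?thesis .
qed

lemma nn_integral_circle_affine:
  fixes \<phi> :: "real \<Rightarrow> ennreal" and k :: nat
  assumes [measurable]: "\<phi> \<in> borel_measurable borel" and per: "\<And>x. \<phi> (x + 1) = \<phi> x" and k: "k \<ge> 1"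
  shows "(\<integral>\<^sup>+x. \<phi> (k * x + s) \<partial>circle_measure) = (\<integral>\<^sup>+x. \<phi> x \<partial>circle_measure)"
proof -
  have i: "(indicator {s..<s + k} (s + k * x) :: ennreal) = indicator {0..<1} x" for x :: real
    using k by (auto simp: indicator_def zero_le_mult_iff)
  have "of_nat k * (\<integral>\<^sup>+y. \<phi> y * indicator {0..<1} y \<partial>lborel) = (\<integral>\<^sup>+y. \<phi> y * indicator {s..<s + k} y \<partial>lborel)"
    using nn_integral_period_interval[OF assms(1) per, where s=s and k=k] by simp
  also have "\<dots> = of_nat k * (\<integral>\<^sup>+x. \<phi> (k * x + s) * indicator {0..<1} x \<partial>lborel)"
    using k by (subst nn_integral_real_affine[where c="real k" and t=s])
      (simp_all add: i add.commute ennreal_of_nat_eq_real_of_nat)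
  finally have "(\<integral>\<^sup>+x. \<phi> (k * x + s) * indicator {0..<1} x \<partial>lborel) = (\<integral>\<^sup>+y. \<phi> y * indicator {0..<1} y \<partial>lborel)"
    using k by (subst (asm) ennreal_mult_cancel_left) (auto simp: of_nat_eq_iff)
  thus ?thesis by (simp add: nn_integral_restrict_space)
qed

text \<open>
  The maps \<open>x \<mapsto> kx + s\<close> preserve the measure of the circle. Stated for image measures, this transfers
  integrability and integrals of signed functions at once.
\<close>
lemma distr_circle_affine:
  fixes k :: nat
  assumes k: "k \<ge> 1"
  shows "distr circle_measure borel (\<lambda>x. frac (k * x + s)) = distr circle_measure borel frac"
proof (rule measure_eqI)
  fix A :: "real set" assume "A \<in> sets (distr circle_measure borel (\<lambda>x. frac (k * x + s)))"
  hence A [measurable]: "A \<in> sets borel" by simp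
  have "frac \<in> borel_measurable (borel :: real measure)" unfolding frac_def by measurable
  note [measurable] = this
  have m: "(\<lambda>x. frac (k * x + s)) \<in> measurable circle_measure borel" "frac \<in> measurable circle_measure borel"
    by (auto intro!: measurable_restrict_space1)
  have "emeasure (distr circle_measure borel (\<lambda>x. frac (k * x + s))) A
      = (\<integral>\<^sup>+x. indicator A (frac (k * x + s)) \<partial>circle_measure)"
    using nn_integral_distr[OF m(1), of "indicator A"] by simp
  also have "\<dots> = (\<integral>\<^sup>+x. indicator A (frac x) \<partial>circle_measure)"
    by (rule nn_integral_circle_affine[of "\<lambda>x. indicator A (frac x)", OF _ _ k]) (auto simp: frac_1_eq)
  also have "\<dots> = emeasure (distr circle_measure borel frac) A"
    using nn_integral_distr[OF m(2), of "indicator A"] by simp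
  finally show "emeasure (distr circle_measure borel (\<lambda>x. frac (k * x + s))) A
      = emeasure (distr circle_measure borel frac) A" .
qed simp

lemma
  fixes f :: "real \<Rightarrow> real" and k :: nat
  assumes f [measurable]: "f \<in> borel_measurable borel" and per: "\<And>x. f (x + 1) = f x" and k: "k \<ge> 1"
  shows integral_circle_affine: "(\<integral>x. f (k * x + s) \<partial>circle_measure) = (\<integral>x. f x \<partial>circle_measure)"
    and integrable_circle_affine:
      "integrable circle_measure (\<lambda>x. f (k * x + s)) \<longleftrightarrow> integrable circle_measure f"
proof -
  have "frac \<in> borel_measurable (borel :: real measure)" unfolding frac_def by measurable
  note [measurable] = this
  have m: "(\<lambda>x. frac (k * x + s)) \<in> measurable circle_measure borel" "frac \<in> measurable circle_measure borel"
    by (auto intro!: measurable_restrict_space1)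
  note fr = periodic_frac[of f, OF per]
  show "(\<integral>x. f (k * x + s) \<partial>circle_measure) = (\<integral>x. f x \<partial>circle_measure)"
    using integral_distr[OF m(1) f] integral_distr[OF m(2) f] distr_circle_affine[OF k, of s]
    by (simp add: fr)
  show "integrable circle_measure (\<lambda>x. f (k * x + s)) \<longleftrightarrow> integrable circle_measure f"
    using integrable_distr_eq[OF m(1) f] integrable_distr_eq[OF m(2) f] distr_circle_affine[OF k, of s]
    by (simp add: fr)
qed

lemma measure_circle [simp]: "measure circle_measure {0..<1} = 1"
  by (simp add: measure_restrict_space)

lemma finite_measure_circle: "finite_measure circle_measure"
  by (rule finite_measureI) (simp add: emeasure_restrict_space space_restrict_space)

lemma integral_circle_const [simp]: "(\<integral>x. c \<partial>circle_measure) = (c :: real)"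
  by (simp add: measure_restrict_space space_restrict_space)

lemma integrable_circle_const [simp]: "integrable circle_measure (\<lambda>x. c :: real)"
  by (rule finite_measure.integrable_const[OF finite_measure_circle])

lemma integrable_circle_continuous:
  fixes f :: "real \<Rightarrow> real"
  assumes "continuous_on UNIV f"
  shows "integrable circle_measure f"
proof -
  have "bounded (f ` {0..1})"
    by (intro compact_imp_bounded compact_continuous_image continuous_on_subset[OF assms]) auto
  then obtain B where "\<forall>y\<in>f ` {0..1}. norm y \<le> B"
    unfolding bounded_iff by blast
  hence B: "x \<in> {0..1} \<Longrightarrow> norm (f x) \<le> B" for x
    by blast
  have [measurable]: "f \<in> borel_measurable borel"
    using assms by (rule borel_measurable_continuous_onI)
  show ?thesis
    by (rule finite_measure.integrable_const_bound[OF finite_measure_circle, of _ B])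
       (use B in \<open>auto simp: AE_restrict_space_iff intro!: measurable_restrict_space1 AE_I2\<close>)
qed

lemma set_integral_unit_interval_eq_circle:
  fixes f :: "real \<Rightarrow> real"
  shows "(LINT x:{0..1}|lborel. f x) = (\<integral>x. f x \<partial>circle_measure)"
proof -
  have "(LINT x:{0..1}|lborel. f x) = (LINT x:{0..<1}|lborel. f x)"
    unfolding set_lebesgue_integral_def
    by (rule integral_discrete_difference[where X="{1}"]) (auto simp: indicator_def)
  thus ?thesis by (simp add: integral_restrict_space set_lebesgue_integral_def)
qed

section \<open>Rotation sums at continued fraction denominators\<close>

lemma bij_betw_mult_mod:
  fixes p :: int and q :: nat
  assumes "coprime p (int q)" "q > 0"
  shows "bij_betw (\<lambda>j. nat ((int j * p) mod int q)) {..<q} {..<q}"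
proof -
  let ?h = "\<lambda>j. nat ((int j * p) mod int q)"
  have inj: "inj_on ?h {..<q}"
  proof (rule inj_onI)
    fix i j assume ij: "i \<in> {..<q}" "j \<in> {..<q}" and "?h i = ?h j"
    hence "(int i * p) mod int q = (int j * p) mod int q"
      using assms(2) by (simp add: eq_nat_nat_iff)
    hence "int q dvd int i * p - int j * p" by (simp add: mod_eq_dvd_iff)
    hence "int q dvd (int i - int j) * p" by (simp add: algebra_simps)
    hence "int q dvd int i - int j"
      using assms(1) by (simp add: coprime_commute coprime_dvd_mult_left_iff)
    hence "int i mod int q = int j mod int q" by (simp add: mod_eq_dvd_iff)
    thus "i = j" using ij by simp
  qed
  moreover have "?h ` {..<q} = {..<q}"
    using assms(2) by (intro endo_inj_surj inj) (auto simp: nat_less_iff)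
  ultimately show ?thesis by (simp add: bij_betw_def)
qed

lemma periodic_rotation_point:
  fixes f :: "real \<Rightarrow> 'a" and q :: nat
  assumes per: "\<And>x. f (x + 1) = f x" and "q > 0"
  shows "f (x + real j * (of_int p / real q)) = f (x + real (nat ((int j * p) mod int q)) / real q)"
proof -
  have "real j * of_int p = of_int ((int j * p) div int q) * real q + of_int ((int j * p) mod int q)"
    by (metis div_mult_mod_eq of_int_add of_int_mult of_int_of_nat_eq)
  hence "x + real j * (of_int p / real q) = (x + real (nat ((int j * p) mod int q)) / real q) + of_int ((int j * p) div int q)"
    using assms(2) by (simp add: field_simps)
  thus ?thesis
    using periodic_int_shift[of f "x + real (nat ((int j * p) mod int q)) / real q" "(int j * p) div int q", OF per]
    by (simp only:)
qed

lemma sum_rotation_eq: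
  fixes f :: "real \<Rightarrow> real" and q :: nat
  assumes "\<And>x. f (x + 1) = f x" "coprime p (int q)" "q > 0"
  shows "(\<Sum>j<q. f (x + real j * (of_int p / real q))) = (\<Sum>j<q. f (x + real j / real q))"
  unfolding periodic_rotation_point[of f, OF assms(1,3)]
  using sum.reindex_bij_betw[OF bij_betw_mult_mod[OF assms(2,3)], of "\<lambda>j. f (x + real j / real q)"] .

lemma prod_rotation_eq:
  fixes f :: "real \<Rightarrow> real" and q :: nat
  assumes "\<And>x. f (x + 1) = f x" "coprime p (int q)" "q > 0"
  shows "(\<Prod>j<q. f (x + real j * (of_int p / real q))) = (\<Prod>j<q. f (x + real j / real q))"
  unfolding periodic_rotation_point[of f, OF assms(1,3)]
  using prod.reindex_bij_betw[OF bij_betw_mult_mod[OF assms(2,3)], of "\<lambda>j. f (x + real j / real q)"] .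

lemma sum_lessThan_add:
  fixes g :: "nat \<Rightarrow> real"
  shows "(\<Sum>j<q + m. g j) = (\<Sum>j<q. g j) + (\<Sum>j<m. g (q + j))"
  by (induction m) (auto simp: add_ac)

lemma periodic_continuous_bounded:
  fixes f :: "real \<Rightarrow> real"
  assumes per: "\<And>x. f (x + 1) = f x" and "continuous_on UNIV f"
  obtains B where "B \<ge> 0" "\<And>x. \<bar>f x\<bar> \<le> B"
proof -
  have "bounded (f ` {0..1})"
    by (intro compact_imp_bounded compact_continuous_image continuous_on_subset[OF assms(2)]) auto
  then obtain B where "\<forall>y\<in>f ` {0..1}. norm y \<le> B"
    unfolding bounded_iff by blast
  hence B: "x \<in> {0..1} \<Longrightarrow> \<bar>f x\<bar> \<le> B" for x by force
  have "\<bar>f x\<bar> \<le> B" for x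
  proof -
    have "frac x \<in> {0..1}" using frac_lt_1[of x] by (simp add: less_imp_le)
    thus ?thesis using B[of "frac x"] periodic_frac[of f x, OF per] by simp
  qed
  moreover have "B \<ge> 0" using B[of 0] by simp
  ultimately show ?thesis using that by blast
qed

lemma periodic_uniformly_continuous:
  fixes f :: "real \<Rightarrow> real"
  assumes per: "\<And>x. f (x + 1) = f x" and "continuous_on UNIV f" and "e > 0"
  obtains d where "d > 0" "\<And>x y. \<bar>x - y\<bar> < d \<Longrightarrow> \<bar>f x - f y\<bar> < e"
proof -
  have "uniformly_continuous_on {-1..2} f"
    by (intro compact_uniformly_continuous continuous_on_subset[OF assms(2)]) auto
  then obtain d where d: "d > 0" "\<And>x y. x \<in> {-1..2} \<Longrightarrow> y \<in> {-1..2} \<Longrightarrow> dist y x < d \<Longrightarrow> dist (f y) (f x) < e"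
    using \<open>e > 0\<close> unfolding uniformly_continuous_on_def by metis
  have "\<bar>f x - f y\<bar> < e" if "\<bar>x - y\<bar> < min d 1" for x y
  proof -
    let ?n = "\<lfloor>x\<rfloor>"
    have "x - of_int ?n \<in> {-1..2}" by (simp, linarith)
    moreover have "y - of_int ?n \<in> {-1..2}" using that by (simp, linarith)
    ultimately have "dist (f (x - of_int ?n)) (f (y - of_int ?n)) < e"
      using that by (intro d(2)) (auto simp: dist_real_def)
    moreover have "f (z - of_int ?n) = f z" for z
      using periodic_int_shift[of f z "- ?n", OF per] by simp
    ultimately show ?thesis by (simp add: dist_real_def)
  qed
  thus ?thesis using that[of "min d 1"] d(1) by auto
qed

text \<open>
  The sum over \<open>q\<close> equispaced points has period \<open>1/q\<close> as a function of the starting point; it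
  therefore oscillates by no more than \<open>q\<close> times the oscillation of \<open>f\<close> over a distance \<open>1/q\<close>, around a
  mean value which is \<open>q\<close> times the integral of \<open>f\<close>.
\<close>
lemma equispaced_average_close:
  fixes f :: "real \<Rightarrow> real" and q :: nat
  assumes per: "\<And>x. f (x + 1) = f x" and cont: "continuous_on UNIV f" and "q > 0"
    and d: "\<And>x y. \<bar>x - y\<bar> < d \<Longrightarrow> \<bar>f x - f y\<bar> < e" "1 / real q < d"
  shows "\<bar>(\<Sum>j<q. f (x + real j / real q)) - real q * (\<integral>y. f y \<partial>circle_measure)\<bar> \<le> real q * e"
proof -
  define G where "G = (\<lambda>x. \<Sum>j<q. f (x + real j / real q))"
  have Gper: "G (x + 1 / real q) = G x" for x
  proof -
    have "G (x + 1 / real q) = (\<Sum>j<q. f (x + real (Suc j) / real q))"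
      unfolding G_def by (intro sum.cong) (auto simp: add_divide_distrib add_ac)
    also have "\<dots> = (\<Sum>j<Suc q. f (x + real j / real q)) - f (x + real 0 / real q)"
      by (subst sum.lessThan_Suc_shift) simp
    also have "\<dots> = G x + f (x + 1) - f x"
      using \<open>q > 0\<close> by (simp add: G_def)
    finally show ?thesis using per by simp
  qed
  have Gk: "G (x + of_int k / real q) = G x" for x k
    using periodic_int_shift[of "\<lambda>y. G (y / real q)" "x * real q" k] Gper \<open>q > 0\<close>
    by (simp add: add_divide_distrib)
  have osc: "\<bar>G x - G y\<bar> \<le> real q * e" for x y
  proof -
    define k where "k = \<lfloor>(x - y) * real q\<rfloor>"
    have "of_int k \<le> (x - y) * real q" "(x - y) * real q < of_int k + 1"
      unfolding k_def by linarith+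
    hence "of_int k / real q \<le> x - y" "x - y < of_int k / real q + 1 / real q"
      using \<open>q > 0\<close> by (simp_all add: field_simps)
    hence c: "\<bar>x - (y + of_int k / real q)\<bar> < d" using d(2) by linarith
    have "\<bar>G x - G y\<bar> = \<bar>G x - G (y + of_int k / real q)\<bar>" by (simp add: Gk)
    also have "\<dots> \<le> (\<Sum>j<q. \<bar>f (x + real j / real q) - f (y + of_int k / real q + real j / real q)\<bar>)"
      unfolding G_def by (simp add: sum_abs flip: sum_subtractf)
    also have "\<dots> \<le> (\<Sum>j<q. e)"
    proof (intro sum_mono)
      fix j
      have "\<bar>(x + real j / real q) - (y + of_int k / real q + real j / real q)\<bar> < d" using c by simp
      from d(1)[OF this] show "\<bar>f (x + real j / real q) - f (y + of_int k / real q + real j / real q)\<bar> \<le> e"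
        by simp
    qed
    finally show ?thesis by simp
  qed
  have intf: "integrable circle_measure f" by (rule integrable_circle_continuous[OF cont])
  have [measurable]: "f \<in> borel_measurable borel" using cont by (rule borel_measurable_continuous_onI)
  have sh: "integrable circle_measure (\<lambda>y. f (y + s))" "(\<integral>y. f (y + s) \<partial>circle_measure) = (\<integral>y. f y \<partial>circle_measure)" for s
    using integrable_circle_affine[of f 1 s, OF _ per] integral_circle_affine[of f 1 s, OF _ per] intf by simp_all
  have intG: "integrable circle_measure G" unfolding G_def by (intro Bochner_Integration.integrable_sum sh)
  have "(\<integral>y. G y \<partial>circle_measure) = real q * (\<integral>y. f y \<partial>circle_measure)"
    unfolding G_def by (subst Bochner_Integration.integral_sum) (simp_all add: sh)
  hence "G x - real q * (\<integral>y. f y \<partial>circle_measure) = (\<integral>y. G x - G y \<partial>circle_measure)"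
    using intG by (subst Bochner_Integration.integral_diff) simp_all
  also have "\<bar>\<dots>\<bar> \<le> (\<integral>y. \<bar>G x - G y\<bar> \<partial>circle_measure)" by (rule integral_abs_bound)
  also have "\<dots> \<le> (\<integral>y. real q * e \<partial>circle_measure)"
    using intG osc by (intro integral_mono) (auto intro!: integrable_abs Bochner_Integration.integrable_diff)
  finally show ?thesis by (simp add: G_def)
qed

lemma cf_rotation_shift_le:
  assumes irr: "\<alpha> \<notin> \<rat>" and j: "j < nat (cf_q \<alpha> n)"
  shows "\<bar>real j * \<alpha> - real j * (of_int (cf_p \<alpha> n) / real (nat (cf_q \<alpha> n)))\<bar> \<le> 1 / of_int (cf_q \<alpha> (Suc n))"
proof -
  have q: "real (nat (cf_q \<alpha> n)) = of_int (cf_q \<alpha> n)" "real_of_int (cf_q \<alpha> n) > 0"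
    using cf_q_pos[OF irr, of n] by auto
  have "\<bar>real j * \<alpha> - real j * (of_int (cf_p \<alpha> n) / of_int (cf_q \<alpha> n))\<bar>
      = (real j / of_int (cf_q \<alpha> n)) * \<bar>of_int (cf_q \<alpha> n) * \<alpha> - of_int (cf_p \<alpha> n)\<bar>"
  proof -
    have "real j * \<alpha> - real j * (of_int (cf_p \<alpha> n) / of_int (cf_q \<alpha> n))
        = (real j / of_int (cf_q \<alpha> n)) * (of_int (cf_q \<alpha> n) * \<alpha> - of_int (cf_p \<alpha> n))"
      using q by (simp add: field_simps)
    thus ?thesis using q by (simp add: abs_mult)
  qed
  also have "\<dots> \<le> 1 * (1 / of_int (cf_q \<alpha> (Suc n)))"
    using j q by (intro mult_mono cf_approx irr) (auto simp: field_simps)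
  finally show ?thesis using q by simp
qed

text \<open>
  The first \<open>q\<^sub>n\<close> points of an orbit stay within \<open>1/q\<^sub>n\<^sub>+\<^sub>1\<close> of the orbit of the rotation by \<open>p\<^sub>n/q\<^sub>n\<close>, which
  consists of \<open>q\<^sub>n\<close> equispaced points. Hence the sum is a Riemann sum, uniformly in the starting point.
\<close>
lemma rotation_sum_cf_q:
  fixes f :: "real \<Rightarrow> real"
  assumes irr: "\<alpha> \<notin> \<rat>" and per: "\<And>x. f (x + 1) = f x" and cont: "continuous_on UNIV f" and "e > 0"
  shows "\<forall>\<^sub>F n in sequentially. \<forall>x. \<bar>(\<Sum>j<nat (cf_q \<alpha> n). f (x + real j * \<alpha>))
            - of_int (cf_q \<alpha> n) * (\<integral>y. f y \<partial>circle_measure)\<bar> \<le> of_int (cf_q \<alpha> n) * e"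
proof -
  obtain d where d: "d > 0" "\<And>x y. \<bar>x - y\<bar> < d \<Longrightarrow> \<bar>f x - f y\<bar> < e / 2"
    using periodic_uniformly_continuous[OF per cont, of "e / 2"] \<open>e > 0\<close> by auto
  have "\<forall>\<^sub>F n in sequentially. 1 / d < of_int (cf_q \<alpha> n)"
    using cf_q_at_top[OF irr] by (simp add: filterlim_at_top_dense)
  thus ?thesis
  proof eventually_elim
    case (elim n)
    define q where "q = nat (cf_q \<alpha> n)"
    have qp: "q > 0" and q: "int q = cf_q \<alpha> n" using cf_q_pos[OF irr, of n] by (auto simp: q_def)
    have qd: "1 / real q < d" and qd': "1 / of_int (cf_q \<alpha> (Suc n)) < d"
    proof -
      have 1: "1 / d < real q" using elim q by (metis of_int_of_nat_eq)
      thus "1 / real q < d" using d(1) qp by (simp add: field_simps)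
      have "1 / d < of_int (cf_q \<alpha> (Suc n))" using elim cf_q_mono[OF irr, of n] by linarith
      thus "1 / of_int (cf_q \<alpha> (Suc n)) < d" using d(1) cf_q_pos[OF irr, of "Suc n"] by (simp add: field_simps)
    qed
    show ?case
    proof
      fix x
      let ?I = "\<integral>y. f y \<partial>circle_measure" and ?p = "cf_p \<alpha> n"
      have "\<bar>(\<Sum>j<q. f (x + real j * \<alpha>)) - (\<Sum>j<q. f (x + real j * (of_int ?p / real q)))\<bar>
          \<le> (\<Sum>j<q. \<bar>f (x + real j * \<alpha>) - f (x + real j * (of_int ?p / real q))\<bar>)"
        by (simp add: sum_abs flip: sum_subtractf)
      also have "\<dots> \<le> (\<Sum>j<q. e / 2)"
      proof (intro sum_mono)
        fix j assume "j \<in> {..<q}"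
        hence "\<bar>real j * \<alpha> - real j * (of_int ?p / real q)\<bar> < d"
          using cf_rotation_shift_le[OF irr, of j n] qd' by (simp add: q_def)
        hence "\<bar>(x + real j * \<alpha>) - (x + real j * (of_int ?p / real q))\<bar> < d" by simp
        from d(2)[OF this] show "\<bar>f (x + real j * \<alpha>) - f (x + real j * (of_int ?p / real q))\<bar> \<le> e / 2" by simp
      qed
      finally have 1: "\<bar>(\<Sum>j<q. f (x + real j * \<alpha>)) - (\<Sum>j<q. f (x + real j * (of_int ?p / real q)))\<bar> \<le> real q * (e / 2)"
        by simp
      have 2: "\<bar>(\<Sum>j<q. f (x + real j / real q)) - real q * ?I\<bar> \<le> real q * (e / 2)"
        by (rule equispaced_average_close[OF per cont qp d(2) qd])
      have 3: "(\<Sum>j<q. f (x + real j * (of_int ?p / real q))) = (\<Sum>j<q. f (x + real j / real q))"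
        by (rule sum_rotation_eq[of f, OF per _ qp]) (simp add: q coprime_cf)
      have "\<bar>(\<Sum>j<q. f (x + real j * \<alpha>)) - real q * ?I\<bar> \<le> real q * e"
        using 1 2 unfolding 3 by (simp add: field_simps) (smt (verit) abs_triangle_ineq)
      thus "\<bar>(\<Sum>j<nat (cf_q \<alpha> n). f (x + real j * \<alpha>)) - of_int (cf_q \<alpha> n) * ?I\<bar> \<le> of_int (cf_q \<alpha> n) * e"
        by (simp add: q_def[symmetric] flip: q)
    qed
  qed
qed

text \<open>
  A sum of arbitrary length is cut into blocks of one fixed length \<open>q\<^sub>N\<close>; the incomplete last block
  contributes a bounded amount.
\<close>
lemma rotation_sum_upper:
  fixes f :: "real \<Rightarrow> real"
  assumes irr: "\<alpha> \<notin> \<rat>" and per: "\<And>x. f (x + 1) = f x" and cont: "continuous_on UNIV f" and "e > 0"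
  obtains C where "\<And>n x. (\<Sum>j<n. f (x + real j * \<alpha>)) \<le> real n * ((\<integral>y. f y \<partial>circle_measure) + e) + C"
proof -
  let ?J = "(\<integral>y. f y \<partial>circle_measure) + e"
  obtain N where N: "\<And>x. \<bar>(\<Sum>j<nat (cf_q \<alpha> N). f (x + real j * \<alpha>))
            - of_int (cf_q \<alpha> N) * (\<integral>y. f y \<partial>circle_measure)\<bar> \<le> of_int (cf_q \<alpha> N) * e"
    using rotation_sum_cf_q[OF irr per cont \<open>e > 0\<close>] by (auto simp: eventually_sequentially)
  define q where "q = nat (cf_q \<alpha> N)"
  have qp: "q > 0" and q: "of_int (cf_q \<alpha> N) = real q" using cf_q_pos[OF irr, of N] by (auto simp: q_def)
  have block: "(\<Sum>j<q. f (x + real j * \<alpha>)) \<le> real q * ?J" for x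
    using N[of x] unfolding q q_def[symmetric] by (simp add: algebra_simps)
  obtain B where B: "B \<ge> 0" "\<And>x. \<bar>f x\<bar> \<le> B" using periodic_continuous_bounded[OF per cont] by blast
  define C where "C = real q * (B + \<bar>?J\<bar>)"
  have "(\<Sum>j<n. f (x + real j * \<alpha>)) \<le> real n * ?J + C" for n x
  proof (induction n arbitrary: x rule: less_induct)
    case (less n)
    show ?case
    proof (cases "n < q")
      case True
      have "(\<Sum>j<n. f (x + real j * \<alpha>)) \<le> (\<Sum>j<n. B)"
        using B(2) abs_le_D1 by (intro sum_mono) blast
      also have "\<dots> \<le> real n * ?J + real n * (B + \<bar>?J\<bar>)"
        by (simp flip: distrib_left add: mult_left_mono)
      also have "real n * (B + \<bar>?J\<bar>) \<le> C"
        unfolding C_def using True B(1) by (intro mult_right_mono) auto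
      finally show ?thesis by simp
    next
      case False
      then obtain m where m: "n = q + m" using le_Suc_ex not_less by blast
      have "(\<Sum>j<n. f (x + real j * \<alpha>)) = (\<Sum>j<q. f (x + real j * \<alpha>)) + (\<Sum>j<m. f ((x + real q * \<alpha>) + real j * \<alpha>))"
        unfolding m by (subst sum_lessThan_add) (simp add: algebra_simps)
      also have "\<dots> \<le> real q * ?J + (real m * ?J + C)"
        using less[of m "x + real q * \<alpha>"] qp m by (intro add_mono block) auto
      finally show ?thesis by (simp add: m algebra_simps)
    qed
  qed
  thus ?thesis using that by blast
qed

section \<open>The distance to the integers and chords of the circle\<close>

lemma dist_int_le: "dist_int x \<le> \<bar>x - of_int k\<bar>"
  using infdist_le[of "of_int k" \<int> x] by (simp add: dist_int_def dist_real_def)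

lemma dist_int_attained: obtains k where "dist_int x = \<bar>x - of_int k\<bar>"
proof -
  obtain y where "y \<in> \<int>" "infdist x \<int> = dist x y"
    using infdist_attains_inf[OF closed_Ints, of x] Ints_0 by blast
  thus ?thesis using that by (auto simp: dist_int_def dist_real_def elim!: Ints_cases)
qed

lemma dist_int_nonneg [simp]: "0 \<le> dist_int x"
  by (simp add: dist_int_def infdist_nonneg)

lemma dist_int_le_half: "dist_int x \<le> 1 / 2"
  using dist_int_le[of x "round x"] of_int_round_abs_le[of x] by (simp add: abs_minus_commute)

lemma dist_int_perturb: "dist_int x \<le> dist_int y + \<bar>x - y\<bar>"
proof -
  obtain k where k: "dist_int y = \<bar>y - of_int k\<bar>" using dist_int_attained .
  show ?thesis using dist_int_le[of x k] k by linarith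
qed

lemma dist_int_add_int: "dist_int (x + of_int k) = dist_int x"
proof -
  have le: "dist_int (x + of_int k) \<le> dist_int x" for x k
  proof -
    obtain l where l: "dist_int x = \<bar>x - of_int l\<bar>" using dist_int_attained .
    show ?thesis using dist_int_le[of "x + of_int k" "l + k"] l by simp
  qed
  show ?thesis using le[of x k] le[of "x + of_int k" "- k"] by simp
qed

lemma dist_int_nat_mult: "dist_int (real m * x) \<le> real m * dist_int x"
proof -
  obtain k where k: "dist_int x = \<bar>x - of_int k\<bar>" using dist_int_attained .
  have "dist_int (real m * x) \<le> \<bar>real m * x - of_int (int m * k)\<bar>" by (rule dist_int_le)
  also have "\<dots> = \<bar>real m * (x - of_int k)\<bar>" by (simp add: algebra_simps)
  finally show ?thesis by (simp add: k abs_mult)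
qed

text \<open>
  Below \<open>\<pi>/3\<close> the derivative of the sine is at least \<open>1/2\<close>; above, monotonicity and
  \<open>sin (\<pi>/3) > \<pi>/4\<close> suffice.
\<close>
lemma sin_ge_half:
  assumes "0 \<le> t" "t \<le> pi / 2"
  shows "t / 2 \<le> sin t"
proof (cases "t \<le> pi / 3")
  case True
  show ?thesis
  proof (cases "t = 0")
    case False
    with assms have "t > 0" by simp
    then obtain z where z: "0 < z" "z < t" "sin t - sin 0 = (t - 0) * cos z"
      using MVT2[of 0 t sin cos] DERIV_sin by blast
    have "cos (pi / 3) \<le> cos z"
      using z True by (intro cos_monotone_0_pi_le) auto
    hence "1 / 2 \<le> cos z" by (simp add: cos_60)
    hence "t * (1 / 2) \<le> t * cos z" using assms by (intro mult_left_mono) auto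
    thus ?thesis using z by simp
  qed simp
next
  case False
  have "sin (pi / 3) \<le> sin t"
    using False assms by (intro sin_monotone_2pi_le) auto
  moreover have "(16/10)\<^sup>2 \<le> (3::real)" by (simp add: power2_eq_square)
  hence "16/10 \<le> sqrt (3::real)" by (rule real_le_rsqrt)
  ultimately show ?thesis using assms pi_less_4 pi_approx by (simp add: sin_60)
qed

lemma abs_sin_pi_add_int: "\<bar>sin (pi * (x + of_int k))\<bar> = \<bar>sin (pi * x)\<bar>"
proof -
  have "sin (pi * of_int k) = 0" by (simp add: sin_zero_iff_int2 mult.commute)
  moreover from this have "\<bar>cos (pi * of_int k)\<bar> = 1"
    using sin_cos_squared_add[of "pi * of_int k"] by (simp add: power2_eq_1_iff abs_if)
  ultimately show ?thesis by (simp add: distrib_left sin_add abs_mult)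
qed

lemma dist_int_le_abs_sin: "dist_int x \<le> \<bar>sin (pi * x)\<bar>"
proof -
  obtain k where k: "dist_int x = \<bar>x - of_int k\<bar>" using dist_int_attained .
  define r where "r = x - of_int k"
  have r: "\<bar>r\<bar> \<le> 1 / 2" using dist_int_le_half[of x] k by (simp add: r_def)
  have "\<bar>r\<bar> \<le> pi * \<bar>r\<bar> / 2" using pi_ge_two mult_right_mono[of 2 pi "\<bar>r\<bar>"] by simp
  also have "\<dots> \<le> sin (pi * \<bar>r\<bar>)"
    using r by (intro sin_ge_half) (auto simp: mult_le_cancel_left_pos[of pi "\<bar>r\<bar>" "1/2", simplified])
  also have "\<dots> \<le> \<bar>sin (pi * r)\<bar>" by (auto simp: abs_if)
  also have "\<dots> = \<bar>sin (pi * x)\<bar>" using abs_sin_pi_add_int[of x "- k"] by (simp add: r_def)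
  finally show ?thesis using k by (simp add: r_def)
qed

lemma abs_sin_le_dist_int: "\<bar>sin (pi * x)\<bar> \<le> pi * dist_int x"
proof -
  obtain k where k: "dist_int x = \<bar>x - of_int k\<bar>" using dist_int_attained .
  have "\<bar>sin (pi * x)\<bar> = \<bar>sin (pi * (x - of_int k))\<bar>" using abs_sin_pi_add_int[of x "- k"] by simp
  also have "\<dots> \<le> \<bar>pi * (x - of_int k)\<bar>" by (rule abs_sin_x_le_abs_x)
  finally show ?thesis by (simp add: k abs_mult)
qed

text \<open>
  The length of the chord of the unit circle between the points \<open>1\<close> and \<open>e\<^sup>2\<^sup>\<pi>\<^sup>i\<^sup>x\<close>.
\<close>
definition chord :: "real \<Rightarrow> real" where
  "chord x = \<bar>2 * sin (pi * x)\<bar>"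

lemma chord_nonneg [simp]: "0 \<le> chord x" by (simp add: chord_def)

lemma chord_periodic: "chord (x + 1) = chord x"
  using abs_sin_pi_add_int[of x 1] by (simp add: chord_def abs_mult)

lemma chord_le_2: "chord x \<le> 2"
  by (simp add: chord_def abs_mult)

lemma chord_ge_dist_int: "2 * dist_int x \<le> chord x"
  using dist_int_le_abs_sin[of x] by (simp add: chord_def abs_mult)

lemma chord_le_dist_int: "chord x \<le> 2 * pi * dist_int x"
  using abs_sin_le_dist_int[of x] by (simp add: chord_def abs_mult)

lemma chord_lipschitz: "chord x \<le> chord y + 2 * pi * \<bar>x - y\<bar>"
proof -
  have "sin (pi * x) - sin (pi * y) = 2 * sin ((pi * x - pi * y) / 2) * cos ((pi * x + pi * y) / 2)"
    by (rule sin_diff_sin)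
  hence "\<bar>sin (pi * x) - sin (pi * y)\<bar> = 2 * \<bar>sin ((pi * x - pi * y) / 2)\<bar> * \<bar>cos ((pi * x + pi * y) / 2)\<bar>"
    by (simp add: abs_mult)
  also have "\<dots> \<le> 2 * \<bar>(pi * x - pi * y) / 2\<bar> * 1"
    by (intro mult_mono abs_sin_x_le_abs_x) auto
  also have "\<dots> = pi * \<bar>x - y\<bar>"
    by (simp add: abs_mult flip: right_diff_distrib)
  finally show ?thesis unfolding chord_def abs_mult by simp
qed

lemma continuous_on_chord [continuous_intros]:
  fixes f :: "real \<Rightarrow> real"
  assumes "continuous_on S f"
  shows "continuous_on S (\<lambda>x. chord (f x))"
  unfolding chord_def using assms by (intro continuous_intros)

lemma chord_measurable [measurable]: "chord \<in> borel_measurable borel"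
  using continuous_on_chord[of UNIV "\<lambda>x. x"] by (intro borel_measurable_continuous_onI) auto

lemma chord_eq_0_iff: "chord x = 0 \<longleftrightarrow> x \<in> \<int>"
  unfolding chord_def by (simp add: sin_times_pi_eq_0 mult.commute[of pi])

lemma norm_cis_diff_1: "norm (1 - cis (2 * pi * x)) = chord x"
proof -
  have "norm (1 - cis (2 * pi * x)) = norm (exp (\<i> * of_real (2 * pi * x)) - 1)"
    by (simp add: cis_conv_exp norm_minus_commute)
  also have "\<dots> = chord x" unfolding dist_exp_i_1 by (simp add: chord_def abs_mult)
  finally show ?thesis .
qed

lemma prod_roots_of_unity:
  assumes "n > 0"
  shows "(\<Prod>w | w ^ n = 1. z - w) = z ^ n - (1::complex)"
proof -
  define p :: "complex poly" where "p = monom 1 n + [:-1:]"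
  have ev: "poly p z = z ^ n - 1" for z by (simp add: p_def poly_monom)
  have "rsquarefree p"
  proof (unfold rsquarefree_roots, intro allI notI)
    fix a assume a: "poly p a = 0 \<and> poly (pderiv p) a = 0"
    have "pderiv p = monom (of_nat n) (n - 1)" by (simp add: p_def pderiv_add pderiv_monom pderiv_pCons)
    hence "a ^ (n - 1) = 0" using a assms by (simp add: poly_monom)
    hence "a = 0" by simp
    thus False using a assms by (simp add: ev power_0_left)
  qed
  hence "smult (lead_coeff p) (\<Prod>z | poly p z = 0. [:- z, 1:]) = p"
    by (rule complex_poly_decompose_rsquarefree)
  moreover have "lead_coeff p = 1"
  proof -
    have "degree p = n" unfolding p_def using assms
      by (subst degree_add_eq_left) (auto simp: degree_monom_eq)
    thus ?thesis using assms by (simp add: p_def coeff_pCons split: nat.split)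
  qed
  ultimately have "poly (\<Prod>z | poly p z = 0. [:- z, 1:]) z = poly p z" by simp
  thus ?thesis by (simp add: ev poly_prod)
qed

text \<open>
  The factorization of \<open>z\<^sup>q - 1\<close> over the roots of unity, evaluated at a point of the unit circle.
\<close>
lemma prod_chord_equispaced:
  assumes "q > 0"
  shows "(\<Prod>j<q. chord (x + real j / real q)) = chord (real q * x)"
proof -
  have "chord (real q * x) = norm (cis (- (2 * pi * x)) ^ q - 1)"
  proof -
    have "norm (cis (- (2 * pi * x)) ^ q - 1) = norm (1 - cis (2 * pi * (- (real q * x))))"
      by (simp add: Complex.DeMoivre norm_minus_commute mult_ac)
    also have "\<dots> = chord (- (real q * x))" by (rule norm_cis_diff_1)
    finally show ?thesis by (simp add: chord_def)
  qed
  also have "cis (- (2 * pi * x)) ^ q - 1 = (\<Prod>w | w ^ q = 1. cis (- (2 * pi * x)) - w)"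
    by (rule prod_roots_of_unity[OF assms, symmetric])
  also have "\<dots> = (\<Prod>k<q. cis (- (2 * pi * x)) - cis (2 * pi * real k / real q))"
    by (rule prod.reindex_bij_betw[OF Complex.bij_betw_roots_unity[OF assms], symmetric])
  also have "norm \<dots> = (\<Prod>k<q. chord (x + real k / real q))"
    unfolding prod_norm[symmetric]
  proof (intro prod.cong refl)
    fix k
    have "cis (- (2 * pi * x)) - cis (2 * pi * real k / real q)
        = cis (- (2 * pi * x)) * (1 - cis (2 * pi * (x + real k / real q)))"
      by (simp add: right_diff_distrib cis_mult) (simp add: algebra_simps)
    thus "norm (cis (- (2 * pi * x)) - cis (2 * pi * real k / real q)) = chord (x + real k / real q)"
      by (simp only: norm_mult norm_cis norm_cis_diff_1 mult_1)
  qed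
  finally show ?thesis by simp
qed

text \<open>
  For the rotation by \<open>p\<^sub>n/q\<^sub>n\<close> the product is known exactly. Passing to \<open>\<alpha>\<close> moves each point by at most
  \<open>1/q\<^sub>n\<^sub>+\<^sub>1\<close>, whereas every chord is at least \<open>2 \<parallel>q\<^sub>n y\<parallel>/q\<^sub>n\<close>; the hypothesis makes the relative error of a
  single factor so small that all \<open>q\<^sub>n\<close> factors together lose at most one half.
\<close>
lemma prod_chord_rotation_ge:
  assumes irr: "\<alpha> \<notin> \<rat>"
    and far: "8 * (of_int (cf_q \<alpha> n))\<^sup>2 \<le> dist_int (of_int (cf_q \<alpha> n) * y) * of_int (cf_q \<alpha> (Suc n))"
  shows "dist_int (of_int (cf_q \<alpha> n) * y) \<le> (\<Prod>j<nat (cf_q \<alpha> n). chord (y + real j * \<alpha>))"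
proof -
  define q q' p d where "q = nat (cf_q \<alpha> n)" and "q' = real_of_int (cf_q \<alpha> (Suc n))"
    and "p = cf_p \<alpha> n" and "d = dist_int (real q * y)"
  have qp: "q > 0" and q: "int q = cf_q \<alpha> n" and rq: "of_int (cf_q \<alpha> n) = real q"
    using cf_q_pos[OF irr, of n] by (auto simp: q_def)
  have q'p: "q' > 0" using cf_q_pos[OF irr, of "Suc n"] by (simp add: q'_def)
  have far': "8 * (real q)\<^sup>2 \<le> d * q'" using far by (simp add: rq d_def q'_def)
  moreover have "0 < 8 * (real q)\<^sup>2" using qp by simp
  ultimately have dp: "d > 0" using q'p by (metis less_le_trans zero_less_mult_pos2)
  define F where "F = (\<lambda>j. chord (y + real j * (of_int p / real q)))"
  define s where "s = 4 * real q / (q' * d)"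
  have s0: "s \<ge> 0" using q'p dp by (simp add: s_def)
  have qs: "real q * s \<le> 1 / 2"
    using far' q'p dp by (simp add: s_def field_simps power2_eq_square)
  have s1: "s \<le> 1"
  proof -
    have "1 * s \<le> real q * s" using qp s0 by (intro mult_right_mono) auto
    thus ?thesis using qs by simp
  qed
  have Fj: "2 * d / real q \<le> F j" for j
  proof -
    have "d = dist_int (real q * y + of_int (int j * p))" by (simp only: dist_int_add_int d_def)
    also have "real q * y + of_int (int j * p) = real q * (y + real j * (of_int p / real q))"
      using qp by (simp add: field_simps)
    finally have "d \<le> real q * dist_int (y + real j * (of_int p / real q))"
      using dist_int_nat_mult by simp
    hence "d / real q \<le> dist_int (y + real j * (of_int p / real q))"
      using qp by (simp add: field_simps)
    thus ?thesis unfolding F_def using chord_ge_dist_int[of "y + real j * (of_int p / real q)"] by simp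
  qed
  have fac: "F j * (1 - s) \<le> chord (y + real j * \<alpha>)" if "j < q" for j
  proof -
    have "F j \<le> chord (y + real j * \<alpha>) + 2 * pi * \<bar>(y + real j * (of_int p / real q)) - (y + real j * \<alpha>)\<bar>"
      unfolding F_def by (rule chord_lipschitz)
    also have "\<bar>(y + real j * (of_int p / real q)) - (y + real j * \<alpha>)\<bar> \<le> 1 / q'"
      using cf_rotation_shift_le[OF irr, of j n] that by (simp add: q_def p_def q'_def abs_minus_commute)
    finally have "F j \<le> chord (y + real j * \<alpha>) + 2 * pi * (1 / q')" by simp
    moreover have "2 * pi * (1 / q') \<le> F j * s"
    proof -
      have "2 * pi * (1 / q') \<le> 8 * (1 / q')"
        using pi_less_4 q'p by (intro mult_right_mono) auto
      also have "\<dots> = (2 * d / real q) * s" using dp qp q'p by (simp add: s_def field_simps)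
      also have "\<dots> \<le> F j * s" by (intro mult_right_mono Fj s0)
      finally show ?thesis .
    qed
    ultimately show ?thesis by (simp add: algebra_simps)
  qed
  have "d \<le> chord (real q * y) * (1 / 2)"
    using chord_ge_dist_int[of "real q * y"] by (simp add: d_def)
  also have "chord (real q * y) = (\<Prod>j<q. F j)"
    unfolding F_def
    by (subst prod_rotation_eq[of chord, OF chord_periodic _ qp])
       (simp_all add: q p_def coprime_cf prod_chord_equispaced[OF qp])
  also have "(\<Prod>j<q. F j) * (1 / 2) \<le> (\<Prod>j<q. F j) * (1 - s) ^ q"
  proof (intro mult_left_mono prod_nonneg)
    have "1 / 2 \<le> 1 + real q * (- s)" using qs by simp
    also have "\<dots> \<le> (1 + (- s)) ^ q" using s1 by (intro Bernoulli_inequality) simp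
    finally show "1 / 2 \<le> (1 - s) ^ q" by simp
  qed (simp add: F_def)
  also have "\<dots> = (\<Prod>j<q. F j * (1 - s))" by (simp add: prod.distrib)
  also have "\<dots> \<le> (\<Prod>j<q. chord (y + real j * \<alpha>))"
    using fac s1 by (intro prod_mono) (auto simp: F_def)
  finally show ?thesis by (simp add: d_def rq q_def)
qed

text \<open>
  Multiplication by \<open>q\<^sub>n\<close> moves \<open>y + j \<alpha>\<close> close to \<open>q\<^sub>n y\<close> modulo \<open>1\<close>, because \<open>j q\<^sub>n \<alpha>\<close> is within
  \<open>q\<^sub>n/q\<^sub>n\<^sub>+\<^sub>1\<close> of an integer.
\<close>
lemma dist_int_rotation_ge:
  assumes irr: "\<alpha> \<notin> \<rat>" and j: "\<bar>j\<bar> \<le> cf_q \<alpha> n"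
    and far: "2 * of_int (cf_q \<alpha> n) \<le> dist_int (of_int (cf_q \<alpha> n) * y) * of_int (cf_q \<alpha> (Suc n))"
  shows "dist_int (of_int (cf_q \<alpha> n) * y) / (2 * of_int (cf_q \<alpha> n)) \<le> dist_int (y + of_int j * \<alpha>)"
proof -
  define q q' p d where "q = nat (cf_q \<alpha> n)" and "q' = real_of_int (cf_q \<alpha> (Suc n))"
    and "p = cf_p \<alpha> n" and "d = dist_int (real q * y)"
  have qp: "q > 0" and q: "int q = cf_q \<alpha> n" and rq: "of_int (cf_q \<alpha> n) = real q"
    using cf_q_pos[OF irr, of n] by (auto simp: q_def)
  have q'p: "q' > 0" using cf_q_pos[OF irr, of "Suc n"] by (simp add: q'_def)
  have "\<bar>real q * \<alpha> - of_int p\<bar> \<le> 1 / q'"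
    using cf_approx[OF irr, of n] by (simp add: rq p_def q'_def)
  hence "\<bar>real_of_int j\<bar> * \<bar>real q * \<alpha> - of_int p\<bar> \<le> real q * (1 / q')"
    using j q q'p by (intro mult_mono) (auto simp flip: of_int_abs)
  hence small: "\<bar>of_int j * (real q * \<alpha> - of_int p)\<bar> \<le> real q / q'" by (simp add: abs_mult)
  have "d = dist_int (real q * y + of_int (j * p))" by (simp only: dist_int_add_int d_def)
  also have "\<dots> \<le> dist_int (real q * (y + of_int j * \<alpha>))
      + \<bar>(real q * y + of_int (j * p)) - real q * (y + of_int j * \<alpha>)\<bar>" by (rule dist_int_perturb)
  also have "\<bar>(real q * y + of_int (j * p)) - real q * (y + of_int j * \<alpha>)\<bar> = \<bar>of_int j * (real q * \<alpha> - of_int p)\<bar>"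
    by (subst abs_minus_commute) (simp add: algebra_simps)
  also note small
  also have "real q / q' \<le> d / 2" using far q'p by (simp add: rq d_def q'_def field_simps)
  finally have "d / 2 \<le> dist_int (real q * (y + of_int j * \<alpha>))" by simp
  also have "\<dots> \<le> real q * dist_int (y + of_int j * \<alpha>)" by (rule dist_int_nat_mult)
  finally show ?thesis using qp by (simp add: rq d_def field_simps)
qed

lemma AE_circle_countable:
  assumes "countable X" "\<And>x. x \<in> {0..<1} \<Longrightarrow> x \<notin> X \<Longrightarrow> P x"
  shows "AE x in circle_measure. P x"
proof -
  have "X \<in> null_sets lborel" using assms(1) by (rule countable_imp_null_set_lborel)
  hence "AE x in lborel. x \<notin> X" by (rule AE_not_in)
  hence "AE x in lborel. x \<in> {0..<1} \<longrightarrow> P x" by eventually_elim (use assms(2) in auto)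
  thus ?thesis by (subst AE_restrict_space_iff) auto
qed

lemma set_integrable_inverse_sqrt: "set_integrable lborel {0..1} (\<lambda>x::real. x powr (-1/2))"
proof -
  have "((\<lambda>x. x powr (-1/2)) has_integral (1 powr (-1/2 + 1) / (-1/2 + 1))) {0..1::real}"
    by (rule has_integral_powr_from_0) auto
  hence "(\<lambda>x::real. x powr (-1/2)) absolutely_integrable_on {0..1}"
    by (intro nonnegative_absolutely_integrable_1) (auto simp: integrable_on_def)
  thus ?thesis unfolding set_integrable_def by (subst (asm) integrable_completion) measurable
qed

text \<open>
  The singularities at both ends of the unit interval are dominated by inverse square roots.
\<close>
lemma ln_chord_integrable: "integrable circle_measure (\<lambda>x. ln (chord x))"
proof -
  let ?g = "\<lambda>x::real. x powr (-1/2)"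
  have a: "set_integrable lborel {0..1} ?g" by (rule set_integrable_inverse_sqrt)
  hence "integrable lborel (\<lambda>x. (\<lambda>x. indicat_real {0..1} x *\<^sub>R ?g x) (1 + (-1) * x))"
    unfolding set_integrable_def by (intro lborel_integrable_real_affine) auto
  also have "(\<lambda>x. (\<lambda>x. indicat_real {0..1} x *\<^sub>R ?g x) (1 + (-1) * x)) = (\<lambda>x. indicat_real {0..1} x *\<^sub>R ?g (1 - x))"
    by (auto simp: indicator_def)
  finally have b: "set_integrable lborel {0..1} (\<lambda>x. ?g (1 - x))" unfolding set_integrable_def .
  have "set_integrable lborel {0..1} (\<lambda>x. 1 + (2 * ?g x + 2 * ?g (1 - x)))"
    by (intro set_integral_add set_integrable_mult_right a b) (simp add: set_integrable_def)
  hence c: "set_integrable lborel {0..<1} (\<lambda>x. 1 + (2 * ?g x + 2 * ?g (1 - x)))"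
    by (rule set_integrable_subset) auto
  have "integrable circle_measure (\<lambda>x. 1 + (2 * ?g x + 2 * ?g (1 - x)))"
    using c by (subst integrable_restrict_space) (auto simp: set_integrable_def)
  thus ?thesis
  proof (rule Bochner_Integration.integrable_bound)
    show "(\<lambda>x. ln (chord x)) \<in> borel_measurable circle_measure"
      by (intro measurable_restrict_space1) measurable
    show "AE x in circle_measure. norm (ln (chord x)) \<le> norm (1 + (2 * ?g x + 2 * ?g (1 - x)))"
    proof (rule AE_circle_countable[of "{}"])
      fix x :: real assume x: "x \<in> {0..<1}"
      have lnb: "- ln y \<le> 2 * ?g y" if "0 < y" for y
      proof -
        have "ln (?g y) \<le> ?g y - 1" using that by (intro ln_le_minus_one) auto
        thus ?thesis using that by (simp add: ln_powr)
      qed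
      have g0: "0 \<le> ?g y" for y by simp
      show "norm (ln (chord x)) \<le> norm (1 + (2 * ?g x + 2 * ?g (1 - x)))"
      proof (cases "x = 0")
        case True thus ?thesis by (simp add: chord_def)
      next
        case False
        with x have x01: "0 < x" "x < 1" by auto
        obtain k where k: "dist_int x = \<bar>x - of_int k\<bar>" using dist_int_attained .
        have "x * (1 - x) \<le> x" "x * (1 - x) \<le> 1 - x"
          using x01 mult_left_le[of "1 - x" x] mult_left_le_one_le[of "1 - x" x] by auto
        moreover have "dist_int x \<ge> x \<or> dist_int x \<ge> 1 - x"
        proof (cases "k \<le> 0")
          case True thus ?thesis using k x01 by (auto simp: abs_if)
        next
          case False
          hence "real_of_int k \<ge> 1" by simp
          thus ?thesis using k x01 by (auto simp: abs_if)
        qed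
        ultimately have "x * (1 - x) \<le> dist_int x" by linarith
        hence lo: "x * (1 - x) \<le> chord x" using chord_ge_dist_int[of x] dist_int_nonneg[of x] by linarith
        have pos: "0 < x * (1 - x)" using x01 by simp
        hence "ln (x * (1 - x)) \<le> ln (chord x)" using lo by simp
        hence "- ln (chord x) \<le> - ln x - ln (1 - x)" using x01 by (simp add: ln_mult)
        also have "\<dots> \<le> 2 * ?g x + 2 * ?g (1 - x)" using lnb[of x] lnb[of "1 - x"] x01 by simp
        finally have 1: "- ln (chord x) \<le> 2 * ?g x + 2 * ?g (1 - x)" .
        have "ln (chord x) \<le> chord x - 1" using pos lo by (intro ln_le_minus_one) linarith
        hence 2: "ln (chord x) \<le> 1" using chord_le_2[of x] by linarith
        have "\<bar>ln (chord x)\<bar> \<le> 1 + (2 * ?g x + 2 * ?g (1 - x))"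
          using 1 2 g0[of x] g0[of "1 - x"] by linarith
        thus ?thesis unfolding real_norm_def by linarith
      qed
    qed simp
  qed
qed

text \<open>
  The doubling formula \<open>|2 sin 2\<pi>x| = |2 sin \<pi>x| |2 sin \<pi>(x + 1/2)|\<close> and the invariance of the integral
  under doubling and translation show that the integral is equal to twice itself.
\<close>
lemma integral_ln_chord: "(\<integral>x. ln (chord x) \<partial>circle_measure) = 0"
proof -
  let ?I = "\<integral>x. ln (chord x) \<partial>circle_measure"
  have per: "ln (chord (x + 1)) = ln (chord x)" for x by (simp add: chord_periodic)
  have m: "(\<lambda>x. ln (chord x)) \<in> borel_measurable borel" by measurable
  have "?I = (\<integral>x. ln (chord (2 * x)) \<partial>circle_measure)"
    using integral_circle_affine[OF m per, of 2 0] by simp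
  also have "\<dots> = (\<integral>x. ln (chord x) + ln (chord (x + 1/2)) \<partial>circle_measure)"
  proof (rule integral_cong_AE)
    show "(\<lambda>x. ln (chord (2 * x))) \<in> borel_measurable circle_measure"
      "(\<lambda>x. ln (chord x) + ln (chord (x + 1 / 2))) \<in> borel_measurable circle_measure"
      by (intro measurable_restrict_space1; measurable)+
    show "AE x in circle_measure. ln (chord (2 * x)) = ln (chord x) + ln (chord (x + 1 / 2))"
    proof (rule AE_circle_countable[of "{0, 1/2}"])
      fix x :: real assume x: "x \<in> {0..<1}" "x \<notin> {0, 1/2}"
      have "x \<notin> \<int>" using x by (auto elim!: Ints_cases)
      moreover have "x + 1/2 \<notin> \<int>"
      proof
        assume "x + 1/2 \<in> \<int>"
        then obtain k where "x + 1/2 = of_int k" by (auto elim: Ints_cases)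
        hence "0 < real_of_int k" "real_of_int k < 2" using x by auto
        hence "k = 1" by simp
        thus False using \<open>x + 1/2 = of_int k\<close> x by simp
      qed
      ultimately have "chord x \<noteq> 0" "chord (x + 1/2) \<noteq> 0" by (simp_all add: chord_eq_0_iff)
      moreover have "chord (2 * x) = chord x * chord (x + 1/2)"
        using prod_chord_equispaced[of 2 x] by (simp add: numeral_2_eq_2)
      ultimately show "ln (chord (2 * x)) = ln (chord x) + ln (chord (x + 1/2))"
        using chord_nonneg[of x] chord_nonneg[of "x + 1/2"] by (simp add: ln_mult less_le)
    qed simp
  qed
  also have "\<dots> = ?I + (\<integral>x. ln (chord (x + 1/2)) \<partial>circle_measure)"
    using ln_chord_integrable integrable_circle_affine[OF m per, of 1 "1/2"]
    by (intro Bochner_Integration.integral_add) auto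
  also have "(\<integral>x. ln (chord (x + 1/2)) \<partial>circle_measure) = ?I"
    using integral_circle_affine[OF m per, of 1 "1/2"] by simp
  finally show ?thesis by simp
qed

section \<open>Zeros of an analytic function on the circle\<close>

lemma circle_analytic_periodic:
  assumes "analytic_on_circle c"
  shows "c (of_real (x + 1)) = c (of_real x)"
  using assms unfolding analytic_on_circle_def by blast

lemma circle_analytic_neighbourhood:
  assumes "analytic_on_circle c"
  obtains S where "open S" "connected S" "\<real> \<subseteq> S" "c holomorphic_on S"
proof -
  obtain T where T: "open T" "\<real> \<subseteq> T" "c holomorphic_on T"
    using assms unfolding analytic_on_circle_def analytic_on_holomorphic by blast
  have "connected (range (of_real :: real \<Rightarrow> complex))"
    by (intro connected_continuous_image continuous_intros) auto
  hence conn: "connected (\<real> :: complex set)" by (simp add: Reals_def)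
  let ?S = "connected_component_set T 0"
  have "\<real> \<subseteq> ?S" by (rule connected_component_maximal[OF _ conn T(2)]) simp
  moreover have "c holomorphic_on ?S"
    by (rule holomorphic_on_subset[OF T(3) connected_component_subset])
  ultimately show ?thesis
    using that[of ?S] open_connected_component[OF T(1)] by auto
qed

lemma circle_analytic_lipschitz:
  assumes an: "analytic_on_circle c"
  obtains K where "K \<ge> 0" "\<And>x y::real. norm (c (of_real x) - c (of_real y)) \<le> K * \<bar>x - y\<bar>"
proof -
  obtain S where S: "open S" "connected S" "\<real> \<subseteq> S" "c holomorphic_on S"
    using circle_analytic_neighbourhood[OF an] .
  define I :: "complex set" where "I = of_real ` {-1..2::real}"
  have "compact I" unfolding I_def by (intro compact_continuous_image continuous_intros) auto
  have IS: "I \<subseteq> S" using S(3) by (auto simp: I_def)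
  have "convex I" unfolding I_def by (rule convex_linear_image) (auto simp: linear_of_real)
  have "bounded (deriv c ` I)"
    using \<open>compact I\<close> IS S
    by (intro compact_imp_bounded compact_continuous_image holomorphic_on_imp_continuous_on
        holomorphic_on_subset[OF holomorphic_deriv[OF S(4,1)]])
  then obtain K0 where "\<forall>y\<in>deriv c ` I. norm y \<le> K0" unfolding bounded_iff by blast
  hence K0: "z \<in> I \<Longrightarrow> norm (deriv c z) \<le> K0" for z by blast
  have "of_real 0 \<in> I" unfolding I_def by (rule imageI) simp
  hence K0nn: "K0 \<ge> 0" using order_trans[OF norm_ge_zero K0] by blast
  have loc: "norm (c (of_real x) - c (of_real y)) \<le> K0 * \<bar>x - y\<bar>" if "x \<in> {-1..2}" "y \<in> {-1..2}" for x y :: real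
  proof -
    have "norm (c (of_real x) - c (of_real y)) \<le> K0 * norm (of_real x - of_real y :: complex)"
    proof (rule field_differentiable_bound[OF \<open>convex I\<close>, of c "deriv c"])
      fix z assume "z \<in> I"
      thus "(c has_field_derivative deriv c z) (at z within I)"
        using IS by (intro holomorphic_derivI[OF S(4,1)]) blast
    next
      show "of_real x \<in> I" "of_real y \<in> I" unfolding I_def using that by blast+
    qed (rule K0)
    thus ?thesis by (simp flip: of_real_diff)
  qed
  note per = periodic_int_shift[of "\<lambda>x. c (of_real x)", OF circle_analytic_periodic[OF an]]
  have "norm (c (of_real x) - c (of_real y)) \<le> K0 * \<bar>x - y\<bar>" for x y
  proof (cases "\<bar>x - y\<bar> \<le> 1")
    case True
    have "norm (c (of_real (x + of_int (- \<lfloor>x\<rfloor>))) - c (of_real (y + of_int (- \<lfloor>x\<rfloor>))))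
        \<le> K0 * \<bar>(x + of_int (- \<lfloor>x\<rfloor>)) - (y + of_int (- \<lfloor>x\<rfloor>))\<bar>"
      using True by (intro loc) (simp, linarith)+
    thus ?thesis unfolding per by simp
  next
    case False
    have "norm (c (of_real (x + of_int (- \<lfloor>x\<rfloor>))) - c (of_real (y + of_int (- \<lfloor>y\<rfloor>))))
        \<le> K0 * \<bar>(x + of_int (- \<lfloor>x\<rfloor>)) - (y + of_int (- \<lfloor>y\<rfloor>))\<bar>"
      by (intro loc) (simp, linarith)+
    also have "\<dots> \<le> K0 * \<bar>x - y\<bar>"
    proof (rule mult_left_mono[OF _ K0nn])
      show "\<bar>(x + of_int (- \<lfloor>x\<rfloor>)) - (y + of_int (- \<lfloor>y\<rfloor>))\<bar> \<le> \<bar>x - y\<bar>"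
        using False by (simp, linarith)
    qed
    finally show ?thesis unfolding per .
  qed
  thus ?thesis using that K0nn by blast
qed

lemma circle_analytic_continuous:
  assumes "analytic_on_circle c"
  shows "continuous_on UNIV (\<lambda>x::real. c (of_real x))"
proof -
  obtain S where S: "open S" "connected S" "\<real> \<subseteq> S" "c holomorphic_on S"
    using circle_analytic_neighbourhood[OF assms] .
  have "continuous_on S c" using S(4) by (rule holomorphic_on_imp_continuous_on)
  thus ?thesis by (rule continuous_on_compose2) (use S(3) in \<open>auto intro!: continuous_intros\<close>)
qed

lemma real_zeros_isolated:
  assumes "analytic_on_circle c" "\<exists>x::real. c (of_real x) \<noteq> 0"
  shows "\<forall>\<^sub>F x in at (t::real). c (of_real x) \<noteq> 0"
proof -
  obtain S where S: "open S" "connected S" "\<real> \<subseteq> S" "c holomorphic_on S"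
    using circle_analytic_neighbourhood[OF assms(1)] .
  obtain x0 :: real where x0: "c (of_real x0) \<noteq> 0" using assms(2) by blast
  have "\<forall>\<^sub>F w in at (of_real t). c w \<noteq> 0 \<and> w \<in> S"
    using S x0 by (intro non_zero_neighbour_alt[of c S "of_real t" "of_real x0"]) auto
  hence "\<forall>\<^sub>F w in at (complex_of_real t). c w \<noteq> 0" by eventually_elim simp
  moreover have "filterlim complex_of_real (at (of_real t)) (at t)"
    by (auto simp: filterlim_at eventually_at_filter intro!: tendsto_intros)
  ultimately show ?thesis by (rule eventually_compose_filterlim)
qed

lemma finite_circle_zeros:
  assumes "analytic_on_circle c" "\<exists>x::real. c (of_real x) \<noteq> 0"
  shows "finite (circle_zeros c)"
proof -
  have "finite ({0..1} \<inter> {t::real. c (of_real t) = 0})"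
    using real_zeros_isolated[OF assms]
    by (intro finite_not_islimpt_in_compact) (auto simp: islimpt_iff_eventually)
  thus ?thesis by (rule finite_subset[rotated]) (auto simp: circle_zeros_def)
qed

lemma zorder_circle_zero:
  assumes "analytic_on_circle c" "\<exists>x::real. c (of_real x) \<noteq> 0" "c (of_real t) = 0"
  obtains r h where "r > 0" "h holomorphic_on cball (complex_of_real t) r"
    "\<And>w. w \<in> cball (of_real t) r \<Longrightarrow> c w = h w * (w - of_real t) ^ nat (zorder c (of_real t)) \<and> h w \<noteq> 0"
    "zorder c (of_real t) > 0"
proof -
  obtain S where S: "open S" "connected S" "\<real> \<subseteq> S" "c holomorphic_on S"
    using circle_analytic_neighbourhood[OF assms(1)] .
  obtain x0 :: real where x0: "c (of_real x0) \<noteq> 0" using assms(2) by blast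
  have tS: "of_real t \<in> S" "of_real x0 \<in> S" using S(3) by auto
  hence "\<exists>w\<in>S. c w \<noteq> 0" using x0 by blast
  note zz = zorder_exist_zero[OF S(4,1,2) tS(1) this]
  obtain r where r: "r > 0" "zor_poly c (of_real t) holomorphic_on cball (of_real t) r"
    "\<forall>w\<in>cball (of_real t) r. c w = zor_poly c (of_real t) w * (w - of_real t) ^ nat (zorder c (of_real t))
        \<and> zor_poly c (of_real t) w \<noteq> 0"
    using zz by blast
  have "zorder c (of_real t) > 0" using zz assms(3) by argo
  thus ?thesis using that[OF r(1,2)] r(3) by blast
qed

lemma continuous_of_limits:
  fixes R g :: "real \<Rightarrow> real"
  assumes lim: "\<And>x. (R \<longlongrightarrow> g x) (at x)"
  shows "continuous_on UNIV g"
  unfolding continuous_on_iff dist_real_def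
proof (intro ballI allI impI)
  fix x e :: real assume "e > 0"
  then obtain d where d: "d > 0" "\<And>y. y \<noteq> x \<Longrightarrow> \<bar>y - x\<bar> < d \<Longrightarrow> \<bar>R y - g x\<bar> < e / 2"
    using LIM_D[OF lim[of x], of "e / 2"] by auto
  have "\<bar>g y - g x\<bar> < e" if y: "\<bar>y - x\<bar> < d" for y
  proof (cases "y = x")
    case False
    have "((\<lambda>z. \<bar>R z - g x\<bar>) \<longlongrightarrow> \<bar>g y - g x\<bar>) (at y)" by (intro tendsto_intros lim)
    moreover have "\<forall>\<^sub>F z in at y. \<bar>R z - g x\<bar> \<le> e / 2"
    proof -
      have "\<forall>\<^sub>F z in at y. z \<in> {x - d<..<x + d} - {x}"
        using y False by (intro eventually_at_in_open') (auto simp: open_delete abs_if split: if_splits)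
      thus ?thesis by eventually_elim (use d(2) in \<open>force intro: less_imp_le\<close>)
    qed
    ultimately have "\<bar>g y - g x\<bar> \<le> e / 2" by (rule tendsto_upperbound) simp
    thus ?thesis using \<open>e > 0\<close> by simp
  qed (use \<open>e > 0\<close> in simp)
  thus "\<exists>d>0. \<forall>x'\<in>UNIV. \<bar>x' - x\<bar> < d \<longrightarrow> \<bar>g x' - g x\<bar> < e" using d(1) by blast
qed

lemma chord_quotient_limit: "((\<lambda>x. chord (x - t) / \<bar>x - t\<bar>) \<longlongrightarrow> 2 * pi) (at t)"
proof -
  have "((\<lambda>x. sin (pi * (x - t))) has_real_derivative cos (pi * (t - t)) * pi) (at t)"
    by (auto intro!: derivative_eq_intros)
  hence "((\<lambda>x. (sin (pi * (x - t)) - sin (pi * (t - t))) / (x - t)) \<longlongrightarrow> cos (pi * (t - t)) * pi) (at t)"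
    unfolding has_field_derivative_iff .
  hence "((\<lambda>x. sin (pi * (x - t)) / (x - t)) \<longlongrightarrow> pi) (at t)" by simp
  hence "((\<lambda>x. 2 * \<bar>sin (pi * (x - t)) / (x - t)\<bar>) \<longlongrightarrow> 2 * \<bar>pi\<bar>) (at t)" by (intro tendsto_intros)
  moreover have "(\<lambda>x. 2 * \<bar>sin (pi * (x - t)) / (x - t)\<bar>) = (\<lambda>x. chord (x - t) / \<bar>x - t\<bar>)"
    by (rule ext) (simp add: chord_def abs_mult abs_divide)
  moreover have "2 * \<bar>pi\<bar> = 2 * pi" by simp
  ultimately show ?thesis by (simp only:)
qed

text \<open>
  A model for \<open>|c|\<close> on the circle: the product that vanishes at the same points to the same orders.
\<close>
definition zero_factor :: "(complex \<Rightarrow> complex) \<Rightarrow> real \<Rightarrow> real" where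
  "zero_factor c x = (\<Prod>s\<in>circle_zeros c. chord (x - s) ^ nat (zorder c (of_real s)))"

lemma zero_factor_periodic: "zero_factor c (x + 1) = zero_factor c x"
  using chord_periodic[of "x - _"] by (simp add: zero_factor_def add_diff_eq[symmetric] diff_add_eq)

lemma zero_factor_nonneg: "0 \<le> zero_factor c x"
  by (simp add: zero_factor_def prod_nonneg)

lemma zero_factor_continuous: "continuous_on UNIV (zero_factor c)"
  unfolding zero_factor_def by (intro continuous_intros)

lemma circle_zeros_diff_int:
  assumes "s \<in> circle_zeros c" "t \<in> circle_zeros c" "s - t \<in> \<int>"
  shows "s = t"
proof -
  obtain k where "s - t = of_int k" using assms(3) by (auto elim: Ints_cases)
  moreover have "-1 < s - t" "s - t < 1" using assms(1,2) by (auto simp: circle_zeros_def)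
  ultimately have "k = 0" by linarith
  thus ?thesis using \<open>s - t = of_int k\<close> by simp
qed

lemma frac_in_circle_zeros:
  assumes "analytic_on_circle c" "c (of_real x) = 0"
  shows "frac x \<in> circle_zeros c"
  using periodic_frac[of "\<lambda>x. c (of_real x)" x, OF circle_analytic_periodic[OF assms(1)]] assms(2) frac_lt_1[of x]
  by (simp add: circle_zeros_def)

lemma zero_factor_eq_0_iff:
  assumes "analytic_on_circle c" "\<exists>x::real. c (of_real x) \<noteq> 0"
  shows "zero_factor c x = 0 \<longleftrightarrow> c (of_real x) = 0"
proof
  assume "zero_factor c x = 0"
  then obtain s where s: "s \<in> circle_zeros c" "chord (x - s) = 0"
    using finite_circle_zeros[OF assms] by (auto simp: zero_factor_def)
  then obtain k where "x - s = of_int k" by (auto simp: chord_eq_0_iff elim: Ints_cases)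
  hence "x = s + of_int k" by simp
  thus "c (of_real x) = 0"
    using periodic_int_shift[of "\<lambda>x. c (of_real x)" s k, OF circle_analytic_periodic[OF assms(1)]] s(1)
    by (simp add: circle_zeros_def)
next
  assume x: "c (of_real x) = 0"
  hence f: "frac x \<in> circle_zeros c" by (rule frac_in_circle_zeros[OF assms(1)])
  have "chord (x - frac x) = 0" by (simp add: chord_eq_0_iff frac_def)
  moreover have "zorder c (of_real (frac x)) > 0"
    using zorder_circle_zero[OF assms, of "frac x"] f unfolding circle_zeros_def by blast
  ultimately show "zero_factor c x = 0"
    using f finite_circle_zeros[OF assms] by (auto simp: zero_factor_def intro!: bexI[of _ "frac x"])
qed

lemma zero_factor_ratio_isCont:
  assumes "analytic_on_circle c" "\<exists>x::real. c (of_real x) \<noteq> 0" "c (of_real t) \<noteq> 0"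
  shows "isCont (\<lambda>x. norm (c (of_real x)) / zero_factor c x) t"
proof -
  have "isCont (\<lambda>x::real. c (of_real x)) t" "isCont (zero_factor c) t"
    using circle_analytic_continuous[OF assms(1)] zero_factor_continuous[of c]
    by (simp_all add: continuous_on_eq_continuous_at)
  thus ?thesis
    using assms(3) zero_factor_eq_0_iff[OF assms(1,2), of t]
    by (intro continuous_divide continuous_norm) auto
qed

text \<open>
  Near a zero of order \<open>m\<close> both \<open>|c|\<close> and its model are \<open>|x - t|\<^sup>m\<close> times a function with a positive
  limit. By periodicity it is enough to look at points of \<open>[0,1)\<close>, where the representatives of the
  zeros lie.
\<close>
lemma zero_factor_ratio_limit:
  assumes an: "analytic_on_circle c" and nz: "\<exists>x::real. c (of_real x) \<noteq> 0"
  shows "\<exists>l>0. ((\<lambda>x. norm (c (of_real x)) / zero_factor c x) \<longlongrightarrow> l) (at t)"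
proof -
  define R where "R = (\<lambda>x. norm (c (of_real x)) / zero_factor c x)"
  note fin = finite_circle_zeros[OF an nz]
  have Rper: "R (x + 1) = R x" for x
    unfolding R_def zero_factor_periodic circle_analytic_periodic[OF an] ..
  have conv: "\<exists>l>0. (R \<longlongrightarrow> l) (at t)" if t: "t \<in> {0..<1}" for t
  proof (cases "c (of_real t) = 0")
    case False
    have "isCont R t" unfolding R_def by (rule zero_factor_ratio_isCont[OF an nz False])
    moreover have "R t > 0" unfolding R_def
      using False zero_factor_eq_0_iff[OF an nz, of t]
        zero_factor_nonneg[of c t] by (simp add: order_less_le)
    ultimately show ?thesis unfolding isCont_def by blast
  next
    case True
    hence tz: "t \<in> circle_zeros c" using t by (simp add: circle_zeros_def)
    obtain r h where h: "r > 0" "h holomorphic_on cball (complex_of_real t) r"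
      "\<And>w. w \<in> cball (of_real t) r \<Longrightarrow> c w = h w * (w - of_real t) ^ nat (zorder c (of_real t)) \<and> h w \<noteq> 0"
      using zorder_circle_zero[OF an nz True] by metis
    define m where "m = nat (zorder c (of_real t))"
    define P where "P = (\<lambda>x. \<Prod>s\<in>circle_zeros c - {t}. chord (x - s) ^ nat (zorder c (of_real s)))"
    have "isCont h (of_real t)"
      using holomorphic_on_imp_continuous_on[OF h(2)] h(1)
      by (intro continuous_on_interior[of "cball (of_real t) r"]) auto
    hence "isCont (\<lambda>x::real. h (of_real x)) t"
      by (intro isCont_o2[where g=h and f=of_real]) (auto intro!: continuous_intros)
    hence hl: "((\<lambda>x::real. h (of_real x)) \<longlongrightarrow> h (of_real t)) (at t)" by (simp add: isCont_def)
    have "continuous_on UNIV P" unfolding P_def by (intro continuous_intros)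
    hence "isCont P t" by (simp add: continuous_on_eq_continuous_at)
    hence Pl: "(P \<longlongrightarrow> P t) (at t)" by (simp add: isCont_def)
    have Ppos: "P t > 0"
      unfolding P_def
    proof (intro prod_pos zero_less_power)
      fix s assume s: "s \<in> circle_zeros c - {t}"
      hence "t - s \<notin> \<int>" using circle_zeros_diff_int[OF tz, of s] by auto
      thus "0 < chord (t - s)" using chord_eq_0_iff[of "t - s"] by (simp add: less_le)
    qed
    have ht: "h (of_real t) \<noteq> 0" using h(1) h(3)[of "of_real t"] by simp
    have "((\<lambda>x. norm (h (of_real x)) / ((chord (x - t) / \<bar>x - t\<bar>) ^ m * P x))
        \<longlongrightarrow> norm (h (of_real t)) / ((2 * pi) ^ m * P t)) (at t)"
      using Ppos by (intro tendsto_intros hl chord_quotient_limit Pl) auto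
    moreover have "\<forall>\<^sub>F x in at t. norm (h (of_real x)) / ((chord (x - t) / \<bar>x - t\<bar>) ^ m * P x) = R x"
    proof -
      have "\<forall>\<^sub>F x in at t. x \<in> {t - r<..<t + r} - {t}"
      proof -
        have "\<forall>\<^sub>F x in at t. x \<in> {t - r<..<t + r}" using h(1) by (intro eventually_at_in_open') auto
        thus ?thesis by (auto simp: eventually_at_filter elim: eventually_mono)
      qed
      thus ?thesis
      proof eventually_elim
        case (elim x)
        hence "of_real x \<in> cball (complex_of_real t) r"
          by (simp add: dist_of_real dist_real_def abs_le_iff)
        hence "c (of_real x) = h (of_real x) * (of_real x - of_real t) ^ m" using h(3) by (simp add: m_def)
        hence "norm (c (of_real x)) = norm (h (of_real x)) * \<bar>x - t\<bar> ^ m"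
          by (simp add: norm_mult norm_power flip: of_real_diff)
        moreover have "zero_factor c x = chord (x - t) ^ m * P x"
          unfolding zero_factor_def P_def m_def using fin tz by (simp add: prod.remove)
        ultimately show ?case using elim by (simp add: R_def power_divide)
      qed
    qed
    ultimately have "(R \<longlongrightarrow> norm (h (of_real t)) / ((2 * pi) ^ m * P t)) (at t)"
      by (rule Lim_transform_eventually)
    moreover have "norm (h (of_real t)) / ((2 * pi) ^ m * P t) > 0"
      using ht Ppos by simp
    ultimately show ?thesis by blast
  qed
  have "frac t \<in> {0..<1}" using frac_lt_1[of t] by simp
  then obtain l where l: "l > 0" "(R \<longlongrightarrow> l) (at (frac t))" using conv by blast
  have "((\<lambda>x. R (x + (- of_int \<lfloor>t\<rfloor>))) \<longlongrightarrow> l) (at t)"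
    using LIM_offset[OF l(2), of "- of_int \<lfloor>t\<rfloor>"] by (simp add: frac_def)
  moreover have "R (x + (- of_int \<lfloor>t\<rfloor>)) = R x" for x
    using periodic_int_shift[of R x "- \<lfloor>t\<rfloor>", OF Rper] by simp
  ultimately show ?thesis using l(1) unfolding R_def by auto
qed

text \<open>
  The non-vanishing factor is the continuous extension of the quotient of \<open>|c|\<close> and its model.
\<close>
lemma circle_factorization:
  assumes an: "analytic_on_circle c" and nz: "\<exists>x::real. c (of_real x) \<noteq> 0"
  obtains g :: "real \<Rightarrow> real" where "continuous_on UNIV g" "\<And>x. g x > 0" "\<And>x. g (x + 1) = g x"
    "\<And>x. norm (c (of_real x)) = g x * zero_factor c x"
proof -
  define R where "R = (\<lambda>x. norm (c (of_real x)) / zero_factor c x)"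
  have Rper: "R (x + 1) = R x" for x
    unfolding R_def zero_factor_periodic circle_analytic_periodic[OF an] ..
  define g where "g = (\<lambda>x. Lim (at x) R)"
  have g: "g x > 0 \<and> (R \<longlongrightarrow> g x) (at x)" for x
    using zero_factor_ratio_limit[OF an nz, of x] tendsto_Lim[of "at x" R] unfolding g_def R_def by fastforce
  have cont: "continuous_on UNIV g" by (rule continuous_of_limits) (use g in blast)
  have "(R \<longlongrightarrow> g (x + 1)) (at x)" for x
    using LIM_offset[of R "g (x + 1)" "x + 1" 1] g[of "x + 1"] by (simp add: Rper)
  hence per: "g (x + 1) = g x" for x using g[of x] LIM_unique by blast
  have "norm (c (of_real x)) = g x * zero_factor c x" for x
  proof (cases "c (of_real x) = 0")
    case True thus ?thesis using zero_factor_eq_0_iff[OF an nz] by simp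
  next
    case False
    have "isCont R x" unfolding R_def by (rule zero_factor_ratio_isCont[OF an nz False])
    hence "R x = g x" using g[of x] LIM_unique by (auto simp: isCont_def)
    thus ?thesis using False zero_factor_eq_0_iff[OF an nz, of x] by (simp add: R_def field_simps)
  qed
  with cont g per show ?thesis using that by blast
qed

section \<open>The Lyapunov exponent of a Jacobi cocycle with zeros\<close>

text \<open>
  The transfer matrix multiplied by \<open>c(x)\<close>. Unlike the transfer matrix it is continuous in \<open>x\<close>, also
  where \<open>c\<close> vanishes.
\<close>
definition jacobi_mat ::
  "real \<Rightarrow> (complex \<Rightarrow> complex) \<Rightarrow> (real \<Rightarrow> real) \<Rightarrow> real \<Rightarrow> real \<Rightarrow> complex^2^2" where
  "jacobi_mat \<alpha> c v E x =
     vector [vector [of_real (E - v x), - conj_ext c (of_real (x - \<alpha>))], vector [c (of_real x), 0]]"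

primrec jacobi_iter ::
  "real \<Rightarrow> (complex \<Rightarrow> complex) \<Rightarrow> (real \<Rightarrow> real) \<Rightarrow> real \<Rightarrow> nat \<Rightarrow> real \<Rightarrow> complex^2^2" where
  "jacobi_iter \<alpha> c v E 0 x = mat 1"
| "jacobi_iter \<alpha> c v E (Suc n) x =
     jacobi_mat \<alpha> c v E (x + of_nat n * \<alpha>) ** jacobi_iter \<alpha> c v E n x"

definition c_prod :: "real \<Rightarrow> (complex \<Rightarrow> complex) \<Rightarrow> nat \<Rightarrow> real \<Rightarrow> complex" where
  "c_prod \<alpha> c n x = (\<Prod>j<n. c (of_real (x + of_nat j * \<alpha>)))"

lemma jacobi_mat_nth [simp]:
  "jacobi_mat \<alpha> c v E x $ 1 $ 1 = of_real (E - v x)"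
  "jacobi_mat \<alpha> c v E x $ 1 $ 2 = - conj_ext c (of_real (x - \<alpha>))"
  "jacobi_mat \<alpha> c v E x $ 2 $ 1 = c (of_real x)"
  "jacobi_mat \<alpha> c v E x $ 2 $ 2 = 0"
  by (simp_all add: jacobi_mat_def)

lemma conj_ext_of_real [simp]: "conj_ext c (of_real x) = cnj (c (of_real x))"
  by (simp add: conj_ext_def)

lemma map_matrix_scale_mult:
  fixes A B :: "complex^2^2"
  shows "map_matrix (\<lambda>z. k * z) A ** map_matrix (\<lambda>z. l * z) B = map_matrix (\<lambda>z. k * l * z) (A ** B)"
  by (simp add: matrix_matrix_mult_def map_matrix_def vec_eq_iff sum_distrib_left mult_ac)

lemma cocycle_iter_eq:
  "cocycle_iter \<alpha> c v E n x = map_matrix (\<lambda>z. 1 / c_prod \<alpha> c n x * z) (jacobi_iter \<alpha> c v E n x)"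
proof (induction n)
  case 0
  show ?case by (simp add: c_prod_def map_matrix_def vec_eq_iff)
next
  case (Suc n)
  have "cocycle_mat \<alpha> c v E y = map_matrix (\<lambda>z. 1 / c (of_real y) * z) (jacobi_mat \<alpha> c v E y)" for y
    by (simp only: cocycle_mat_def jacobi_mat_def)
  thus ?case
    by (simp only: cocycle_iter.simps jacobi_iter.simps Suc map_matrix_scale_mult)
       (simp add: c_prod_def mult.commute)
qed

lemma opnorm_cocycle_iter:
  "onorm (\<lambda>y. cocycle_iter \<alpha> c v E n x *v y) = opnorm (jacobi_iter \<alpha> c v E n x) / norm (c_prod \<alpha> c n x)"
  unfolding opnorm_def[symmetric] cocycle_iter_eq opnorm_scale by (simp add: norm_divide)

lemma jacobi_iter_add:
  "jacobi_iter \<alpha> c v E (m + n) x = jacobi_iter \<alpha> c v E m (x + of_nat n * \<alpha>) ** jacobi_iter \<alpha> c v E n x"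
  by (induction m) (simp_all add: matrix_mul_assoc algebra_simps)

lemma det_jacobi_iter:
  "det (jacobi_iter \<alpha> c v E n x) =
     (\<Prod>j<n. cnj (c (of_real (x + of_nat j * \<alpha> - \<alpha>)))) * c_prod \<alpha> c n x"
proof (induction n)
  case 0
  show ?case by (simp add: c_prod_def det_I)
next
  case (Suc n)
  have "det (jacobi_mat \<alpha> c v E y) = cnj (c (of_real (y - \<alpha>))) * c (of_real y)" for y
    unfolding det_2 jacobi_mat_nth conj_ext_of_real by simp
  thus ?case
    using Suc by (simp only: jacobi_iter.simps det_mul c_prod_def prod.lessThan_Suc mult_ac)
qed

text \<open>
  Fekete's lemma; the lower bound makes the limit finite and nonnegative.
\<close>
lemma subadditive_average_convergent:
  fixes a :: "nat \<Rightarrow> real"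
  assumes sub: "\<And>m n. a (m + n) \<le> a m + a n" and low: "\<And>n. - B \<le> a n"
  obtains L where "L \<ge> 0" "(\<lambda>n. 1 / of_nat n * a n) \<longlonglongrightarrow> L"
proof -
  define B' where "B' = \<bar>B\<bar>"
  have low': "- B' \<le> a n" for n using low[of n] by (simp add: B'_def)
  define S where "S = (\<lambda>n. a n / real n) ` {1..}"
  have bdd: "bdd_below S"
  proof (rule bdd_belowI[of _ "- B'"])
    fix y assume "y \<in> S"
    then obtain n where n: "n \<ge> 1" "y = a n / real n" by (auto simp: S_def)
    have "- B' * real n \<le> - B'" using n(1) by (simp add: B'_def mult_le_cancel_left1)
    hence "- B' * real n \<le> a n" using low'[of n] by linarith
    thus "- B' \<le> y" using n by (simp add: pos_le_divide_eq)
  qed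
  have ne: "S \<noteq> {}" by (auto simp: S_def)
  define L where "L = Inf S"
  have Lle: "L \<le> a n / real n" if "n \<ge> 1" for n
    unfolding L_def using that by (intro cInf_lower[OF _ bdd]) (auto simp: S_def)
  have mult: "a (k * N + r) \<le> real k * a N + a r" for k N r
  proof (induction k)
    case (Suc k)
    have "a (Suc k * N + r) \<le> a N + a (k * N + r)" using sub[of N "k * N + r"] by (simp add: add_ac)
    thus ?case using Suc by (simp add: algebra_simps)
  qed simp
  have lim: "(\<lambda>n. a n / real n) \<longlonglongrightarrow> L"
  proof (rule LIMSEQ_I)
    fix e :: real assume "e > 0"
    obtain y where "y \<in> S" "y < L + e / 2"
      using cInf_lessD[OF ne, of "L + e / 2"] \<open>e > 0\<close> unfolding L_def by auto
    then obtain N where N: "N \<ge> 1" "a N / real N < L + e / 2" by (auto simp: S_def)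
    define M where "M = (\<Sum>r<N. \<bar>a r\<bar>) + \<bar>a N\<bar>"
    have up: "a n / real n \<le> a N / real N + M / real n" if "n \<ge> 1" for n
    proof -
      define k r where "k = n div N" and "r = n mod N"
      have n: "n = k * N + r" "r < N" using N(1) by (simp_all add: k_def r_def)
      have kN: "real k * a N = real n * (a N / real N) - real r * (a N / real N)"
        using N(1) by (simp add: n(1) field_simps)
      have "\<bar>a r\<bar> \<le> (\<Sum>r<N. \<bar>a r\<bar>)"
        using n(2) by (intro member_le_sum) auto
      moreover have "- (real r * (a N / real N)) \<le> \<bar>a N\<bar>"
      proof -
        have "- (real r * (a N / real N)) \<le> \<bar>real r * (a N / real N)\<bar>" by (rule abs_ge_minus_self)
        also have "\<dots> = (real r / real N) * \<bar>a N\<bar>" by (simp add: abs_mult)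
        also have "\<dots> \<le> 1 * \<bar>a N\<bar>" using n(2) by (intro mult_right_mono) auto
        finally show ?thesis by simp
      qed
      ultimately have "a n \<le> real n * (a N / real N) + M"
        using mult[of k N r] kN unfolding M_def n(1)[symmetric] by linarith
      hence "a n / real n \<le> (real n * (a N / real N) + M) / real n"
        by (intro divide_right_mono) auto
      thus ?thesis using that by (simp add: add_divide_distrib)
    qed
    have "(\<lambda>n. M / real n) \<longlonglongrightarrow> 0" by (rule lim_const_over_n)
    then obtain n0 where n0: "\<And>n. n \<ge> n0 \<Longrightarrow> \<bar>M / real n\<bar> < e / 2"
      using LIMSEQ_D[of _ 0 "e / 2"] \<open>e > 0\<close> by (metis diff_zero half_gt_zero real_norm_def)
    have "norm (a n / real n - L) < e" if "n \<ge> max n0 1" for n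
    proof -
      have "a n / real n \<le> a N / real N + M / real n" "L \<le> a n / real n"
        using that by (auto intro!: up Lle)
      moreover have "\<bar>M / real n\<bar> < e / 2" by (rule n0) (use that in simp)
      ultimately show ?thesis using N(2) unfolding real_norm_def by linarith
    qed
    thus "\<exists>no. \<forall>n\<ge>no. norm (a n / real n - L) < e" by blast
  qed
  have "(\<lambda>n. - B' / real n) \<longlonglongrightarrow> 0" by (rule lim_const_over_n)
  moreover have "\<forall>n. - B' / real n \<le> a n / real n"
    using low' by (intro allI divide_right_mono) auto
  ultimately have "0 \<le> L" using lim by (intro LIMSEQ_le) auto
  with lim show ?thesis using that by simp
qed

text \<open>
  The coefficient \<open>c\<close> may vanish on the circle. The energy \<open>E\<close> is a parameter of the locale because all
  matrices depend on it.
\<close>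
locale singular_jacobi =
  fixes \<alpha> :: real and c :: "complex \<Rightarrow> complex" and v :: "real \<Rightarrow> real" and E :: real
  assumes irr: "\<alpha> \<notin> \<rat>" and an: "analytic_on_circle c" and nz: "\<exists>x::real. c (of_real x) \<noteq> 0"
    and v_per: "\<And>x. v (x + 1) = v x" and v_lip: "\<exists>K. K-lipschitz_on UNIV v"
begin

abbreviation "M x \<equiv> jacobi_mat \<alpha> c v E x"
abbreviation "Mn n x \<equiv> jacobi_iter \<alpha> c v E n x"
definition growth :: "nat \<Rightarrow> real \<Rightarrow> real" where "growth n x = opnorm (Mn n x)"
definition log_c :: "real \<Rightarrow> real" where "log_c x = ln (norm (c (of_real x)))"
definition mean_log_c :: real where "mean_log_c = (\<integral>x. log_c x \<partial>circle_measure)"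

lemma c_continuous: "continuous_on S (\<lambda>x::real. c (of_real x))"
  using circle_analytic_continuous[OF an] continuous_on_subset by blast

lemma v_continuous: "continuous_on UNIV v"
  using v_lip lipschitz_on_continuous_on by blast

lemma growth_nonneg [simp]: "0 \<le> growth n x" by (simp add: growth_def)

lemma jacobi_mat_periodic: "M (x + 1) = M x"
  using circle_analytic_periodic[OF an, of x] circle_analytic_periodic[OF an, of "x - \<alpha>"] v_per[of x]
  by (simp add: jacobi_mat_def add_diff_eq[symmetric] diff_add_eq conj_ext_def)

lemma jacobi_iter_periodic: "Mn n (x + 1) = Mn n x"
proof (induction n)
  case (Suc n)
  have "M (x + 1 + real n * \<alpha>) = M (x + real n * \<alpha>)"
    using jacobi_mat_periodic[of "x + real n * \<alpha>"] by (simp add: add_ac)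
  thus ?case using Suc by simp
qed simp

lemma growth_periodic: "growth n (x + 1) = growth n x"
  unfolding growth_def jacobi_iter_periodic ..

lemma jacobi_mat_entry_continuous: "continuous_on UNIV (\<lambda>x. M (x + s) $ i $ j)"
proof -
  have c': "continuous_on UNIV (\<lambda>x::real. c (of_real (x + s)))" for s
    by (rule continuous_on_compose2[OF c_continuous[of UNIV]]) (auto intro!: continuous_intros)
  have v': "continuous_on UNIV (\<lambda>x. v (x + s))"
    by (rule continuous_on_compose2[OF v_continuous]) (auto intro!: continuous_intros)
  have c'': "continuous_on UNIV (\<lambda>x::real. c (of_real (x + s - \<alpha>)))"
    using c'[of "s - \<alpha>"] by (simp only: add_diff_eq)
  have "continuous_on UNIV (\<lambda>x. M (x + s) $ 1 $ 1)" "continuous_on UNIV (\<lambda>x. M (x + s) $ 1 $ 2)"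
    "continuous_on UNIV (\<lambda>x. M (x + s) $ 2 $ 1)" "continuous_on UNIV (\<lambda>x. M (x + s) $ 2 $ 2)"
    unfolding jacobi_mat_nth conj_ext_of_real by (intro continuous_intros c' c'' v')+
  moreover have "i = 1 \<or> i = 2" "j = 1 \<or> j = 2" using exhaust_2 by auto
  ultimately show ?thesis by auto
qed

lemma growth_continuous: "continuous_on UNIV (growth n)"
proof -
  have "continuous_on UNIV (\<lambda>x. Mn n x $ i $ j)" for i j
  proof (induction n arbitrary: i j)
    case 0 show ?case by simp
  next
    case (Suc n)
    show ?case
      by (simp add: matrix_matrix_mult_def) (intro continuous_intros Suc jacobi_mat_entry_continuous)
  qed
  thus ?thesis unfolding growth_def by (rule continuous_on_opnorm)
qed

lemma growth_measurable [measurable]: "growth n \<in> borel_measurable borel"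
  by (rule borel_measurable_continuous_onI[OF growth_continuous])

lemma log_c_measurable [measurable]: "log_c \<in> borel_measurable borel"
proof -
  have [measurable]: "(\<lambda>x::real. c (of_real x)) \<in> borel_measurable borel"
    by (rule borel_measurable_continuous_onI[OF c_continuous])
  show ?thesis unfolding log_c_def by measurable
qed

lemma growth_add_le: "growth (m + n) x \<le> growth m (x + real n * \<alpha>) * growth n x"
  unfolding growth_def jacobi_iter_add by (rule opnorm_mult_le)

lemma log_c_periodic: "log_c (x + 1) = log_c x"
  unfolding log_c_def circle_analytic_periodic[OF an] ..

lemma growth_exponential_bound:
  obtains K where "K \<ge> 1" "\<And>n x. growth n x \<le> K ^ n"
proof -
  obtain B where B: "B \<ge> 0" "\<And>x. \<bar>growth 1 x\<bar> \<le> B"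
    using periodic_continuous_bounded[OF growth_periodic growth_continuous] by blast
  have "growth n x \<le> (max B 1) ^ n" for n x
  proof (induction n)
    case 0 show ?case by (simp add: growth_def opnorm_mat_1)
  next
    case (Suc n)
    have "growth (1 + n) x \<le> growth 1 (x + real n * \<alpha>) * growth n x" by (rule growth_add_le)
    also have "\<dots> \<le> max B 1 * (max B 1) ^ n"
      using B(2)[of "x + real n * \<alpha>"] Suc by (intro mult_mono) auto
    finally show ?case by simp
  qed
  thus ?thesis using that[of "max B 1"] by simp
qed

lemma countable_Theta: "countable (Theta_set \<alpha> c)"
proof -
  have "Theta_set \<alpha> c = (\<lambda>(t, k, l). t + of_int k * \<alpha> + of_int l) ` (circle_zeros c \<times> UNIV \<times> UNIV)"
    unfolding Theta_set_def by (auto simp: image_iff) blast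
  moreover have "countable (circle_zeros c)" by (rule countable_finite[OF finite_circle_zeros[OF an nz]])
  ultimately show ?thesis by (simp only:) (intro countable_image countable_SIGMA; simp)
qed

lemma nonzero_off_Theta:
  assumes "x \<notin> Theta_set \<alpha> c"
  shows "c (of_real (x + of_int k * \<alpha>)) \<noteq> 0"
proof
  assume "c (of_real (x + of_int k * \<alpha>)) = 0"
  hence "frac (x + of_int k * \<alpha>) \<in> circle_zeros c" by (rule frac_in_circle_zeros[OF an])
  moreover have "x = frac (x + of_int k * \<alpha>) + of_int (- k) * \<alpha> + of_int \<lfloor>x + of_int k * \<alpha>\<rfloor>"
    by (simp add: frac_def)
  ultimately have "x \<in> Theta_set \<alpha> c" unfolding Theta_set_def by blast
  thus False using assms by simp
qed

lemma AE_off_Theta: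
  assumes "\<And>x. x \<notin> Theta_set \<alpha> c \<Longrightarrow> P x"
  shows "AE x in circle_measure. P x"
  using AE_circle_countable[OF countable_Theta] assms by blast

lemma log_c_factorization:
  assumes g: "\<And>x. g x > 0" "\<And>x. norm (c (of_real x)) = g x * zero_factor c x" and "c (of_real x) \<noteq> 0"
  shows "log_c x = ln (g x) + (\<Sum>s\<in>circle_zeros c. real (nat (zorder c (of_real s))) * ln (chord (x - s)))"
proof -
  have z: "zero_factor c x \<noteq> 0" using zero_factor_eq_0_iff[OF an nz] assms(3) by simp
  hence pos: "chord (x - s) ^ nat (zorder c (of_real s)) \<noteq> 0" if "s \<in> circle_zeros c" for s
    using that finite_circle_zeros[OF an nz] unfolding zero_factor_def by (metis (no_types, lifting) prod_zero_iff)
  have "ln (zero_factor c x) = (\<Sum>s\<in>circle_zeros c. ln (chord (x - s) ^ nat (zorder c (of_real s))))"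
    unfolding zero_factor_def using pos finite_circle_zeros[OF an nz]
    by (intro ln_prod) (auto simp: order_less_le)
  also have "\<dots> = (\<Sum>s\<in>circle_zeros c. real (nat (zorder c (of_real s))) * ln (chord (x - s)))"
    using pos chord_nonneg by (intro sum.cong refl) (simp add: ln_realpow order_less_le)
  finally show ?thesis
    using g(1)[of x] z zero_factor_nonneg[of c x] unfolding log_c_def g(2) by (simp add: ln_mult order_less_le)
qed

lemma
  assumes gc: "continuous_on UNIV g" and g: "\<And>x. g x > 0" "\<And>x. norm (c (of_real x)) = g x * zero_factor c x"
  shows log_c_integrable': "integrable circle_measure log_c"
    and mean_log_c_eq: "mean_log_c = (\<integral>x. ln (g x) \<partial>circle_measure)"
proof -
  let ?m = "\<lambda>s. real (nat (zorder c (complex_of_real s)))"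
  let ?h = "\<lambda>x. ln (g x) + (\<Sum>s\<in>circle_zeros c. ?m s * ln (chord (x - s)))"
  have lc: "continuous_on UNIV (\<lambda>x. ln (g x))" using gc g(1) by (intro continuous_intros) (auto simp: less_imp_neq[symmetric])
  have per: "ln (chord (x + 1)) = ln (chord x)" for x by (simp add: chord_periodic)
  have sh: "integrable circle_measure (\<lambda>x. ln (chord (x - s)))" "(\<integral>x. ln (chord (x - s)) \<partial>circle_measure) = 0" for s
    using integrable_circle_affine[of "\<lambda>x. ln (chord x)" 1 "- s", OF _ per]
      integral_circle_affine[of "\<lambda>x. ln (chord x)" 1 "- s", OF _ per] ln_chord_integrable integral_ln_chord by simp_all
  have i: "integrable circle_measure (\<lambda>x. ln (g x))" by (rule integrable_circle_continuous[OF lc])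
  have ih: "integrable circle_measure ?h"
    by (intro Bochner_Integration.integrable_add i Bochner_Integration.integrable_sum integrable_mult_right sh)
  have ae: "AE x in circle_measure. log_c x = ?h x"
  proof (rule AE_off_Theta)
    fix x assume "x \<notin> Theta_set \<alpha> c"
    hence "c (of_real x) \<noteq> 0" using nonzero_off_Theta[of x 0] by simp
    thus "log_c x = ?h x" by (rule log_c_factorization[OF g])
  qed
  have m1: "log_c \<in> borel_measurable circle_measure" by (rule measurable_restrict_space1) measurable
  have m2: "?h \<in> borel_measurable circle_measure" using ih by (rule borel_measurable_integrable)
  show "integrable circle_measure log_c"
    using integrable_cong_AE[OF m1 m2 ae] ih by blast
  have "mean_log_c = (\<integral>x. ?h x \<partial>circle_measure)"
    unfolding mean_log_c_def by (rule integral_cong_AE[OF m1 m2 ae])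
  also have "\<dots> = (\<integral>x. ln (g x) \<partial>circle_measure)"
    by (subst Bochner_Integration.integral_add[OF i Bochner_Integration.integrable_sum])
       (auto simp: sh intro!: integrable_mult_right sum.neutral)
  finally show "mean_log_c = (\<integral>x. ln (g x) \<partial>circle_measure)" .
qed

lemma log_c_integrable: "integrable circle_measure log_c"
  using circle_factorization[OF an nz] log_c_integrable' by metis

lemma log_c_shift:
  "integrable circle_measure (\<lambda>x. log_c (x + s))" "(\<integral>x. log_c (x + s) \<partial>circle_measure) = mean_log_c"
  using integrable_circle_affine[of log_c 1 s, OF _ log_c_periodic] log_c_integrable
    integral_circle_affine[of log_c 1 s, OF _ log_c_periodic] by (simp_all add: mean_log_c_def)

text \<open>
  The logarithm of the absolute value of the determinant of the product of \<open>n\<close> matrices, away from the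
  zeros, as a sum that can be integrated term by term.
\<close>
definition log_det :: "nat \<Rightarrow> real \<Rightarrow> real" where
  "log_det n x = (\<Sum>j<n. log_c (x + (real j * \<alpha> - \<alpha>)) + log_c (x + real j * \<alpha>))"

lemma log_det_integrable: "integrable circle_measure (log_det n)"
  unfolding log_det_def by (intro Bochner_Integration.integrable_sum Bochner_Integration.integrable_add log_c_shift)

lemma integral_log_det: "(\<integral>x. log_det n x \<partial>circle_measure) = 2 * real n * mean_log_c"
proof -
  have "(\<integral>x. log_det n x \<partial>circle_measure) = (\<Sum>j<n. mean_log_c + mean_log_c)"
    unfolding log_det_def
    by (subst Bochner_Integration.integral_sum)
       (auto simp: log_c_shift intro!: Bochner_Integration.integrable_add sum.cong Bochner_Integration.integral_add[THEN trans])
  thus ?thesis by simp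
qed

lemma log_det_le_growth:
  assumes x: "x \<notin> Theta_set \<alpha> c"
  shows "growth n x > 0" "log_det n x \<le> ln 2 + 2 * ln (growth n x)"
proof -
  have c1: "c (of_real (x + real j * \<alpha>)) \<noteq> 0" for j
    using nonzero_off_Theta[OF x, of "int j"] by simp
  have c2: "c (of_real (x + real j * \<alpha> - \<alpha>)) \<noteq> 0" for j
  proof -
    have "x + real j * \<alpha> - \<alpha> = x + of_int (int j - 1) * \<alpha>" by (simp add: algebra_simps)
    thus ?thesis using nonzero_off_Theta[OF x, of "int j - 1"] by metis
  qed
  let ?P = "\<Prod>j<n. norm (c (of_real (x + real j * \<alpha> - \<alpha>))) * norm (c (of_real (x + real j * \<alpha>)))"
  have d: "norm (det (Mn n x)) = ?P"
    by (simp add: det_jacobi_iter c_prod_def norm_mult prod.distrib flip: prod_norm)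
  have pos: "?P > 0" using c1 c2 by (intro prod_pos) auto
  have le: "?P \<le> 2 * (growth n x)\<^sup>2" using norm_det_le_opnorm[of "Mn n x"] by (simp only: d growth_def)
  with pos have "(growth n x)\<^sup>2 > 0" by linarith
  thus g: "growth n x > 0" using growth_nonneg[of n x] by (simp add: order_less_le)
  have "log_det n x = ln ?P"
    using c1 c2 by (subst ln_prod) (auto simp: log_det_def log_c_def ln_mult add_diff_eq)
  also have "\<dots> \<le> ln (2 * (growth n x)\<^sup>2)"
    using le pos by (subst ln_le_cancel_iff) linarith+
  also have "\<dots> = ln 2 + 2 * ln (growth n x)" using g by (simp add: ln_mult ln_realpow)
  finally show "log_det n x \<le> ln 2 + 2 * ln (growth n x)" .
qed

text \<open>
  The products are bounded above by continuity, and below by their determinants, whose logarithm is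
  integrable.
\<close>
lemma ln_growth_integrable: "integrable circle_measure (\<lambda>x. ln (growth n x))"
proof -
  obtain K where K: "K \<ge> 1" "\<And>n x. growth n x \<le> K ^ n" using growth_exponential_bound by blast
  have "integrable circle_measure (\<lambda>x. K ^ n + (ln 2 + \<bar>log_det n x\<bar>))"
    using log_det_integrable by (intro Bochner_Integration.integrable_add integrable_circle_const integrable_abs)
  thus ?thesis
  proof (rule Bochner_Integration.integrable_bound)
    show "(\<lambda>x. ln (growth n x)) \<in> borel_measurable circle_measure"
      by (rule measurable_restrict_space1) measurable
    show "AE x in circle_measure. norm (ln (growth n x)) \<le> norm (K ^ n + (ln 2 + \<bar>log_det n x\<bar>))"
    proof (rule AE_off_Theta)
      fix x assume x: "x \<notin> Theta_set \<alpha> c"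
      have "ln (growth n x) \<le> growth n x - 1" using log_det_le_growth(1)[OF x] by (rule ln_le_minus_one)
      hence "ln (growth n x) \<le> K ^ n" using K(2)[of n x] by linarith
      moreover have "0 \<le> K ^ n" using K(1) by simp
      moreover have "0 \<le> ln (2::real)" by simp
      moreover note log_det_le_growth(2)[OF x, of n]
      ultimately have "\<bar>ln (growth n x)\<bar> \<le> K ^ n + (ln 2 + \<bar>log_det n x\<bar>)" by linarith
      thus "norm (ln (growth n x)) \<le> norm (K ^ n + (ln 2 + \<bar>log_det n x\<bar>))"
        unfolding real_norm_def by linarith
    qed
  qed
qed

definition mean_growth :: "nat \<Rightarrow> real" where
  "mean_growth n = (\<integral>x. ln (growth n x) \<partial>circle_measure)"

text \<open>
  The determinant of the product of \<open>n\<close> matrices has mean logarithm \<open>2n\<close> times that of \<open>|c|\<close>, which is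
  what makes the Lyapunov exponent nonnegative.
\<close>
lemma mean_growth_ge: "real n * mean_log_c - ln 2 / 2 \<le> mean_growth n"
proof -
  have "(\<integral>x. log_det n x \<partial>circle_measure) \<le> (\<integral>x. ln 2 + 2 * ln (growth n x) \<partial>circle_measure)"
    using log_det_le_growth(2)
    by (intro integral_mono_AE log_det_integrable Bochner_Integration.integrable_add integrable_circle_const
        integrable_mult_right ln_growth_integrable AE_off_Theta) auto
  also have "\<dots> = ln 2 + 2 * mean_growth n"
    by (subst Bochner_Integration.integral_add) (auto simp: ln_growth_integrable mean_growth_def)
  finally show ?thesis unfolding integral_log_det by simp
qed

lemma mean_growth_subadditive: "mean_growth (m + n) \<le> mean_growth m + mean_growth n"
proof -
  have per: "ln (growth m (x + 1)) = ln (growth m x)" for x by (simp add: growth_periodic)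
  have sh: "integrable circle_measure (\<lambda>x. ln (growth m (x + real n * \<alpha>)))"
    "(\<integral>x. ln (growth m (x + real n * \<alpha>)) \<partial>circle_measure) = mean_growth m"
    using integrable_circle_affine[of "\<lambda>x. ln (growth m x)" 1 "real n * \<alpha>", OF _ per] ln_growth_integrable[of m]
      integral_circle_affine[of "\<lambda>x. ln (growth m x)" 1 "real n * \<alpha>", OF _ per] by (simp_all add: mean_growth_def)
  have "mean_growth (m + n) \<le> (\<integral>x. ln (growth m (x + real n * \<alpha>)) + ln (growth n x) \<partial>circle_measure)"
    unfolding mean_growth_def
  proof (intro integral_mono_AE ln_growth_integrable Bochner_Integration.integrable_add sh AE_off_Theta)
    fix x assume x: "x \<notin> Theta_set \<alpha> c"
    have p: "0 < growth (m + n) x" "0 < growth n x" using log_det_le_growth(1)[OF x] by auto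
    have "0 < growth m (x + real n * \<alpha>) * growth n x" using p growth_add_le[of m n x] by linarith
    hence p': "0 < growth m (x + real n * \<alpha>)" using p(2) by (simp add: zero_less_mult_iff)
    have "ln (growth (m + n) x) \<le> ln (growth m (x + real n * \<alpha>) * growth n x)"
      using growth_add_le[of m n x] p by simp
    thus "ln (growth (m + n) x) \<le> ln (growth m (x + real n * \<alpha>)) + ln (growth n x)"
      using p p' by (simp add: ln_mult)
  qed
  also have "\<dots> = mean_growth m + mean_growth n"
    by (subst Bochner_Integration.integral_add[OF sh(1) ln_growth_integrable]) (simp add: sh mean_growth_def)
  finally show ?thesis .
qed

text \<open>
  The poles of the cocycle contribute the integrable term \<open>- n ln |c|\<close> to the mean.
\<close>
lemma cocycle_integral:
  "(LINT \<theta>:{0..1}|lborel. ln (onorm (\<lambda>x. cocycle_iter \<alpha> c v E n \<theta> *v x))) = mean_growth n - real n * mean_log_c"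
proof -
  let ?f = "\<lambda>x. ln (growth n x / norm (c_prod \<alpha> c n x))"
  let ?g = "\<lambda>x. ln (growth n x) - (\<Sum>j<n. log_c (x + real j * \<alpha>))"
  have "continuous_on UNIV (c_prod \<alpha> c n)"
    unfolding c_prod_def
    by (intro continuous_intros continuous_on_compose2[OF c_continuous[of UNIV]]) auto
  hence [measurable]: "c_prod \<alpha> c n \<in> borel_measurable borel" by (rule borel_measurable_continuous_onI)
  have "(LINT \<theta>:{0..1}|lborel. ln (onorm (\<lambda>x. cocycle_iter \<alpha> c v E n \<theta> *v x))) = (\<integral>x. ?f x \<partial>circle_measure)"
    unfolding opnorm_cocycle_iter growth_def[symmetric] by (rule set_integral_unit_interval_eq_circle)
  also have "\<dots> = (\<integral>x. ?g x \<partial>circle_measure)"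
  proof (rule integral_cong_AE)
    show "?f \<in> borel_measurable circle_measure" "?g \<in> borel_measurable circle_measure"
      by (rule measurable_restrict_space1, measurable)+
    show "AE x in circle_measure. ?f x = ?g x"
    proof (rule AE_off_Theta)
      fix x assume x: "x \<notin> Theta_set \<alpha> c"
      have c1: "c (of_real (x + real j * \<alpha>)) \<noteq> 0" for j
        using nonzero_off_Theta[OF x, of "int j"] by simp
      have "ln (norm (c_prod \<alpha> c n x)) = (\<Sum>j<n. log_c (x + real j * \<alpha>))"
        unfolding c_prod_def log_c_def prod_norm[symmetric] using c1 by (subst ln_prod) auto
      moreover have "norm (c_prod \<alpha> c n x) > 0" using c1 by (simp add: c_prod_def)
      ultimately show "?f x = ?g x" using log_det_le_growth(1)[OF x, of n] by (simp add: ln_div)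
    qed
  qed
  also have "\<dots> = mean_growth n - (\<Sum>j<n. \<integral>x. log_c (x + real j * \<alpha>) \<partial>circle_measure)"
    unfolding mean_growth_def
    by (subst Bochner_Integration.integral_diff)
       (auto intro!: ln_growth_integrable Bochner_Integration.integrable_sum log_c_shift
         simp: Bochner_Integration.integral_sum[OF log_c_shift(1)])
  finally show ?thesis by (simp add: log_c_shift)
qed

text \<open>
  The limit in the definition of the Lyapunov exponent exists.
\<close>
lemma
  shows lyapunov_nonneg: "0 \<le> lyapunov \<alpha> c v E"
    and lyapunov_LIMSEQ: "(\<lambda>n. 1 / of_nat n * (mean_growth n - real n * mean_log_c)) \<longlonglongrightarrow> lyapunov \<alpha> c v E"
proof -
  let ?a = "\<lambda>n. mean_growth n - real n * mean_log_c"
  have "?a (m + n) \<le> ?a m + ?a n" for m n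
    using mean_growth_subadditive[of m n] by (simp add: algebra_simps)
  moreover have "- (ln 2 / 2) \<le> ?a n" for n using mean_growth_ge[of n] by linarith
  ultimately obtain L where L: "L \<ge> 0" "(\<lambda>n. 1 / of_nat n * ?a n) \<longlonglongrightarrow> L"
    using subadditive_average_convergent[of ?a] by blast
  have "lyapunov \<alpha> c v E = L"
    unfolding lyapunov_def cocycle_integral by (rule limI[OF L(2)])
  thus "0 \<le> lyapunov \<alpha> c v E"
    "(\<lambda>n. 1 / of_nat n * ?a n) \<longlonglongrightarrow> lyapunov \<alpha> c v E" using L by auto
qed

end

section \<open>Three consecutive blocks\<close>

lemma norm_scalar_vec: "norm (k *s (x::complex^2)) = norm k * norm x"
  unfolding norm_vec_def by (subst L2_set_right_distrib) (simp_all add: norm_mult)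

lemma cayley_hamilton_vec:
  fixes A :: "complex^2^2"
  shows "A *v (A *v x) = trace A *s (A *v x) - det A *s x"
  by (simp add: vec_eq_iff forall_2 matrix_vector_mult_def sum_2 trace_def det_2 algebra_simps)

lemma norm_trace_le: "norm (trace (A :: complex^2^2)) \<le> 2 * opnorm A"
  using norm_triangle_ineq[of "A$1$1" "A$2$2"] norm_entry_le_opnorm[of A 1 1] norm_entry_le_opnorm[of A 2 2]
  by (simp add: trace_def sum_2)

lemma scalar_mult_vec: "A *v (k *s x) = k *s (A *v (x :: complex^2))" for A :: "complex^2^2"
  by (simp add: vec_eq_iff forall_2 matrix_vector_mult_def sum_2 algebra_simps)

lemma matrix_mult_diff_left: "A ** (B - B') = A ** B - A ** B'" for A B B' :: "complex^2^2"
  by (simp add: matrix_matrix_mult_def vec_eq_iff sum_subtractf right_diff_distrib)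

lemma matrix_mult_diff_right: "(A - A') ** B = A ** B - A' ** B" for A A' B :: "complex^2^2"
  by (simp add: matrix_matrix_mult_def vec_eq_iff sum_subtractf left_diff_distrib)

lemma norm_mult_vec_diff_le: "norm (A *v x) \<le> norm (B *v x) + opnorm (B - A) * norm x"
proof -
  have "A *v x = B *v x - (B - A) *v x" by (simp add: matrix_vector_mult_diff_rdistrib)
  hence "norm (A *v x) \<le> norm (B *v x) + norm ((B - A) *v x)" by (metis norm_triangle_ineq4)
  thus ?thesis using norm_mult_vec_le[of "B - A" x] by linarith
qed

text \<open>
  Gordon's alternative. If \<open>|tr A| \<le> |C|\<close>, the identity \<open>A\<^sup>2 - (tr A) A + det A = 0\<close> applied to \<open>X\<^sub>0\<close>
  bounds \<open>X\<^sub>0\<close> by \<open>X\<^sub>1\<close> and \<open>X\<^sub>2\<close>. If \<open>|tr A| > |C|\<close>, the same identity for \<open>A''\<close>, applied to \<open>X\<close>, bounds it by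
  \<open>X\<^sub>1\<close> and \<open>X\<close>. The scalars \<open>C\<close> are kept outside the matrices, so that the distance of the three
  matrices is measured against \<open>|C|\<close> once.
\<close>
lemma three_block_bound:
  fixes A A' A'' :: "complex^2^2"
  assumes step: "C *s X1 = A *v X0" "C' *s X2 = A' *v X1" "C'' *s X0 = A'' *v X"
    and nz: "C \<noteq> 0" "C'' \<noteq> 0"
    and close: "opnorm (A' - A) \<le> norm C / 12" "opnorm (A'' - A) \<le> norm C / 12"
    and ratio: "(norm C)\<^sup>2 / 2 \<le> norm (det A)" "norm C' \<le> 2 * norm C" "norm (det A'') \<le> 2 * norm C'' * norm C"
  shows "norm X0 \<le> 4 * (norm X1 + norm X2 + norm X)"
proof (cases "norm (trace A) \<le> norm C")
  case True
  have Cp: "norm C > 0" using nz by simp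
  have "C *s (A *v X1) = trace A *s (C *s X1) - det A *s X0"
    using cayley_hamilton_vec[of A X0] unfolding step(1)[symmetric] scalar_mult_vec .
  hence "det A *s X0 = C *s (trace A *s X1 - A *v X1)"
    by (simp add: vec_eq_iff algebra_simps)
  hence "norm (det A) * norm X0 = norm C * norm (trace A *s X1 - A *v X1)"
    by (metis norm_scalar_vec)
  also have "\<dots> \<le> norm C * (norm C * (2 * norm X1 + 2 * norm X2))"
  proof (intro mult_left_mono)
    have "norm (trace A *s X1 - A *v X1) \<le> norm (trace A *s X1) + norm (A *v X1)"
      by (rule norm_triangle_ineq4)
    moreover have "norm (trace A *s X1) \<le> norm C * norm X1"
      unfolding norm_scalar_vec by (rule mult_right_mono[OF True]) simp
    moreover have "norm (A *v X1) \<le> norm (A' *v X1) + opnorm (A' - A) * norm X1" by (rule norm_mult_vec_diff_le)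
    moreover have "norm (A' *v X1) \<le> 2 * norm C * norm X2"
      unfolding step(2)[symmetric] norm_scalar_vec by (rule mult_right_mono[OF ratio(2)]) simp
    moreover have "opnorm (A' - A) * norm X1 \<le> norm C * norm X1"
      using close(1) norm_ge_zero[of C] by (intro mult_right_mono) (linarith, simp)
    ultimately have "norm (trace A *s X1 - A *v X1) \<le> norm C * norm X1 + (2 * norm C * norm X2 + norm C * norm X1)"
      by linarith
    thus "norm (trace A *s X1 - A *v X1) \<le> norm C * (2 * norm X1 + 2 * norm X2)"
      by (simp add: distrib_left)
  qed simp
  also have "\<dots> = (norm C)\<^sup>2 * (2 * norm X1 + 2 * norm X2)"
    by (simp add: power2_eq_square)
  finally have "norm (det A) * norm X0 \<le> (norm C)\<^sup>2 * (2 * norm X1 + 2 * norm X2)" .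
  moreover have "(norm C)\<^sup>2 / 2 * norm X0 \<le> norm (det A) * norm X0"
    by (rule mult_right_mono[OF ratio(1)]) simp
  ultimately have "(norm C)\<^sup>2 * (norm X0 / 2) \<le> (norm C)\<^sup>2 * (2 * norm X1 + 2 * norm X2)" by simp
  hence "norm X0 / 2 \<le> 2 * norm X1 + 2 * norm X2"
    using Cp by (subst (asm) mult_le_cancel_left_pos) auto
  moreover have "0 \<le> 4 * norm X" by simp
  ultimately show ?thesis by argo
next
  case False
  have Cp: "norm C > 0" using nz by simp
  have "C'' *s (A'' *v X0) = C'' *s (trace A'' *s X0) - det A'' *s X"
    using cayley_hamilton_vec[of A'' X] unfolding step(3)[symmetric] scalar_mult_vec
    by (simp add: vec_eq_iff algebra_simps)
  hence "C'' *s (trace A'' *s X0 - A'' *v X0) = det A'' *s X"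
    by (simp add: vec_eq_iff algebra_simps)
  hence "norm C'' * norm (trace A'' *s X0 - A'' *v X0) = norm (det A'') * norm X"
    by (metis norm_scalar_vec)
  also have "\<dots> \<le> norm C'' * (2 * norm C * norm X)"
    using mult_right_mono[OF ratio(3), of "norm X"] by (simp add: mult_ac)
  finally have 1: "norm (trace A'' *s X0 - A'' *v X0) \<le> 2 * norm C * norm X"
    using nz(2) by (subst (asm) mult_le_cancel_left_pos) auto
  have eq: "opnorm (A - A'') = opnorm (A'' - A)" using opnorm_minus[of "A'' - A"] by simp
  have "norm (trace A'' *s X0) \<le> norm (trace A'' *s X0 - A'' *v X0) + norm (A'' *v X0)"
    using norm_triangle_ineq[of "trace A'' *s X0 - A'' *v X0" "A'' *v X0"] by simp
  moreover have "norm (A'' *v X0) \<le> norm (A *v X0) + opnorm (A'' - A) * norm X0"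
    using eq norm_mult_vec_diff_le[of A'' X0 A] by simp
  moreover have "norm (A *v X0) = norm C * norm X1" unfolding step(1)[symmetric] norm_scalar_vec ..
  ultimately have 2: "norm (trace A'') * norm X0 \<le> 2 * norm C * norm X + norm C * norm X1 + opnorm (A'' - A) * norm X0"
    using 1 unfolding norm_scalar_vec by linarith
  have "trace A = trace A'' + trace (A - A'')" by (simp add: trace_def sum_2)
  hence "norm (trace A) \<le> norm (trace A'') + norm (trace (A - A''))" by (metis norm_triangle_ineq)
  hence "norm C \<le> norm (trace A'') + 2 * opnorm (A'' - A)"
    using False norm_trace_le[of "A - A''"] eq by linarith
  hence "norm C * norm X0 \<le> (norm (trace A'') + 2 * opnorm (A'' - A)) * norm X0" by (rule mult_right_mono) simp
  also have "\<dots> \<le> 2 * norm C * norm X + norm C * norm X1 + 3 * (opnorm (A'' - A) * norm X0)"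
    using 2 by (simp add: algebra_simps)
  also have "3 * (opnorm (A'' - A) * norm X0) \<le> 3 * (norm C / 12 * norm X0)"
    by (intro mult_left_mono mult_right_mono close(2)) auto
  finally have "norm C * (3 / 4 * norm X0) \<le> norm C * (2 * norm X + norm X1)"
    by (simp add: algebra_simps)
  hence "3 / 4 * norm X0 \<le> 2 * norm X + norm X1"
    using Cp by (subst (asm) mult_le_cancel_left_pos) auto
  moreover have "0 \<le> norm X2" "0 \<le> norm X1" "0 \<le> norm X" by simp_all
  ultimately show ?thesis by argo
qed

section \<open>Uniform upper bounds for the matrix products\<close>

context singular_jacobi
begin

text \<open>
  The logarithm of a matrix product may be \<open>-\<infinity>\<close> at some phases. Truncated from below it is continuous,
  and by dominated convergence the truncation hardly changes the mean.
\<close>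
lemma regularized_mean_growth:
  assumes "mean_growth N < b"
  obtains \<eta> where "0 < \<eta>" "\<eta> \<le> 1" "(\<integral>x. ln (max \<eta> (growth N x)) \<partial>circle_measure) < b"
proof -
  let ?s = "\<lambda>k x. ln (max (1 / real (Suc k)) (growth N x))"
  have "(\<lambda>k. \<integral>x. ?s k x \<partial>circle_measure) \<longlonglongrightarrow> (\<integral>x. ln (growth N x) \<partial>circle_measure)"
  proof (rule integral_dominated_convergence[where w = "\<lambda>x. \<bar>ln (growth N x)\<bar>"])
    show "(\<lambda>x. ln (growth N x)) \<in> borel_measurable circle_measure"
      by (rule measurable_restrict_space1) measurable
    show "?s k \<in> borel_measurable circle_measure" for k
      by (rule measurable_restrict_space1) measurable
    show "integrable circle_measure (\<lambda>x. \<bar>ln (growth N x)\<bar>)" by (intro integrable_abs ln_growth_integrable)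
    show "AE x in circle_measure. (\<lambda>k. ?s k x) \<longlonglongrightarrow> ln (growth N x)"
    proof (rule AE_off_Theta)
      fix x assume "x \<notin> Theta_set \<alpha> c"
      hence p: "0 < growth N x" by (rule log_det_le_growth)
      have "(\<lambda>k. 1 / real (Suc k)) \<longlonglongrightarrow> 0" by (rule LIMSEQ_Suc[OF lim_1_over_n])
      hence "\<forall>\<^sub>F k in sequentially. 1 / real (Suc k) < growth N x" using p by (rule order_tendstoD)
      hence "\<forall>\<^sub>F k in sequentially. ln (growth N x) = ?s k x" by eventually_elim simp
      thus "(\<lambda>k. ?s k x) \<longlonglongrightarrow> ln (growth N x)" by (rule Lim_transform_eventually[OF tendsto_const])
    qed
    show "AE x in circle_measure. norm (?s k x) \<le> \<bar>ln (growth N x)\<bar>" for k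
    proof (rule AE_off_Theta)
      fix x assume "x \<notin> Theta_set \<alpha> c"
      hence p: "0 < growth N x" by (rule log_det_le_growth)
      show "norm (?s k x) \<le> \<bar>ln (growth N x)\<bar>"
      proof (cases "growth N x \<le> 1 / real (Suc k)")
        case True
        have "1 / real (Suc k) \<le> 1" by simp
        hence "ln (1 / real (Suc k)) \<le> 0" by (subst ln_le_zero_iff) auto
        moreover have "ln (growth N x) \<le> ln (1 / real (Suc k))" using True p by (subst ln_le_cancel_iff) auto
        ultimately show ?thesis using True by (simp add: max_def)
      qed (simp add: max_def)
    qed
  qed
  hence "\<forall>\<^sub>F k in sequentially. (\<integral>x. ?s k x \<partial>circle_measure) < b"
    using assms unfolding mean_growth_def by (rule order_tendstoD)
  then obtain k where "(\<integral>x. ?s k x \<partial>circle_measure) < b" by (auto simp: eventually_sequentially)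
  thus ?thesis using that[of "1 / real (Suc k)"] by simp
qed

text \<open>
  Choose \<open>N\<close> such that the mean of \<open>ln (growth N) / N\<close> is close to its limit, and let \<open>f\<close> be a continuous
  majorant of \<open>ln (growth N)\<close> with nearly the same mean. Each step of length \<open>N\<close> starting at time \<open>n\<close>
  costs at most \<open>f(x + n \<alpha>)\<close>. The product of \<open>N\<close> consecutive values of the growth averages over
  the \<open>N\<close> possible starting points: from \<open>n\<close> to \<open>n + 1\<close> it gains at most the factor
  \<open>exp (f(x + n \<alpha>))\<close>, so it is controlled by a full orbit sum of \<open>f\<close>.
\<close>
lemma uniform_growth:
  assumes "e > 0"
  obtains D where "D > 0" "\<And>n x. growth n x \<le> D * exp (real n * (lyapunov \<alpha> c v E + mean_log_c + e))"
proof -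
  define \<rho> where "\<rho> = lyapunov \<alpha> c v E + mean_log_c + e"
  have "\<forall>\<^sub>F n in sequentially. 1 / of_nat n * (mean_growth n - real n * mean_log_c) < lyapunov \<alpha> c v E + e / 2"
    using lyapunov_LIMSEQ \<open>e > 0\<close> by (intro order_tendstoD) auto
  with eventually_gt_at_top[of 0]
  have "\<forall>\<^sub>F n in sequentially. 0 < n \<and> 1 / of_nat n * (mean_growth n - real n * mean_log_c) < lyapunov \<alpha> c v E + e / 2"
    by eventually_elim simp
  then obtain N where N: "N > 0" "1 / of_nat N * (mean_growth N - real N * mean_log_c) < lyapunov \<alpha> c v E + e / 2"
    by (auto simp: eventually_sequentially)
  hence "mean_growth N - real N * mean_log_c < real N * (lyapunov \<alpha> c v E + e / 2)"
    by (simp add: field_simps)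
  hence "mean_growth N < real N * (\<rho> - e / 2)"
    by (simp add: \<rho>_def algebra_simps)
  then obtain \<eta> where \<eta>: "0 < \<eta>" "\<eta> \<le> 1" "(\<integral>x. ln (max \<eta> (growth N x)) \<partial>circle_measure) < real N * (\<rho> - e / 2)"
    by (rule regularized_mean_growth)
  define f where "f = (\<lambda>x. ln (max \<eta> (growth N x)))"
  have f_per: "f (x + 1) = f x" for x by (simp add: f_def growth_periodic)
  have f_cont: "continuous_on UNIV f"
    unfolding f_def using \<eta>(1) by (intro continuous_intros growth_continuous) (auto simp: max_def)
  have fN: "growth N x \<le> exp (f x)" for x using \<eta>(1) by (simp add: f_def exp_ln_iff[THEN iffD2] less_max_iff_disj)
  have e2: "real N * (e / 2) > 0" using N(1) \<open>e > 0\<close> by simp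
  obtain C where C: "\<And>n x. (\<Sum>j<n. f (x + real j * \<alpha>)) \<le> real n * ((\<integral>y. f y \<partial>circle_measure) + real N * (e / 2)) + C"
    using rotation_sum_upper[OF irr f_per f_cont e2] by blast
  have sumf: "(\<Sum>j<n. f (x + real j * \<alpha>)) \<le> real n * (real N * \<rho>) + C" for n x
  proof -
    have "(\<integral>y. f y \<partial>circle_measure) + real N * (e / 2) \<le> real N * \<rho>"
      using \<eta>(3) by (simp add: f_def algebra_simps)
    hence "real n * ((\<integral>y. f y \<partial>circle_measure) + real N * (e / 2)) \<le> real n * (real N * \<rho>)"
      by (rule mult_left_mono) simp
    thus ?thesis using C[where n=n and x=x] by linarith
  qed
  obtain K where K: "K \<ge> 1" "\<And>n x. growth n x \<le> K ^ n" using growth_exponential_bound by blast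
  have KN: "K ^ i \<le> K ^ N" if "i \<le> N" for i using that K(1) by (rule power_increasing)
  have prodb: "(\<Prod>i<N. growth (n + i) x) \<le> (K ^ N) ^ N * exp (\<Sum>j<n. f (x + real j * \<alpha>))" for n x
  proof (induction n)
    case 0
    have "(\<Prod>i<N. growth (0 + i) x) \<le> (\<Prod>i<N. K ^ N)"
      by (intro prod_mono) (auto intro: order_trans[OF K(2) KN])
    thus ?case by simp
  next
    case (Suc n)
    obtain m where m: "N = Suc m" using N(1) gr0_conv_Suc by blast
    let ?Q = "\<Prod>i<m. growth (n + Suc i) x"
    have "growth (Suc n + m) x = growth (N + n) x" by (simp add: m add.commute)
    also have "\<dots> \<le> growth N (x + real n * \<alpha>) * growth n x" by (rule growth_add_le)
    also have "\<dots> \<le> exp (f (x + real n * \<alpha>)) * growth n x" by (intro mult_right_mono fN) simp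
    finally have last: "growth (Suc n + m) x \<le> exp (f (x + real n * \<alpha>)) * growth n x" .
    have "(\<Prod>i<N. growth (Suc n + i) x) = ?Q * growth (Suc n + m) x" by (simp add: m)
    also have "\<dots> \<le> ?Q * (exp (f (x + real n * \<alpha>)) * growth n x)"
      by (intro mult_left_mono last prod_nonneg) auto
    also have "\<dots> = (\<Prod>i<N. growth (n + i) x) * exp (f (x + real n * \<alpha>))"
      unfolding m prod.lessThan_Suc_shift by (simp add: mult_ac)
    also have "\<dots> \<le> (K ^ N) ^ N * exp (\<Sum>j<n. f (x + real j * \<alpha>)) * exp (f (x + real n * \<alpha>))"
      by (intro mult_right_mono Suc) simp
    finally show ?case by (simp add: exp_add mult_ac)
  qed
  define D0 where "D0 = max 1 ((K ^ N) ^ N * ((K ^ N) ^ N * exp C))"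
  have D0: "D0 \<ge> 1" by (simp add: D0_def)
  have big: "growth (N + n) x \<le> D0 * exp (real n * \<rho>)" for n x
  proof -
    have "growth (N + n) x \<le> K ^ N * growth (n + i) x" if "i < N" for i
    proof -
      have "growth ((N - i) + (n + i)) x \<le> growth (N - i) (x + real (n + i) * \<alpha>) * growth (n + i) x"
        by (rule growth_add_le)
      also have "\<dots> \<le> K ^ N * growth (n + i) x"
        by (intro mult_right_mono order_trans[OF K(2) KN]) auto
      finally show ?thesis using that by (simp add: add.commute)
    qed
    hence "(\<Prod>i<N. growth (N + n) x) \<le> (\<Prod>i<N. K ^ N * growth (n + i) x)"
      by (intro prod_mono) auto
    hence "growth (N + n) x ^ N \<le> (K ^ N) ^ N * (\<Prod>i<N. growth (n + i) x)"
      by (simp add: prod.distrib)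
    also have "\<dots> \<le> (K ^ N) ^ N * ((K ^ N) ^ N * exp (real n * (real N * \<rho>) + C))"
    proof (intro mult_left_mono)
      have "exp (\<Sum>j<n. f (x + real j * \<alpha>)) \<le> exp (real n * (real N * \<rho>) + C)" using sumf by simp
      hence "(K ^ N) ^ N * exp (\<Sum>j<n. f (x + real j * \<alpha>)) \<le> (K ^ N) ^ N * exp (real n * (real N * \<rho>) + C)"
        using K(1) by (intro mult_left_mono) auto
      thus "(\<Prod>i<N. growth (n + i) x) \<le> (K ^ N) ^ N * exp (real n * (real N * \<rho>) + C)"
        using prodb[of n x] by linarith
    qed (use K(1) in simp)
    also have "\<dots> \<le> D0 * exp (real n * (real N * \<rho>))"
    proof -
      have "(K ^ N) ^ N * ((K ^ N) ^ N * exp C) * exp (real n * (real N * \<rho>)) \<le> D0 * exp (real n * (real N * \<rho>))"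
        by (intro mult_right_mono) (auto simp: D0_def)
      thus ?thesis by (simp add: exp_add mult_ac)
    qed
    also have "\<dots> \<le> D0 ^ N * exp (real n * (real N * \<rho>))"
      using D0 N(1) by (intro mult_right_mono self_le_power) auto
    also have "\<dots> = (D0 * exp (real n * \<rho>)) ^ N"
      by (simp add: power_mult_distrib exp_of_nat_mult[symmetric] mult_ac)
    finally show ?thesis
      using D0 N(1) by (subst (asm) power_mono_iff) auto
  qed
  define D where "D = (D0 + K ^ N) * exp (real N * \<bar>\<rho>\<bar>)"
  have Kp: "K ^ N > 0" using K(1) by simp
  have "growth n x \<le> D * exp (real n * \<rho>)" for n x
  proof (cases "n < N")
    case True
    have "- (real n * \<rho>) \<le> real N * \<bar>\<rho>\<bar>"
    proof -
      have "- (real n * \<rho>) \<le> real n * \<bar>\<rho>\<bar>" using mult_left_mono[of "- \<rho>" "\<bar>\<rho>\<bar>" "real n"] by simp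
      also have "\<dots> \<le> real N * \<bar>\<rho>\<bar>" using True by (intro mult_right_mono) auto
      finally show ?thesis .
    qed
    hence "exp 0 \<le> exp (real N * \<bar>\<rho>\<bar> + real n * \<rho>)" by (subst exp_le_cancel_iff) linarith
    hence "(D0 + K ^ N) * 1 \<le> (D0 + K ^ N) * exp (real N * \<bar>\<rho>\<bar> + real n * \<rho>)"
      using D0 Kp by (intro mult_left_mono) auto
    moreover have "growth n x \<le> K ^ N" using True by (intro order_trans[OF K(2) KN]) auto
    ultimately show ?thesis using D0 by (simp add: D_def exp_add mult_ac)
  next
    case False
    then obtain m where m: "n = N + m" using le_Suc_ex not_less by blast
    have "growth n x \<le> D0 * exp (real m * \<rho>)" unfolding m by (rule big)
    also have "\<dots> \<le> (D0 + K ^ N) * exp (real N * \<bar>\<rho>\<bar> + real n * \<rho>)"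
    proof (intro mult_mono)
      have "0 \<le> real N * \<bar>\<rho>\<bar> + real N * \<rho>"
        using mult_left_mono[OF abs_ge_minus_self[of \<rho>], of "real N"] by simp
      thus "exp (real m * \<rho>) \<le> exp (real N * \<bar>\<rho>\<bar> + real n * \<rho>)"
        by (simp add: m algebra_simps)
    qed (use D0 Kp in auto)
    finally show ?thesis by (simp add: D_def exp_add mult_ac)
  qed
  moreover have "D > 0" using D0 Kp by (simp add: D_def)
  ultimately show ?thesis using that unfolding \<rho>_def by blast
qed

text \<open>
  The difference of the products telescopes. The additional factor on the left makes the induction
  work: it turns each term into a product of two shorter blocks, which are bounded by the uniform
  growth estimate rather than factor by factor.
\<close>
lemma jacobi_iter_diff_le:
  assumes D: "D > 0" "\<And>n x. growth n x \<le> D * exp (real n * \<rho>)"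
    and \<tau>: "\<And>x. opnorm (M (x + s) - M x) \<le> \<tau>"
  shows "opnorm (Mn n (x + s) - Mn n x) \<le> real n * \<tau> * D\<^sup>2 * exp ((real n - 1) * \<rho>)"
proof -
  have \<tau>0: "\<tau> \<ge> 0" using \<tau>[of 0] opnorm_nonneg order_trans by blast
  \<comment> \<open>The claim is the case \<open>k = 0\<close>.\<close>
  have "opnorm (Mn k (x + s + real n * \<alpha>) ** (Mn n (x + s) - Mn n x))
      \<le> real n * \<tau> * D\<^sup>2 * exp ((real k + real n - 1) * \<rho>)" for k
  proof (induction n arbitrary: k)
    case 0
    show ?case by (simp add: opnorm_def onorm_zero matrix_matrix_mult_def matrix_vector_mult_def zero_vec_def[symmetric])
  next
    case (Suc n)
    let ?y = "x + s" and ?d = "Mn n (x + s) - Mn n x"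
    let ?W = "Mn k (?y + real (Suc n) * \<alpha>)"
    have comm: "?W ** M (?y + real n * \<alpha>) = Mn (Suc k) (?y + real n * \<alpha>)"
      using jacobi_iter_add[of \<alpha> c v E k 1 "?y + real n * \<alpha>"] by (simp add: algebra_simps)
    have "Mn (Suc n) ?y - Mn (Suc n) x
        = M (?y + real n * \<alpha>) ** ?d + (M (?y + real n * \<alpha>) - M (x + real n * \<alpha>)) ** Mn n x"
      by (simp add: matrix_mult_diff_left matrix_mult_diff_right)
    hence "?W ** (Mn (Suc n) ?y - Mn (Suc n) x)
        = (?W ** M (?y + real n * \<alpha>)) ** ?d + ?W ** ((M (?y + real n * \<alpha>) - M (x + real n * \<alpha>)) ** Mn n x)"
      by (simp only: matrix_add_ldistrib matrix_mul_assoc)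
    hence "opnorm (?W ** (Mn (Suc n) ?y - Mn (Suc n) x))
        \<le> opnorm (Mn (Suc k) (?y + real n * \<alpha>) ** ?d)
          + opnorm (?W ** ((M (?y + real n * \<alpha>) - M (x + real n * \<alpha>)) ** Mn n x))"
      unfolding comm by (simp only: opnorm_add_le)
    also have "opnorm (Mn (Suc k) (?y + real n * \<alpha>) ** ?d) \<le> real n * \<tau> * D\<^sup>2 * exp ((real (Suc k) + real n - 1) * \<rho>)"
      by (rule Suc)
    also have "opnorm (?W ** ((M (?y + real n * \<alpha>) - M (x + real n * \<alpha>)) ** Mn n x))
        \<le> (D * exp (real k * \<rho>)) * (\<tau> * (D * exp (real n * \<rho>)))"
    proof -
      have "opnorm (M (?y + real n * \<alpha>) - M (x + real n * \<alpha>)) \<le> \<tau>"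
        using \<tau>[of "x + real n * \<alpha>"] by (simp add: add_ac)
      thus ?thesis
        using D(2)[of k "?y + real (Suc n) * \<alpha>"] D(2)[of n x] \<tau>0 D(1)
        by (intro order_trans[OF opnorm_mult_le] mult_mono) (auto simp: growth_def)
    qed
    also have "(D * exp (real k * \<rho>)) * (\<tau> * (D * exp (real n * \<rho>))) = \<tau> * D\<^sup>2 * exp ((real k + real n) * \<rho>)"
      unfolding distrib_right[of "real k" "real n"] exp_add by (simp add: power2_eq_square mult_ac)
    finally show ?case by (simp add: algebra_simps)
  qed
  from this[of 0] show ?thesis by simp
qed

text \<open>
  Everything is \<open>1\<close>-periodic, so only the distance of the shift from an integer matters.
\<close>
lemma jacobi_mat_lipschitz:
  obtains K where "K \<ge> 0" "\<And>x s k. opnorm (M (x + s) - M x) \<le> K * \<bar>s - of_int k\<bar>"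
    "\<And>x s k. norm (c (of_real (x + s))) \<le> norm (c (of_real x)) + K * \<bar>s - of_int k\<bar>"
proof -
  obtain Kc where Kc: "Kc \<ge> 0" "\<And>x y::real. norm (c (of_real x) - c (of_real y)) \<le> Kc * \<bar>x - y\<bar>"
    using circle_analytic_lipschitz[OF an] by blast
  obtain Kv where Kv: "Kv-lipschitz_on UNIV v" using v_lip by blast
  have Kv0: "Kv \<ge> 0" using Kv by (rule lipschitz_on_nonneg)
  have cs: "norm (c (of_real (x + s)) - c (of_real x)) \<le> Kc * \<bar>s - of_int k\<bar>" for x s k
    using periodic_int_shift[of "\<lambda>x. c (of_real x)" "x + s" "- k", OF circle_analytic_periodic[OF an]]
      Kc(2)[of "x + s + of_int (- k)" x] by (simp add: algebra_simps)
  have vs: "\<bar>v (x + s) - v x\<bar> \<le> Kv * \<bar>s - of_int k\<bar>" for x s k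
    using periodic_int_shift[of v "x + s" "- k", OF v_per]
      lipschitz_onD[OF Kv, of "x + s + of_int (- k)" x] by (simp add: dist_real_def algebra_simps)
  have "opnorm (M (x + s) - M x) \<le> (Kv + 2 * Kc) * \<bar>s - of_int k\<bar>" for x s k
  proof -
    let ?A = "M (x + s) - M x"
    have "norm (?A $1$1) = \<bar>v (x + s) - v x\<bar>"
    proof -
      have "?A $1$1 = of_real (v x - v (x + s))" by simp
      thus ?thesis by (simp only: norm_of_real abs_minus_commute)
    qed
    moreover have "norm (?A $1$2) = norm (c (of_real (x - \<alpha> + s)) - c (of_real (x - \<alpha>)))"
    proof -
      have "?A $1$2 = - cnj (c (of_real (x - \<alpha> + s)) - c (of_real (x - \<alpha>)))"
        by (simp only: vector_minus_component jacobi_mat_nth conj_ext_of_real complex_cnj_diff add_diff_eq diff_add_eq)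
           simp
      thus ?thesis by (simp only: norm_minus_cancel complex_mod_cnj)
    qed
    moreover have "norm (?A $2$1) = norm (c (of_real (x + s)) - c (of_real x))"
      by (simp only: vector_minus_component jacobi_mat_nth)
    moreover have "norm (?A $2$2) = 0" by simp
    ultimately have "opnorm ?A \<le> Kv * \<bar>s - of_int k\<bar> + Kc * \<bar>s - of_int k\<bar> + Kc * \<bar>s - of_int k\<bar> + 0"
      using opnorm_le_entries[of ?A] vs[of x s k] cs[of "x - \<alpha>" s k] cs[of x s k] by linarith
    thus ?thesis by (simp add: algebra_simps)
  qed
  moreover have "norm (c (of_real (x + s))) \<le> norm (c (of_real x)) + (Kv + 2 * Kc) * \<bar>s - of_int k\<bar>" for x s k
  proof -
    have "Kc * \<bar>s - of_int k\<bar> \<le> (Kv + 2 * Kc) * \<bar>s - of_int k\<bar>"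
      using Kc(1) Kv0 by (intro mult_right_mono) auto
    thus ?thesis using cs[of x s k] norm_triangle_ineq2[of "c (of_real (x + s))" "c (of_real x)"] by linarith
  qed
  ultimately show ?thesis using that[of "Kv + 2 * Kc"] Kc(1) Kv0 by simp
qed

section \<open>Solutions of the eigenvalue equation\<close>

definition cauchy_vec :: "(int \<Rightarrow> complex) \<Rightarrow> int \<Rightarrow> complex^2" where
  "cauchy_vec u n = vector [u n, u (n - 1)]"

lemma cauchy_vec_nth [simp]: "cauchy_vec u n $ 1 = u n" "cauchy_vec u n $ 2 = u (n - 1)"
  by (simp_all add: cauchy_vec_def)

lemma cauchy_vec_step:
  assumes "H_op \<alpha> c v \<theta> u = (\<lambda>n. of_real E * u n)"
  shows "c (of_real (\<theta> + of_int n * \<alpha>)) *s cauchy_vec u (n + 1) = M (\<theta> + of_int n * \<alpha>) *v cauchy_vec u n"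
proof -
  have "c (of_real (\<theta> + of_int n * \<alpha>)) * u (n + 1)
      + conj_ext c (of_real (\<theta> + of_int (n - 1) * \<alpha>)) * u (n - 1)
      + of_real (v (\<theta> + of_int n * \<alpha>)) * u n = of_real E * u n"
    using fun_cong[OF assms, of n] unfolding H_op_def .
  moreover have "\<theta> + of_int (n - 1) * \<alpha> = \<theta> + of_int n * \<alpha> - \<alpha>" by (simp add: algebra_simps)
  ultimately have "c (of_real (\<theta> + of_int n * \<alpha>)) * u (n + 1)
      = of_real (E - v (\<theta> + of_int n * \<alpha>)) * u n - conj_ext c (of_real (\<theta> + of_int n * \<alpha> - \<alpha>)) * u (n - 1)"
    by (simp add: algebra_simps)
  thus ?thesis
    unfolding vec_eq_iff forall_2 matrix_vector_mult_def sum_2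
    by (simp del: of_real_add of_real_diff conj_ext_of_real)
qed

lemma cauchy_vec_steps:
  assumes "H_op \<alpha> c v \<theta> u = (\<lambda>n. of_real E * u n)"
  shows "c_prod \<alpha> c n (\<theta> + of_int k * \<alpha>) *s cauchy_vec u (k + int n) = Mn n (\<theta> + of_int k * \<alpha>) *v cauchy_vec u k"
proof (induction n)
  case 0
  show ?case by (simp add: c_prod_def)
next
  case (Suc n)
  let ?y = "\<theta> + of_int k * \<alpha> + real n * \<alpha>"
  have y: "\<theta> + of_int (k + int n) * \<alpha> = ?y" by (simp add: algebra_simps)
  have "c_prod \<alpha> c (Suc n) (\<theta> + of_int k * \<alpha>) *s cauchy_vec u (k + int (Suc n))
      = c_prod \<alpha> c n (\<theta> + of_int k * \<alpha>) *s (c (of_real ?y) *s cauchy_vec u (k + int n + 1))"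
    by (simp add: c_prod_def vec_eq_iff mult_ac add_ac)
  also have "c (of_real ?y) *s cauchy_vec u (k + int n + 1) = M ?y *v cauchy_vec u (k + int n)"
    using cauchy_vec_step[OF assms, of "k + int n"] unfolding y .
  also have "c_prod \<alpha> c n (\<theta> + of_int k * \<alpha>) *s (M ?y *v cauchy_vec u (k + int n))
      = M ?y *v (Mn n (\<theta> + of_int k * \<alpha>) *v cauchy_vec u k)"
    unfolding scalar_mult_vec[symmetric] Suc ..
  finally show ?case by (simp add: matrix_vector_mul_assoc)
qed

text \<open>
  Since \<open>c\<close> does not vanish along the orbit, the recursion determines the solution in both directions.
\<close>
lemma cauchy_vec_nonzero:
  assumes eq: "H_op \<alpha> c v \<theta> u = (\<lambda>n. of_real E * u n)" and \<theta>: "\<theta> \<notin> Theta_set \<alpha> c" and "u \<noteq> (\<lambda>n. 0)"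
  shows "cauchy_vec u 0 \<noteq> 0"
proof
  assume z: "cauchy_vec u 0 = 0"
  note cn = nonzero_off_Theta[OF \<theta>]
  have up: "cauchy_vec u (n + 1) = 0" if "cauchy_vec u n = 0" for n
  proof -
    have "c (of_real (\<theta> + of_int n * \<alpha>)) *s cauchy_vec u (n + 1) = 0"
      using cauchy_vec_step[OF eq, of n] that by simp
    thus ?thesis using cn[of n] by (simp add: vec_eq_iff del: of_real_add)
  qed
  have down: "cauchy_vec u (n - 1) = 0" if "cauchy_vec u n = 0" for n
  proof -
    have "M (\<theta> + of_int (n - 1) * \<alpha>) *v cauchy_vec u (n - 1) = 0"
      using cauchy_vec_step[OF eq, of "n - 1"] that by simp
    hence m: "(M (\<theta> + of_int (n - 1) * \<alpha>) *v cauchy_vec u (n - 1)) $ i = 0" for i by simp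
    have "c (of_real (\<theta> + of_int (n - 1) * \<alpha>)) * u (n - 1) = 0"
      using m[of 2] by (simp add: matrix_vector_mult_def sum_2 del: of_real_add of_int_diff)
    hence u1: "u (n - 1) = 0" using cn[of "n - 1"] by (simp del: of_real_add of_int_diff)
    have e: "\<theta> + of_int (n - 1) * \<alpha> - \<alpha> = \<theta> + of_int (n - 2) * \<alpha>" by (simp add: algebra_simps)
    have "conj_ext c (of_real (\<theta> + of_int (n - 1) * \<alpha> - \<alpha>)) * u (n - 1 - 1) = 0"
      using m[of 1] u1 by (simp add: matrix_vector_mult_def sum_2 del: of_real_add of_int_diff of_real_diff conj_ext_of_real)
    hence "u (n - 1 - 1) = 0" using cn[of "n - 2"] unfolding e conj_ext_of_real by simp
    with u1 show ?thesis by (simp add: vec_eq_iff forall_2)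
  qed
  have "cauchy_vec u n = 0" for n
    by (induction n rule: int_induct[where k=0]) (use z up down in auto)
  hence "cauchy_vec u n $ 1 = 0" for n by simp
  hence "u = (\<lambda>n. 0)" by auto
  thus False using assms(3) by simp
qed

end

lemma ell2_tendsto_0:
  fixes f :: "nat \<Rightarrow> int"
  assumes "u \<in> ell2" "inj f"
  shows "(\<lambda>n. u (f n)) \<longlonglongrightarrow> 0"
proof -
  have "(\<lambda>n. (norm (u n))\<^sup>2) summable_on (range f)"
    using assms(1) unfolding ell2_def by (auto intro: summable_on_subset_banach)
  hence "((\<lambda>n. (norm (u n))\<^sup>2) \<circ> f) summable_on UNIV"
    using summable_on_reindex[OF assms(2)] by blast
  hence "summable (\<lambda>n. (norm (u (f n)))\<^sup>2)"
    by (simp add: o_def summable_on_imp_summable)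
  hence "(\<lambda>n. (norm (u (f n)))\<^sup>2) \<longlonglongrightarrow> 0" by (rule summable_LIMSEQ_zero)
  hence "(\<lambda>n. sqrt ((norm (u (f n)))\<^sup>2)) \<longlonglongrightarrow> sqrt 0" by (rule tendsto_real_sqrt)
  thus ?thesis by (simp add: tendsto_norm_zero_iff)
qed

section \<open>Absence of eigenvalues for \<open>L < \<delta>\<close>\<close>

lemma power_exp_tendsto_0:
  assumes "b > 0"
  shows "((\<lambda>x::real. x ^ m * exp (- (b * x))) \<longlongrightarrow> 0) at_top"
proof -
  have "filterlim (\<lambda>x. b * x) at_top at_top"
    using assms by (intro filterlim_tendsto_pos_mult_at_top[OF tendsto_const _ filterlim_ident])
  hence "((\<lambda>x. (b * x) ^ m / exp (b * x)) \<longlongrightarrow> 0) at_top"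
    by (rule filterlim_compose[OF tendsto_power_div_exp_0])
  hence "((\<lambda>x. (1 / b) ^ m * ((b * x) ^ m / exp (b * x))) \<longlongrightarrow> (1 / b) ^ m * 0) at_top"
    by (intro tendsto_intros)
  moreover have "(\<lambda>x. (1 / b) ^ m * ((b * x) ^ m / exp (b * x))) = (\<lambda>x. x ^ m * exp (- (b * x)))"
    using assms by (auto simp: exp_minus power_mult_distrib field_simps)
  ultimately show ?thesis by simp
qed

text \<open>
  With \<open>w j = |c(\<theta> + j \<alpha>)|\<close> these are the products of \<open>|c|\<close> that occur in the determinants and scalars of
  the three blocks. A shift by \<open>N\<close> changes each factor by \<open>1 + \<eta>\<close> at most; a shift by one changes a
  product only in its two end factors, which are a distance \<open>N\<close> apart.
\<close>
lemma quasiperiodic_products: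
  fixes w :: "int \<Rightarrow> real"
  assumes N: "N \<ge> 1" and pos: "\<And>j. w j > 0" and \<eta>: "\<eta> \<ge> 0" "(1 + \<eta>) ^ Suc N \<le> 2"
    and fwd: "\<And>j. -1 \<le> j \<Longrightarrow> j < int N \<Longrightarrow> w (j + int N) \<le> (1 + \<eta>) * w j"
    and bwd: "\<And>j. -1 \<le> j \<Longrightarrow> j < int N \<Longrightarrow> w (j - int N) \<le> (1 + \<eta>) * w j"
  shows "(\<Prod>j<N. w (int j)) / 2 \<le> (\<Prod>j<N. w (int j - 1))"
    and "(\<Prod>j<N. w (int j + int N)) \<le> 2 * (\<Prod>j<N. w (int j))"
    and "(\<Prod>j<N. w (int j - 1 - int N)) \<le> 2 * (\<Prod>j<N. w (int j))"
proof -
  let ?C = "\<Prod>j<N. w (int j)" and ?S = "\<Prod>j<N. w (int j - 1)"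
  have C0: "?C > 0" and S0: "?S > 0" using pos by (auto intro: prod_pos)
  have p1: "(1 + \<eta>) ^ k \<le> 2" if "k \<le> Suc N" for k
    using order_trans[OF power_increasing[OF that, of "1 + \<eta>"] \<eta>(2)] \<eta>(1) by simp
  have e: "int N - 1 = -1 + int N" by simp
  have tel: "?S * w (int N - 1) = w (-1) * ?C"
  proof -
    have "?S * w (int N - 1) = (\<Prod>j<Suc N. w (int j - 1))" by simp
    also have "\<dots> = w (-1) * ?C" by (subst prod.lessThan_Suc_shift) simp
    finally show ?thesis .
  qed
  have "w (-1) * ?C \<le> ?S * (2 * w (-1))"
  proof -
    have "w (int N - 1) \<le> (1 + \<eta>) * w (-1)" using fwd[of "-1"] N unfolding e by simp
    also have "\<dots> \<le> 2 * w (-1)" using p1[of 1] pos[of "-1"] by (intro mult_right_mono) auto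
    finally have "?S * w (int N - 1) \<le> ?S * (2 * w (-1))" using S0 by (intro mult_left_mono) auto
    thus ?thesis unfolding tel .
  qed
  hence "w (-1) * ?C \<le> w (-1) * (2 * ?S)" by (simp add: mult_ac)
  hence "?C \<le> 2 * ?S" using pos[of "-1"] by (subst (asm) mult_le_cancel_left_pos) auto
  thus "?C / 2 \<le> ?S" by simp
  have "?S * w (int N - 1) \<le> ((1 + \<eta>) * w (int N - 1)) * ?C"
  proof -
    have "w (-1) \<le> (1 + \<eta>) * w (int N - 1)" using bwd[of "int N - 1"] N by simp
    thus ?thesis unfolding tel using C0 by (intro mult_right_mono) auto
  qed
  hence "w (int N - 1) * ?S \<le> w (int N - 1) * ((1 + \<eta>) * ?C)" by (simp add: mult_ac)
  hence S_le: "?S \<le> (1 + \<eta>) * ?C" using pos[of "int N - 1"] by (subst (asm) mult_le_cancel_left_pos) auto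
  have "(\<Prod>j<N. w (int j + int N)) \<le> (\<Prod>j<N. (1 + \<eta>) * w (int j))"
    by (intro prod_mono conjI fwd less_imp_le[OF pos]) auto
  also have "\<dots> = (1 + \<eta>) ^ N * ?C" by (simp add: prod.distrib)
  also have "\<dots> \<le> 2 * ?C" using p1[of N] C0 by (intro mult_right_mono) auto
  finally show "(\<Prod>j<N. w (int j + int N)) \<le> 2 * ?C" .
  have "(\<Prod>j<N. w (int j - 1 - int N)) \<le> (\<Prod>j<N. (1 + \<eta>) * w (int j - 1))"
    by (intro prod_mono conjI bwd less_imp_le[OF pos]) auto
  also have "\<dots> = (1 + \<eta>) ^ N * ?S" by (simp add: prod.distrib)
  also have "\<dots> \<le> (1 + \<eta>) ^ N * ((1 + \<eta>) * ?C)" using S_le \<eta>(1) by (intro mult_left_mono) auto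
  also have "\<dots> = (1 + \<eta>) ^ Suc N * ?C" by simp
  also have "\<dots> \<le> 2 * ?C" using \<eta>(2) C0 by (intro mult_right_mono) auto
  finally show "(\<Prod>j<N. w (int j - 1 - int N)) \<le> 2 * ?C" .
qed

context singular_jacobi
begin

abbreviation q where "q n \<equiv> real_of_int (cf_q \<alpha> n)"
abbreviation zero_order where "zero_order s \<equiv> nat (zorder c (complex_of_real s))"

text \<open>
  The exponential of the sum over the zeros in the definition of \<open>\<delta>\<close>.
\<close>
definition zero_proximity :: "nat \<Rightarrow> real \<Rightarrow> real" where
  "zero_proximity n x = (\<Prod>s\<in>circle_zeros c. dist_int (q n * (x - s)) ^ zero_order s)"

lemma zero_proximity_nonneg: "0 \<le> zero_proximity n x"
  by (simp add: zero_proximity_def prod_nonneg)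

lemma zero_order_pos:
  assumes "s \<in> circle_zeros c"
  shows "zero_order s > 0"
proof -
  have "c (of_real s) = 0" using assms by (simp add: circle_zeros_def)
  from zorder_circle_zero[OF an nz this] have "zorder c (of_real s) > 0" by blast
  thus ?thesis by simp
qed

lemma zero_proximity_le_dist:
  assumes "s \<in> circle_zeros c"
  shows "zero_proximity n x \<le> dist_int (q n * (x - s))"
proof -
  let ?d = "\<lambda>s. dist_int (q n * (x - s))"
  have d1: "?d s \<le> 1" for s using dist_int_le_half[of "q n * (x - s)"] by simp
  obtain k where k: "zero_order s = Suc k" using zero_order_pos[OF assms] gr0_conv_Suc by blast
  have "zero_proximity n x = ?d s ^ zero_order s * (\<Prod>s\<in>circle_zeros c - {s}. ?d s ^ zero_order s)"
    unfolding zero_proximity_def using finite_circle_zeros[OF an nz] assms by (rule prod.remove)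
  also have "\<dots> \<le> ?d s ^ zero_order s * 1"
    using d1 by (intro mult_left_mono prod_le_1) (auto intro: power_le_one)
  also have "\<dots> = ?d s * ?d s ^ k" by (simp add: k)
  also have "\<dots> \<le> ?d s * 1" using d1 by (intro mult_left_mono power_le_one) auto
  finally show ?thesis by simp
qed

lemma norm_c_orbit_ge:
  assumes g: "\<And>x. g x \<ge> g0" "g0 > 0" "\<And>x. norm (c (of_real x)) = g x * zero_factor c x"
    and far: "2 * q n \<le> zero_proximity n x * q (Suc n)" and j: "\<bar>j\<bar> \<le> cf_q \<alpha> n"
  shows "g0 * zero_proximity n x / q n ^ (\<Sum>s\<in>circle_zeros c. zero_order s) \<le> norm (c (of_real (x + of_int j * \<alpha>)))"
proof -
  have qp: "q n > 0" "q (Suc n) > 0" using cf_q_pos[OF irr, of n] cf_q_pos[OF irr, of "Suc n"] by auto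
  have ch: "dist_int (q n * (x - s)) / q n \<le> chord (x + of_int j * \<alpha> - s)" if "s \<in> circle_zeros c" for s
  proof -
    have "2 * q n \<le> dist_int (q n * (x - s)) * q (Suc n)"
      using far mult_right_mono[OF zero_proximity_le_dist[OF that, of n x], of "q (Suc n)"] qp by linarith
    from dist_int_rotation_ge[OF irr j this]
    have "dist_int (q n * (x - s)) / q n \<le> 2 * dist_int (x - s + of_int j * \<alpha>)"
      using qp by (simp add: field_simps)
    also have "\<dots> \<le> chord (x - s + of_int j * \<alpha>)" by (rule chord_ge_dist_int)
    finally show ?thesis by (simp add: algebra_simps)
  qed
  have "zero_proximity n x / q n ^ (\<Sum>s\<in>circle_zeros c. zero_order s)
      = (\<Prod>s\<in>circle_zeros c. (dist_int (q n * (x - s)) / q n) ^ zero_order s)"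
    by (simp add: zero_proximity_def power_sum power_divide prod_dividef)
  also have "\<dots> \<le> zero_factor c (x + of_int j * \<alpha>)"
    unfolding zero_factor_def using qp by (intro prod_mono conjI power_mono ch) auto
  finally have "g0 * (zero_proximity n x / q n ^ (\<Sum>s\<in>circle_zeros c. zero_order s)) \<le> g (x + of_int j * \<alpha>) * zero_factor c (x + of_int j * \<alpha>)"
    using g(1)[of "x + of_int j * \<alpha>"] g(2) qp zero_proximity_nonneg[of n x] by (intro mult_mono) auto
  thus ?thesis by (simp only: g(3) times_divide_eq_right)
qed

lemma norm_c_prod_ge:
  assumes g: "\<And>x. g x > 0" "\<And>x. norm (c (of_real x)) = g x * zero_factor c x"
    and sum: "b \<le> (\<Sum>j<nat (cf_q \<alpha> n). ln (g (x + real j * \<alpha>)))"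
    and far: "8 * (q n)\<^sup>2 \<le> zero_proximity n x * q (Suc n)"
  shows "exp b * zero_proximity n x \<le> norm (c_prod \<alpha> c (nat (cf_q \<alpha> n)) x)"
proof -
  let ?N = "nat (cf_q \<alpha> n)"
  have qp: "q (Suc n) > 0" using cf_q_pos[OF irr, of "Suc n"] by auto
  have ch: "dist_int (q n * (x - s)) \<le> (\<Prod>j<?N. chord (x - s + real j * \<alpha>))" if "s \<in> circle_zeros c" for s
  proof (rule prod_chord_rotation_ge[OF irr])
    show "8 * (q n)\<^sup>2 \<le> dist_int (q n * (x - s)) * q (Suc n)"
      using far mult_right_mono[OF zero_proximity_le_dist[OF that, of n x], of "q (Suc n)"] qp by linarith
  qed
  have "exp b \<le> exp (\<Sum>j<?N. ln (g (x + real j * \<alpha>)))" using sum by simp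
  also have "\<dots> = (\<Prod>j<?N. g (x + real j * \<alpha>))" using g(1) by (simp add: exp_sum)
  finally have 1: "exp b \<le> (\<Prod>j<?N. g (x + real j * \<alpha>))" .
  have "zero_proximity n x \<le> (\<Prod>s\<in>circle_zeros c. (\<Prod>j<?N. chord (x - s + real j * \<alpha>)) ^ zero_order s)"
    unfolding zero_proximity_def by (intro prod_mono conjI power_mono ch) auto
  also have "\<dots> = (\<Prod>j<?N. zero_factor c (x + real j * \<alpha>))"
    unfolding zero_factor_def prod_power_distrib by (subst prod.swap) (simp add: algebra_simps)
  finally have "exp b * zero_proximity n x \<le> (\<Prod>j<?N. g (x + real j * \<alpha>)) * (\<Prod>j<?N. zero_factor c (x + real j * \<alpha>))"
    using 1 zero_proximity_nonneg[of n x] by (intro mult_mono) (auto intro: prod_nonneg less_imp_le g(1))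
  also have "\<dots> = norm (c_prod \<alpha> c ?N x)"
    unfolding c_prod_def prod_norm[symmetric] of_nat_id g(2) by (simp add: prod.distrib)
  finally show ?thesis .
qed

lemma norm_c_prod_eq:
  "norm (c_prod \<alpha> c N (\<theta> + of_int k * \<alpha>)) = (\<Prod>j<N. norm (c (of_real (\<theta> + of_int (int j + k) * \<alpha>))))"
  unfolding c_prod_def prod_norm[symmetric] by (intro prod.cong refl arg_cong[of _ _ norm] arg_cong[of _ _ c]) (simp add: algebra_simps)

lemma norm_det_eq:
  "norm (det (Mn N (\<theta> + of_int k * \<alpha>)))
     = (\<Prod>j<N. norm (c (of_real (\<theta> + of_int (int j - 1 + k) * \<alpha>)))) * norm (c_prod \<alpha> c N (\<theta> + of_int k * \<alpha>))"
  unfolding det_jacobi_iter norm_mult prod_norm[symmetric] complex_mod_cnj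
  by (intro arg_cong2[of _ _ _ _ "(*)"] refl prod.cong arg_cong[of _ _ norm] arg_cong[of _ _ c]) (simp add: algebra_simps)

text \<open>
  The hypothesis on \<open>n\<close> is the lower bound for a term of the limit superior in \<open>\<delta>\<close>. Of the room
  \<open>4\<epsilon>\<close> that it leaves, the growth estimate and the estimate of \<open>C\<^sub>q\<close> use one \<open>\<epsilon>\<close> each, and the remaining
  factor \<open>e\<^sup>-\<^sup>2\<^sup>\<epsilon>\<^sup>q\<close> absorbs all polynomial factors in \<open>q\<close>.
\<close>
lemma solution_bounded_below:
  assumes \<theta>: "\<theta> \<notin> Theta_set \<alpha> c" and eq: "H_op \<alpha> c v \<theta> u = (\<lambda>n. of_real E * u n)" and \<epsilon>: "\<epsilon> > 0"
  shows "\<forall>\<^sub>F n in sequentially.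
      exp ((lyapunov \<alpha> c v E + 4 * \<epsilon>) * q n) \<le> zero_proximity n \<theta> * q (Suc n) \<longrightarrow>
      norm (cauchy_vec u 0) \<le> 4 * (norm (cauchy_vec u (cf_q \<alpha> n)) + norm (cauchy_vec u (2 * cf_q \<alpha> n))
          + norm (cauchy_vec u (- cf_q \<alpha> n)))"
proof -
  obtain g where g: "continuous_on UNIV g" "\<And>x. g x > 0" "\<And>x. g (x + 1) = g x"
    "\<And>x. norm (c (of_real x)) = g x * zero_factor c x"
    using circle_factorization[OF an nz] by blast
  have lg_cont: "continuous_on UNIV (\<lambda>x. ln (g x))"
    using g(1,2) by (intro continuous_intros) (auto simp: less_imp_neq[symmetric])
  have lg_per: "ln (g (x + 1)) = ln (g x)" for x by (simp add: g(3))
  obtain B where B: "\<And>x. \<bar>ln (g x)\<bar> \<le> B" using periodic_continuous_bounded[OF lg_per lg_cont] by blast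
  define g0 where "g0 = exp (- B)"
  have g0: "g0 > 0" by (simp add: g0_def)
  have g0_le: "g0 \<le> g x" for x
  proof -
    have "exp (- B) \<le> exp (ln (g x))" using B[of x] by (subst exp_le_cancel_iff) linarith
    thus ?thesis using g(2)[of x] by (simp add: g0_def)
  qed
  obtain K where K: "K \<ge> 0" "\<And>x s k. opnorm (M (x + s) - M x) \<le> K * \<bar>s - of_int k\<bar>"
    "\<And>x s k. norm (c (of_real (x + s))) \<le> norm (c (of_real x)) + K * \<bar>s - of_int k\<bar>"
    using jacobi_mat_lipschitz by blast
  define L where "L = lyapunov \<alpha> c v E"
  define \<rho> where "\<rho> = L + mean_log_c + \<epsilon>"
  obtain D where D: "D > 0" "\<And>n x. growth n x \<le> D * exp (real n * \<rho>)"
    using uniform_growth[OF \<epsilon>] unfolding \<rho>_def L_def by blast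
  define m where "m = (\<Sum>s\<in>circle_zeros c. zero_order s)"
  have small: "\<forall>\<^sub>F n in sequentially. a * (q n ^ k * exp (- (b * q n))) < \<gamma>" if "b > 0" "\<gamma> > 0" for a b \<gamma> k
  proof -
    have "((\<lambda>x. a * (x ^ k * exp (- (b * x)))) \<longlongrightarrow> a * 0) at_top"
      by (intro tendsto_intros power_exp_tendsto_0 that)
    hence "\<forall>\<^sub>F x in at_top. a * (x ^ k * exp (- (b * x))) < \<gamma>" using that by (intro order_tendstoD) auto
    thus ?thesis by (rule eventually_compose_filterlim[OF _ cf_q_at_top[OF irr]])
  qed
  have "\<forall>\<^sub>F n in sequentially. \<forall>x. \<bar>(\<Sum>j<nat (cf_q \<alpha> n). ln (g (x + real j * \<alpha>)))
            - q n * (\<integral>y. ln (g y) \<partial>circle_measure)\<bar> \<le> q n * \<epsilon>"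
    by (rule rotation_sum_cf_q[OF irr lg_per lg_cont \<epsilon>])
  moreover have "\<forall>\<^sub>F n in sequentially. 8 * (q n ^ 2 * exp (- (4 * \<epsilon> * q n))) < 1"
    using \<epsilon> by (intro small) auto
  moreover have "\<forall>\<^sub>F n in sequentially. (2 * K / g0) * (q n ^ Suc m * exp (- (4 * \<epsilon> * q n))) < 1 / 2"
    using \<epsilon> by (intro small) auto
  moreover have "\<forall>\<^sub>F n in sequentially. (K * D\<^sup>2 * exp (- \<rho>)) * (q n ^ 1 * exp (- (2 * \<epsilon> * q n))) < 1 / 12"
    using \<epsilon> by (intro small) auto
  ultimately show ?thesis
  proof eventually_elim
    case (elim n)
    define N Q Q' p P where "N = nat (cf_q \<alpha> n)" and "Q = q n" and "Q' = q (Suc n)" and "p = cf_p \<alpha> n"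
      and "P = zero_proximity n \<theta>"
    have N1: "N \<ge> 1" and NQ: "Q = real N" and iN: "int N = cf_q \<alpha> n"
      using cf_q_pos[OF irr, of n] by (auto simp: N_def Q_def)
    have Q1: "Q \<ge> 1" and Q'1: "Q' > 0"
      using cf_q_pos[OF irr, of n] cf_q_pos[OF irr, of "Suc n"] by (auto simp: Q_def Q'_def)
    have apx: "\<bar>Q * \<alpha> - of_int p\<bar> \<le> 1 / Q'" using cf_approx[OF irr, of n] by (simp add: Q_def Q'_def p_def)
    have e2: "8 * (Q\<^sup>2 * exp (- (4 * \<epsilon> * Q))) < 1"
      and e3: "(2 * K / g0) * (Q ^ Suc m * exp (- (4 * \<epsilon> * Q))) < 1 / 2"
      and e4: "(K * D\<^sup>2 * exp (- \<rho>)) * (Q * exp (- (2 * \<epsilon> * Q))) < 1 / 12"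
      using elim by (simp_all add: Q_def)
    show ?case
    proof
      assume "exp ((lyapunov \<alpha> c v E + 4 * \<epsilon>) * q n) \<le> zero_proximity n \<theta> * q (Suc n)"
      hence hyp: "exp ((L + 4 * \<epsilon>) * Q) \<le> P * Q'" by (simp add: L_def Q_def P_def Q'_def)
      have "exp (4 * \<epsilon> * Q) \<le> exp ((L + 4 * \<epsilon>) * Q)"
        using lyapunov_nonneg Q1 by (simp add: L_def distrib_right)
      hence hyp0: "exp (4 * \<epsilon> * Q) \<le> P * Q'" using hyp by linarith
      have P0: "P > 0"
        using less_le_trans[OF exp_gt_zero hyp0] Q'1 zero_less_mult_pos2 by blast
      have "8 * Q\<^sup>2 \<le> exp (4 * \<epsilon> * Q)" using e2 by (simp add: exp_minus field_simps)
      hence far: "8 * Q\<^sup>2 \<le> P * Q'" using hyp0 by linarith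
      have "Q \<le> Q\<^sup>2" using Q1 by (simp add: power2_eq_square)
      hence far2: "2 * Q \<le> P * Q'" using far Q1 by linarith
      define w where "w = (\<lambda>j. norm (c (of_real (\<theta> + of_int j * \<alpha>))))"
      have w0: "w j > 0" for j using nonzero_off_Theta[OF \<theta>, of j] unfolding w_def zero_less_norm_iff .
      \<comment> \<open>A lower bound for \<open>|c|\<close> on the block, and the relative error \<open>\<eta>\<close> of a shift by \<open>\<plusminus>q\<alpha>\<close>.\<close>
      define \<kappa> where "\<kappa> = g0 * P / Q ^ m"
      have \<kappa>0: "\<kappa> > 0" using g0 P0 Q1 by (simp add: \<kappa>_def)
      have w\<kappa>: "\<kappa> \<le> w j" if "\<bar>j\<bar> \<le> int N" for j
        using norm_c_orbit_ge[of g0 g n \<theta> j, OF g0_le g0 g(4)] far2 that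
        by (simp add: \<kappa>_def w_def iN m_def P_def Q_def Q'_def del: of_real_add)
      define \<eta> where "\<eta> = K * (1 / Q') / \<kappa>"
      have \<eta>0: "\<eta> \<ge> 0" using K(1) Q'1 \<kappa>0 by (simp add: \<eta>_def)
      have \<eta>_le: "(Q + 1) * \<eta> \<le> 1 / 2"
      proof -
        have "1 / (P * Q') \<le> exp (- (4 * \<epsilon> * Q))"
          using hyp0 P0 Q'1 by (simp add: exp_minus field_simps)
        hence "(K / g0 * Q ^ m) * (1 / (P * Q')) \<le> (K / g0 * Q ^ m) * exp (- (4 * \<epsilon> * Q))"
          using K(1) g0 Q1 by (intro mult_left_mono) auto
        moreover have "\<eta> = (K / g0 * Q ^ m) * (1 / (P * Q'))"
          by (simp add: \<eta>_def \<kappa>_def)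
        ultimately have "\<eta> \<le> K / g0 * Q ^ m * exp (- (4 * \<epsilon> * Q))" by simp
        hence "(Q + 1) * \<eta> \<le> (2 * Q) * (K / g0 * Q ^ m * exp (- (4 * \<epsilon> * Q)))"
          using Q1 \<eta>0 by (intro mult_mono) auto
        also have "\<dots> = (2 * K / g0) * (Q ^ Suc m * exp (- (4 * \<epsilon> * Q)))" by simp
        finally show ?thesis using e3 by linarith
      qed
      have pow2: "(1 + \<eta>) ^ Suc N \<le> 2"
      proof -
        have "(1 + \<eta>) ^ Suc N \<le> exp \<eta> ^ Suc N"
          using exp_ge_add_one_self[of \<eta>] \<eta>0 by (intro power_mono) auto
        also have "\<dots> = exp ((Q + 1) * \<eta>)"
          unfolding exp_of_nat_mult[symmetric] by (simp add: NQ add.commute)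
        also have "\<dots> \<le> exp (1 / 2)" using \<eta>_le by simp
        also have "exp (1 / 2) \<le> (2::real)"
        proof (rule power2_le_imp_le)
          have "(exp (1 / 2 :: real))\<^sup>2 = exp 1" by (simp add: exp_double[symmetric])
          thus "(exp (1 / 2 :: real))\<^sup>2 \<le> 2\<^sup>2" using exp_le by simp
        qed simp
        finally show ?thesis .
      qed
      have near: "\<exists>k::int. \<bar>of_int i * \<alpha> - of_int k\<bar> \<le> 1 / Q'" if "i = int N \<or> i = - int N" for i
        using that
      proof
        assume "i = int N"
        thus ?thesis using apx by (intro exI[of _ p]) (simp add: NQ)
      next
        assume "i = - int N"
        thus ?thesis using apx by (intro exI[of _ "- p"]) (simp add: NQ abs_minus_commute)
      qed
      have shift: "w (j + i) \<le> (1 + \<eta>) * w j" if "\<bar>j\<bar> \<le> int N" "i = int N \<or> i = - int N" for i j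
      proof -
        obtain k :: int where k: "\<bar>of_int i * \<alpha> - of_int k\<bar> \<le> 1 / Q'" using near[OF \<open>i = int N \<or> i = - int N\<close>] by blast
        have "w (j + i) = norm (c (of_real (\<theta> + of_int j * \<alpha> + of_int i * \<alpha>)))"
          unfolding w_def by (simp add: distrib_right add.assoc)
        also have "\<dots> \<le> w j + K * \<bar>of_int i * \<alpha> - of_int k\<bar>" unfolding w_def by (rule K(3))
        also have "\<dots> \<le> w j + K * (1 / Q')" using k K(1) by (intro add_left_mono mult_left_mono) auto
        also have "K * (1 / Q') = \<eta> * \<kappa>" using \<kappa>0 by (simp add: \<eta>_def)
        also have "\<eta> * \<kappa> \<le> \<eta> * w j" using w\<kappa>[OF that(1)] \<eta>0 by (rule mult_left_mono)
        finally show ?thesis by (simp add: distrib_right)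
      qed
      have sf: "w (j + int N) \<le> (1 + \<eta>) * w j" "w (j - int N) \<le> (1 + \<eta>) * w j"
        if "-1 \<le> j" "j < int N" for j
        using shift[of j "int N"] shift[of j "- int N"] that N1 by auto
      note prods = quasiperiodic_products[of N w \<eta>, OF N1 w0 \<eta>0 pow2 sf]
      define C C' C'' where "C = c_prod \<alpha> c N \<theta>" and "C' = c_prod \<alpha> c N (\<theta> + of_int (int N) * \<alpha>)"
        and "C'' = c_prod \<alpha> c N (\<theta> + of_int (- int N) * \<alpha>)"
      have nC: "norm C = (\<Prod>j<N. w (int j))" "norm C' = (\<Prod>j<N. w (int j + int N))"
        using norm_c_prod_eq[of N \<theta> 0] norm_c_prod_eq[of N \<theta> "int N"]
        by (simp_all add: C_def C'_def w_def)
      have C0: "norm C > 0" using w0 unfolding nC by (intro prod_pos) auto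
      have "norm C'' = (\<Prod>j<N. w (int j + - int N))"
        unfolding C''_def w_def by (rule norm_c_prod_eq)
      hence C''0: "norm C'' > 0" using w0 by (simp add: prod_pos del: of_int_minus)
      \<comment> \<open>The size of \<open>C\<^sub>q\<close> against the change of \<open>B\<^sub>q\<close> between blocks.\<close>
      have Cge: "exp (Q * (mean_log_c - \<epsilon>)) * P \<le> norm C"
        unfolding C_def P_def N_def
      proof (rule norm_c_prod_ge[of g, OF g(2,4)])
        have "\<bar>(\<Sum>j<nat (cf_q \<alpha> n). ln (g (\<theta> + real j * \<alpha>))) - Q * mean_log_c\<bar> \<le> Q * \<epsilon>"
          using elim(1) unfolding mean_log_c_eq[OF g(1,2,4)] Q_def by blast
        thus "Q * (mean_log_c - \<epsilon>) \<le> (\<Sum>j<nat (cf_q \<alpha> n). ln (g (\<theta> + real j * \<alpha>)))"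
          unfolding right_diff_distrib by linarith
      qed (use far in \<open>simp add: P_def Q_def Q'_def\<close>)
      have diff: "opnorm (Mn N (\<theta> + of_int i * \<alpha>) - Mn N \<theta>) \<le> norm C / 12" if i: "i = int N \<or> i = - int N" for i
      proof -
        obtain k :: int where k: "\<bar>of_int i * \<alpha> - of_int k\<bar> \<le> 1 / Q'" using near[OF i] by blast
        have \<tau>: "opnorm (M (x + of_int i * \<alpha>) - M x) \<le> K * (1 / Q')" for x
        proof -
          have "opnorm (M (x + of_int i * \<alpha>) - M x) \<le> K * \<bar>of_int i * \<alpha> - of_int k\<bar>" by (rule K(2))
          also have "\<dots> \<le> K * (1 / Q')" using k K(1) by (intro mult_left_mono) auto
          finally show ?thesis .
        qed
        have "opnorm (Mn N (\<theta> + of_int i * \<alpha>) - Mn N \<theta>) \<le> real N * (K * (1 / Q')) * D\<^sup>2 * exp ((real N - 1) * \<rho>)"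
          by (rule jacobi_iter_diff_le[OF D \<tau>])
        also have "\<dots> = (Q * K * D\<^sup>2 * exp ((Q - 1) * \<rho>)) * (1 / Q')" by (simp add: NQ)
        also have "\<dots> \<le> (Q * K * D\<^sup>2 * exp ((Q - 1) * \<rho>)) * (P * exp (- ((L + 4 * \<epsilon>) * Q)))"
        proof (rule mult_left_mono)
          show "1 / Q' \<le> P * exp (- ((L + 4 * \<epsilon>) * Q))"
          proof -
            have "1 / Q' \<le> P * exp (- a)" if "exp a \<le> P * Q'" for a
              using that Q'1 by (simp add: exp_minus field_simps)
            from this[OF hyp] show ?thesis .
          qed
          show "0 \<le> Q * K * D\<^sup>2 * exp ((Q - 1) * \<rho>)" using Q1 K(1) by simp
        qed
        also have "\<dots> = (Q * K * D\<^sup>2) * P * exp ((Q - 1) * \<rho> + (- ((L + 4 * \<epsilon>) * Q)))"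
          unfolding exp_add by (simp add: mult_ac)
        also have "(Q - 1) * \<rho> + (- ((L + 4 * \<epsilon>) * Q)) = - \<rho> + (- (2 * \<epsilon> * Q)) + Q * (mean_log_c - \<epsilon>)"
          by (simp add: \<rho>_def algebra_simps)
        also have "(Q * K * D\<^sup>2) * P * exp (- \<rho> + (- (2 * \<epsilon> * Q)) + Q * (mean_log_c - \<epsilon>))
            = (K * D\<^sup>2 * exp (- \<rho>)) * (Q * exp (- (2 * \<epsilon> * Q))) * (exp (Q * (mean_log_c - \<epsilon>)) * P)"
          unfolding exp_add by (simp add: mult_ac)
        also have "\<dots> \<le> (1 / 12) * norm C"
          using e4 Cge P0 by (intro mult_mono) auto
        finally show ?thesis by simp
      qed
      have "norm (cauchy_vec u 0) \<le> 4 * (norm (cauchy_vec u (int N)) + norm (cauchy_vec u (int N + int N)) + norm (cauchy_vec u (- int N)))"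
      proof (rule three_block_bound[of C _ "Mn N \<theta>" _ C' _ "Mn N (\<theta> + of_int (int N) * \<alpha>)" C'' "Mn N (\<theta> + of_int (- int N) * \<alpha>)"])
        show "C *s cauchy_vec u (int N) = Mn N \<theta> *v cauchy_vec u 0"
          using cauchy_vec_steps[OF eq, of N 0] by (simp add: C_def)
        show "C' *s cauchy_vec u (int N + int N) = Mn N (\<theta> + of_int (int N) * \<alpha>) *v cauchy_vec u (int N)"
          using cauchy_vec_steps[OF eq, of N "int N"] by (simp only: C'_def)
        show "C'' *s cauchy_vec u 0 = Mn N (\<theta> + of_int (- int N) * \<alpha>) *v cauchy_vec u (- int N)"
          using cauchy_vec_steps[OF eq, of N "- int N"] by (simp only: C''_def add.left_inverse)
        show "C \<noteq> 0" "C'' \<noteq> 0" using C0 C''0 by auto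
        show "opnorm (Mn N (\<theta> + of_int (int N) * \<alpha>) - Mn N \<theta>) \<le> norm C / 12"
          "opnorm (Mn N (\<theta> + of_int (- int N) * \<alpha>) - Mn N \<theta>) \<le> norm C / 12"
          by (rule diff; simp)+
        have "norm (det (Mn N \<theta>)) = (\<Prod>j<N. w (int j - 1)) * norm C"
          using norm_det_eq[of N \<theta> 0] by (simp add: w_def C_def)
        moreover have "norm C / 2 * norm C \<le> (\<Prod>j<N. w (int j - 1)) * norm C"
          by (rule mult_right_mono[OF prods(1)[folded nC(1)] norm_ge_zero])
        ultimately show "(norm C)\<^sup>2 / 2 \<le> norm (det (Mn N \<theta>))" by (simp add: power2_eq_square)
        show "norm C' \<le> 2 * norm C" using prods(2) by (simp add: nC)
        have "norm (det (Mn N (\<theta> + of_int (- int N) * \<alpha>))) = (\<Prod>j<N. w (int j - 1 - int N)) * norm C''"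
          using norm_det_eq[of N \<theta> "- int N"] by (simp add: w_def C''_def)
        also have "\<dots> \<le> (2 * norm C) * norm C''"
          using prods(3) by (intro mult_right_mono) (auto simp: nC)
        finally show "norm (det (Mn N (\<theta> + of_int (- int N) * \<alpha>))) \<le> 2 * norm C'' * norm C" by (simp add: mult_ac)
      qed
      thus "norm (cauchy_vec u 0) \<le> 4 * (norm (cauchy_vec u (cf_q \<alpha> n)) + norm (cauchy_vec u (2 * cf_q \<alpha> n))
          + norm (cauchy_vec u (- cf_q \<alpha> n)))"
        unfolding iN mult_2 .
    qed
  qed
qed

lemma cauchy_vec_tendsto_0:
  assumes "u \<in> ell2" "filterlim k at_top sequentially" "s = 1 \<or> s = - 1"
  shows "(\<lambda>n. norm (cauchy_vec u (s * int (k n)))) \<longlonglongrightarrow> 0"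
proof -
  have "(\<lambda>j. u (s * int j)) \<longlonglongrightarrow> 0" "(\<lambda>j. u (s * int j - 1)) \<longlonglongrightarrow> 0"
    using assms(3) by (auto intro!: ell2_tendsto_0[OF assms(1)] injI)
  hence "(\<lambda>j. norm (u (s * int j)) + norm (u (s * int j - 1))) \<longlonglongrightarrow> 0 + 0"
    by (intro tendsto_add tendsto_norm_zero)
  hence lim: "(\<lambda>j. norm (u (s * int j)) + norm (u (s * int j - 1))) \<longlonglongrightarrow> 0" by simp
  have "norm (norm (cauchy_vec u (s * int j))) \<le> norm (u (s * int j)) + norm (u (s * int j - 1))" for j
    using norm_vec2_le[of "cauchy_vec u (s * int j)"] by simp
  hence "(\<lambda>j. norm (cauchy_vec u (s * int j))) \<longlonglongrightarrow> 0"
    by (intro Lim_null_comparison[OF _ lim] always_eventually allI)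
  thus ?thesis by (rule filterlim_compose[OF _ assms(2)])
qed

text \<open>
  A finite lower bound for the term excludes \<open>\<parallel>q\<^sub>n(\<theta> - t)\<parallel> = 0\<close>: all summands are nonpositive, so a single
  \<open>-\<infinity>\<close> would make the sum equal to \<open>-\<infinity>\<close>.
\<close>
lemma delta_term_bound:
  assumes "ereal r < ((\<Sum>t\<in>circle_zeros c. ereal (of_int (zorder c (of_real t))) * eln (dist_int (of_int (cf_q \<alpha> n) * (\<theta> - t))))
      + ereal (ln (of_int (cf_q \<alpha> (Suc n))))) / ereal (of_int (cf_q \<alpha> n))"
  shows "exp (r * q n) \<le> zero_proximity n \<theta> * q (Suc n)"
proof -
  let ?d = "\<lambda>t. dist_int (of_int (cf_q \<alpha> n) * (\<theta> - t))"
  let ?e = "\<lambda>t. ereal (of_int (zorder c (of_real t))) * eln (?d t)"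
  have qp: "q n > 0" "q (Suc n) > 0" using cf_q_pos[OF irr, of n] cf_q_pos[OF irr, of "Suc n"] by auto
  note fin = finite_circle_zeros[OF an nz]
  have zp: "zorder c (of_real t) > 0" if "t \<in> circle_zeros c" for t
    using zero_order_pos[OF that] by simp
  have e0: "?e t \<le> 0" if "t \<in> circle_zeros c" for t
  proof (cases "?d t = 0")
    case True thus ?thesis using zp[OF that] by (simp add: eln_def)
  next
    case False
    hence "ln (?d t) \<le> 0" using dist_int_le_half[of "of_int (cf_q \<alpha> n) * (\<theta> - t)"] dist_int_nonneg[of "of_int (cf_q \<alpha> n) * (\<theta> - t)"]
      by (subst ln_le_zero_iff) linarith+
    thus ?thesis using False zp[OF that] by (simp add: eln_def mult_nonneg_nonpos)
  qed
  have d0: "?d t \<noteq> 0" if t: "t \<in> circle_zeros c" for t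
  proof
    assume "?d t = 0"
    hence inf: "?e t = - \<infinity>" using zp[OF t] by (simp add: eln_def)
    have "(\<Sum>t\<in>circle_zeros c. ?e t) = ?e t + (\<Sum>t\<in>circle_zeros c - {t}. ?e t)"
      using fin t by (rule sum.remove)
    also have "\<dots> \<le> ?e t + 0" using e0 by (intro add_left_mono sum_nonpos) auto
    finally have "(\<Sum>t\<in>circle_zeros c. ?e t) = - \<infinity>" unfolding inf by simp
    with assms qp show False by simp
  qed
  have "?e t = ereal (real (zero_order t) * ln (?d t))" if "t \<in> circle_zeros c" for t
    using d0[OF that] zp[OF that] by (simp add: eln_def)
  hence "(\<Sum>t\<in>circle_zeros c. ?e t) = (\<Sum>t\<in>circle_zeros c. ereal (real (zero_order t) * ln (?d t)))"
    by (intro sum.cong refl)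
  also have "\<dots> = ereal (\<Sum>t\<in>circle_zeros c. real (zero_order t) * ln (?d t))" by simp
  finally have "ereal r < ereal (((\<Sum>t\<in>circle_zeros c. real (zero_order t) * ln (?d t)) + ln (q (Suc n))) / q n)"
    using assms qp by simp
  hence "r * q n \<le> (\<Sum>t\<in>circle_zeros c. real (zero_order t) * ln (?d t)) + ln (q (Suc n))"
    using qp by (simp add: field_simps)
  hence "exp (r * q n) \<le> exp ((\<Sum>t\<in>circle_zeros c. real (zero_order t) * ln (?d t)) + ln (q (Suc n)))" by simp
  also have "\<dots> = (\<Prod>t\<in>circle_zeros c. exp (real (zero_order t) * ln (?d t))) * q (Suc n)"
    using fin qp by (simp add: exp_add exp_sum)
  also have "(\<Prod>t\<in>circle_zeros c. exp (real (zero_order t) * ln (?d t))) = zero_proximity n \<theta>"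
    unfolding zero_proximity_def
  proof (intro prod.cong refl)
    fix t assume t: "t \<in> circle_zeros c"
    have "?d t > 0" using d0[OF t] dist_int_nonneg[of "of_int (cf_q \<alpha> n) * (\<theta> - t)"] by linarith
    thus "exp (real (zero_order t) * ln (?d t)) = ?d t ^ zero_order t" by (simp add: exp_of_nat_mult)
  qed
  finally show ?thesis .
qed

lemma no_eigenvalue_below_delta:
  assumes \<theta>: "\<theta> \<notin> Theta_set \<alpha> c" and less: "ereal (lyapunov \<alpha> c v E) < delta \<alpha> c \<theta>"
  shows "\<not> is_eigenvalue (H_op \<alpha> c v \<theta>) E"
proof
  assume "is_eigenvalue (H_op \<alpha> c v \<theta>) E"
  then obtain u where u: "u \<in> ell2" "u \<noteq> (\<lambda>n. 0)" "H_op \<alpha> c v \<theta> u = (\<lambda>n. of_real E * u n)"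
    unfolding is_eigenvalue_def by blast
  obtain r where r: "lyapunov \<alpha> c v E < r" "ereal r < delta \<alpha> c \<theta>"
    using ereal_dense2[OF less] by auto
  define \<epsilon> where "\<epsilon> = (r - lyapunov \<alpha> c v E) / 4"
  have \<epsilon>: "\<epsilon> > 0" "lyapunov \<alpha> c v E + 4 * \<epsilon> = r" using r(1) by (simp_all add: \<epsilon>_def diff_divide_distrib)
  let ?X = "cauchy_vec u"
  let ?F = "\<lambda>n. 4 * (norm (?X (cf_q \<alpha> n)) + norm (?X (2 * cf_q \<alpha> n)) + norm (?X (- cf_q \<alpha> n)))"
  have "\<exists>\<^sub>F n in sequentially. exp (r * q n) \<le> zero_proximity n \<theta> * q (Suc n)"
  proof (rule ccontr)
    assume "\<not> ?thesis"
    hence "\<forall>\<^sub>F n in sequentially. \<not> exp (r * q n) \<le> zero_proximity n \<theta> * q (Suc n)"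
      by (simp add: not_frequently)
    hence "delta \<alpha> c \<theta> \<le> ereal r"
      unfolding delta_def
      by (intro Limsup_bounded, elim eventually_mono) (rule ccontr, use delta_term_bound in \<open>simp add: not_le\<close>)
    thus False using r(2) by simp
  qed
  hence freq: "\<exists>\<^sub>F n in sequentially. norm (?X 0) \<le> ?F n"
    by (rule frequently_rev_mp)
       (use solution_bounded_below[OF \<theta> u(3) \<epsilon>(1)] in \<open>auto simp: \<epsilon>(2) elim!: eventually_mono\<close>)
  have k1: "filterlim (\<lambda>n. nat (cf_q \<alpha> n)) at_top sequentially"
    by (rule filterlim_at_top_mono[OF filterlim_ident])
       (intro always_eventually allI, metis cf_q_ge[OF irr] nat_int nat_mono)
  have k2: "filterlim (\<lambda>n. 2 * nat (cf_q \<alpha> n)) at_top sequentially"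
    by (rule filterlim_at_top_mono[OF k1]) auto
  have i: "int (nat (cf_q \<alpha> n)) = cf_q \<alpha> n" for n using cf_q_pos[OF irr, of n] by simp
  have "?F \<longlonglongrightarrow> 4 * (0 + 0 + 0)"
    using cauchy_vec_tendsto_0[OF u(1) k1, of 1] cauchy_vec_tendsto_0[OF u(1) k2, of 1]
      cauchy_vec_tendsto_0[OF u(1) k1, of "-1"] by (intro tendsto_intros) (simp_all add: i del: int_nat_eq)
  moreover have "norm (?X 0) > 0" using cauchy_vec_nonzero[OF u(3) \<theta> u(2)] by simp
  ultimately have "\<forall>\<^sub>F n in sequentially. ?F n < norm (?X 0)" by (intro order_tendstoD) auto
  hence "\<forall>\<^sub>F n in sequentially. \<not> norm (?X 0) \<le> ?F n" by eventually_elim simp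
  with freq show False by (simp add: frequently_def)
qed

end

section \<open>Almost every phase\<close>

lemma AE_lborel_periodic:
  assumes ae: "AE x in circle_measure. P x" and per: "\<And>x::real. P (x + 1) = P x"
  shows "AE x in lborel. P x"
proof -
  have "AE x in lborel. x \<in> {0..<1} \<longrightarrow> P x"
    using ae by (subst (asm) AE_restrict_space_iff) auto
  then obtain N where N: "N \<in> null_sets lborel" "{x \<in> space lborel. \<not> (x \<in> {0..<1} \<longrightarrow> P x)} \<subseteq> N"
    unfolding eventually_ae_filter by blast
  have "AE x in lborel. \<forall>k::int. x - of_int k \<notin> N"
  proof (subst AE_all_countable, rule allI)
    fix k :: int
    have "{x. x - of_int k \<in> N} \<in> null_sets lborel" by (rule null_sets_translation[OF N(1)])
    from AE_not_in[OF this] show "AE x in lborel. x - of_int k \<notin> N" by simp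
  qed
  thus ?thesis
  proof eventually_elim
    case (elim x)
    have "frac x \<notin> N" using elim by (simp add: frac_def)
    moreover have "frac x \<in> N" if "\<not> P (frac x)"
      by (rule subsetD[OF N(2)]) (use that frac_lt_1[of x] in simp)
    ultimately have "P (frac x)" by blast
    thus ?case using periodic_frac[of P x, OF per] by simp
  qed
qed

text \<open>
  By invariance under \<open>x \<mapsto> q\<^sub>n x\<close>, the integral of the absolute value of the \<open>n\<close>-th term is
  \<open>1/q\<^sub>n\<close> times a constant. These integrals are summable, so the terms are summable almost everywhere.
\<close>
lemma AE_ln_chord_cf_q_small:
  assumes irr: "\<alpha> \<notin> \<rat>"
  shows "AE x in lborel. (\<lambda>n. ln (chord (of_int (cf_q \<alpha> n) * (x - s))) / of_int (cf_q \<alpha> n)) \<longlonglongrightarrow> 0"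
proof (rule AE_lborel_periodic)
  define q where "q = (\<lambda>n. nat (cf_q \<alpha> n))"
  have q: "q n \<ge> 1" "of_int (cf_q \<alpha> n) = real (q n)" for n
    using cf_q_pos[OF irr, of n] by (auto simp: q_def)
  have chper: "chord (real (q n) * (x + 1 - s)) = chord (real (q n) * (x - s))" for n x
    using periodic_int_shift[of chord "real (q n) * (x - s)" "int (q n)", OF chord_periodic]
    by (simp add: algebra_simps)
  show "((\<lambda>n. ln (chord (of_int (cf_q \<alpha> n) * (x + 1 - s))) / of_int (cf_q \<alpha> n)) \<longlonglongrightarrow> 0)
      = ((\<lambda>n. ln (chord (of_int (cf_q \<alpha> n) * (x - s))) / of_int (cf_q \<alpha> n)) \<longlonglongrightarrow> 0)" for x
    unfolding q chper ..
  let ?J = "\<integral>x. \<bar>ln (chord x)\<bar> \<partial>circle_measure"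
  let ?a = "\<lambda>n x. \<bar>ln (chord (real (q n) * x + (- (real (q n) * s))))\<bar> / real (q n)"
  have int: "integrable circle_measure (\<lambda>x. \<bar>ln (chord x)\<bar>)"
    by (intro integrable_abs ln_chord_integrable)
  have one: "(\<integral>\<^sup>+x. ennreal (?a n x) \<partial>circle_measure) = ennreal (?J / real (q n))" for n
  proof -
    have "(\<integral>\<^sup>+x. ennreal (?a n x) \<partial>circle_measure)
        = (\<integral>\<^sup>+x. ennreal (\<bar>ln (chord x)\<bar> / real (q n)) \<partial>circle_measure)"
      by (rule nn_integral_circle_affine[of "\<lambda>y. ennreal (\<bar>ln (chord y)\<bar> / real (q n))", OF _ _ q(1)])
         (auto simp: chord_periodic)
    also have "\<dots> = ennreal (\<integral>x. \<bar>ln (chord x)\<bar> / real (q n) \<partial>circle_measure)"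
      using int by (intro nn_integral_eq_integral) auto
    finally show ?thesis by simp
  qed
  have meas: "(\<lambda>x. ennreal (?a n x)) \<in> borel_measurable circle_measure" for n
    by (rule measurable_restrict_space1) measurable
  have "(\<integral>\<^sup>+x. (\<Sum>n. ennreal (?a n x)) \<partial>circle_measure) = (\<Sum>n. ennreal (?J / real (q n)))"
    by (subst nn_integral_suminf[OF meas]) (simp only: one)
  also have "\<dots> \<noteq> top"
  proof (rule ennreal_suminf_neq_top)
    have "summable (\<lambda>n. ?J * (1 / real (q n)))"
      using summable_inverse_cf_q[OF irr] unfolding q by (rule summable_mult)
    thus "summable (\<lambda>n. ?J / real (q n))" by simp
    show "0 \<le> ?J / real (q n)" for n by (simp add: integral_nonneg_AE)
  qed
  finally have fin: "(\<integral>\<^sup>+x. (\<Sum>n. ennreal (?a n x)) \<partial>circle_measure) \<noteq> \<infinity>" by simp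
  have "AE x in circle_measure. (\<Sum>n. ennreal (?a n x)) \<noteq> \<infinity>"
    by (rule nn_integral_PInf_AE[OF _ fin]) (intro borel_measurable_suminf_order meas)
  thus "AE x in circle_measure. (\<lambda>n. ln (chord (of_int (cf_q \<alpha> n) * (x - s))) / of_int (cf_q \<alpha> n)) \<longlonglongrightarrow> 0"
  proof eventually_elim
    case (elim x)
    have "summable (\<lambda>n. ?a n x)" using elim by (intro summable_suminf_not_top) auto
    hence "(\<lambda>n. ?a n x) \<longlonglongrightarrow> 0" by (rule summable_LIMSEQ_zero)
    moreover have "?a n x = \<bar>ln (chord (of_int (cf_q \<alpha> n) * (x - s))) / of_int (cf_q \<alpha> n)\<bar>" for n
      by (simp add: q abs_divide right_diff_distrib)
    ultimately show ?case by (simp only: tendsto_rabs_zero_iff)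
  qed
qed

context singular_jacobi
begin

text \<open>
  As \<open>\<parallel>y\<parallel> \<ge> |2 sin \<pi>y|/2\<pi>\<close>, the first hypothesis bounds the sum over the zeros from below by a null sequence.
  The second one is separate because the real logarithm has the value \<open>0\<close> at \<open>0\<close>, where the first
  hypothesis therefore says nothing.
\<close>
lemma beta_le_delta:
  assumes lim: "\<And>s. s \<in> circle_zeros c \<Longrightarrow> (\<lambda>n. ln (chord (q n * (\<theta> - s))) / q n) \<longlonglongrightarrow> 0"
    and nonint: "\<And>s n. s \<in> circle_zeros c \<Longrightarrow> q n * (\<theta> - s) \<notin> \<int>"
  shows "beta \<alpha> \<le> delta \<alpha> c \<theta>"
proof -
  have qp: "q n > 0" for n using cf_q_pos[OF irr, of n] by simp
  define a where "a = (\<lambda>n. \<Sum>s\<in>circle_zeros c. real (zero_order s) * (ln (chord (q n * (\<theta> - s))) / q n - ln (2 * pi) * (1 / q n)))"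
  define b where "b = (\<lambda>n. ln (q (Suc n)) / q n)"
  have "(\<lambda>n. 1 / q n) \<longlonglongrightarrow> 0"
    by (rule summable_LIMSEQ_zero[OF summable_inverse_cf_q[OF irr]])
  hence "a \<longlonglongrightarrow> (\<Sum>s\<in>circle_zeros c. real (zero_order s) * (0 - ln (2 * pi) * 0))"
    unfolding a_def by (intro tendsto_intros lim)
  hence a0: "(\<lambda>n. ereal (a n)) \<longlonglongrightarrow> ereal 0" by simp
  have "beta \<alpha> = limsup (\<lambda>n. ereal (a n) + ereal (b n))"
    using ereal_limsup_lim_add[OF a0, of "\<lambda>n. ereal (b n)"] by (simp add: beta_def b_def)
  also have "\<dots> \<le> delta \<alpha> c \<theta>"
    unfolding delta_def
  proof (intro Limsup_mono always_eventually allI)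
    fix n
    let ?d = "\<lambda>s. dist_int (q n * (\<theta> - s))"
    have d: "ln (chord (q n * (\<theta> - s))) - ln (2 * pi) \<le> ln (?d s)" "?d s \<noteq> 0" if "s \<in> circle_zeros c" for s
    proof -
      have "0 < chord (q n * (\<theta> - s))"
        using chord_eq_0_iff[of "q n * (\<theta> - s)"] nonint[OF that, of n] by (simp add: order_less_le)
      moreover have le: "chord (q n * (\<theta> - s)) \<le> 2 * pi * ?d s" by (rule chord_le_dist_int)
      ultimately have p: "0 < 2 * pi * ?d s" by linarith
      hence dp: "0 < ?d s" by (simp add: zero_less_mult_iff)
      thus "?d s \<noteq> 0" by simp
      have "ln (chord (q n * (\<theta> - s))) \<le> ln (2 * pi * ?d s)"
        using le p \<open>0 < chord (q n * (\<theta> - s))\<close> by (subst ln_le_cancel_iff) auto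
      also have "\<dots> = ln (2 * pi) + ln (?d s)" using dp by (simp add: ln_mult)
      finally show "ln (chord (q n * (\<theta> - s))) - ln (2 * pi) \<le> ln (?d s)" by simp
    qed
    have "a n * q n = (\<Sum>s\<in>circle_zeros c. real (zero_order s) * (ln (chord (q n * (\<theta> - s))) - ln (2 * pi)))"
      unfolding a_def sum_distrib_right using qp[of n] by (intro sum.cong refl) (simp add: field_simps)
    also have "\<dots> \<le> (\<Sum>s\<in>circle_zeros c. real (zero_order s) * ln (?d s))"
      by (intro sum_mono mult_left_mono d) auto
    finally have le: "a n * q n + ln (q (Suc n)) \<le> (\<Sum>s\<in>circle_zeros c. real (zero_order s) * ln (?d s)) + ln (q (Suc n))"
      by simp
    have "(\<Sum>s\<in>circle_zeros c. ereal (of_int (zorder c (of_real s))) * eln (?d s))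
        = (\<Sum>s\<in>circle_zeros c. ereal (real (zero_order s) * ln (?d s)))"
      using d(2) zero_order_pos by (intro sum.cong refl) (force simp: eln_def)
    also have "\<dots> = ereal (\<Sum>s\<in>circle_zeros c. real (zero_order s) * ln (?d s))" by simp
    finally have S: "(\<Sum>s\<in>circle_zeros c. ereal (of_int (zorder c (of_real s))) * eln (?d s))
        = ereal (\<Sum>s\<in>circle_zeros c. real (zero_order s) * ln (?d s))" .
    have "a n + b n = (a n * q n + ln (q (Suc n))) / q n"
      using qp[of n] by (simp add: b_def field_simps)
    also have "\<dots> \<le> ((\<Sum>s\<in>circle_zeros c. real (zero_order s) * ln (?d s)) + ln (q (Suc n))) / q n"
      using le qp[of n] by (intro divide_right_mono) auto
    finally have "ereal (a n + b n) \<le> ereal (((\<Sum>s\<in>circle_zeros c. real (zero_order s) * ln (?d s)) + ln (q (Suc n))) / q n)"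
      by simp
    thus "ereal (a n) + ereal (b n)
        \<le> ((\<Sum>t\<in>circle_zeros c. ereal (of_int (zorder c (of_real t))) * eln (?d t)) + ereal (ln (q (Suc n)))) / ereal (q n)"
      unfolding S using qp[of n] by simp
  qed
  finally show ?thesis .
qed

lemma AE_beta_le_delta: "AE \<theta> in lborel. \<theta> \<notin> Theta_set \<alpha> c \<and> beta \<alpha> \<le> delta \<alpha> c \<theta>"
proof -
  note fin = finite_circle_zeros[OF an nz]
  let ?R = "(\<lambda>(s, r). s + r) ` (circle_zeros c \<times> \<rat>)"
  have "countable ?R"
    by (intro countable_image countable_SIGMA countable_finite[OF fin] countable_rat)
  hence "AE \<theta> in lborel. \<theta> \<notin> ?R" by (intro AE_not_in countable_imp_null_set_lborel)
  moreover have "AE \<theta> in lborel. \<theta> \<notin> Theta_set \<alpha> c"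
    by (intro AE_not_in countable_imp_null_set_lborel countable_Theta)
  moreover have "AE \<theta> in lborel. \<forall>s\<in>circle_zeros c. (\<lambda>n. ln (chord (q n * (\<theta> - s))) / q n) \<longlonglongrightarrow> 0"
    by (subst AE_ball_countable[OF countable_finite[OF fin]]) (use AE_ln_chord_cf_q_small[OF irr] in blast)
  ultimately show ?thesis
  proof eventually_elim
    case (elim \<theta>)
    have "beta \<alpha> \<le> delta \<alpha> c \<theta>"
    proof (rule beta_le_delta)
      fix s n assume s: "s \<in> circle_zeros c"
      show "q n * (\<theta> - s) \<notin> \<int>"
      proof
        assume "q n * (\<theta> - s) \<in> \<int>"
        then obtain k where "q n * (\<theta> - s) = of_int k" by (auto elim: Ints_cases)
        hence "\<theta> = s + of_int k / q n" using cf_q_pos[OF irr, of n] by (simp add: field_simps)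
        hence "\<theta> \<in> ?R" using s by (intro image_eqI[of _ _ "(s, of_int k / q n)"]) auto
        thus False using elim by blast
      qed
    qed (use elim in blast)
    thus ?case using elim by blast
  qed
qed

end

theorem theorem1p3:
  fixes \<alpha> :: real
    and c :: "complex \<Rightarrow> complex"
    and chat :: "int \<Rightarrow> real"
    and v :: "real \<Rightarrow> real"
  assumes irrational: "\<alpha> \<notin> \<rat>"
    and c_analytic: "analytic_on_circle c"
    and c_nonzero: "\<exists>x::real. c (of_real x) \<noteq> 0"
    and c_fourier: "\<And>x::real.
          ((\<lambda>k. of_real (chat k) * exp (2 * of_real pi * \<i> * of_int k * of_real (x + \<alpha> / 2)))
             has_sum c (of_real x)) UNIV"
    and v_periodic: "\<And>x. v (x + 1) = v x"
    and v_lipschitz: "\<exists>K. K-lipschitz_on UNIV v"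
  shows "(\<forall>\<theta>. \<theta> \<notin> Theta_set \<alpha> c \<longrightarrow>
            (\<forall>E. ereal (lyapunov \<alpha> c v E) < delta \<alpha> c \<theta> \<longrightarrow> \<not> is_eigenvalue (H_op \<alpha> c v \<theta>) E))
       \<and> (AE \<theta> in lborel.
            \<forall>E. ereal (lyapunov \<alpha> c v E) < beta \<alpha> \<longrightarrow> \<not> is_eigenvalue (H_op \<alpha> c v \<theta>) E)"
proof -
  have loc: "singular_jacobi \<alpha> c v"
    by (rule singular_jacobi.intro) fact+
  note main = singular_jacobi.no_eigenvalue_below_delta[OF loc]
  have "AE \<theta> in lborel. \<forall>E. ereal (lyapunov \<alpha> c v E) < beta \<alpha> \<longrightarrow> \<not> is_eigenvalue (H_op \<alpha> c v \<theta>) E"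
    using singular_jacobi.AE_beta_le_delta[OF loc]
    by eventually_elim (meson main order_less_le_trans)
  thus ?thesis using main by blast
qed

end
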